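(* Let $f(s)$ be an almost periodic function in a vertical strip $U=\{s=\sigma+it:\alpha<\sigma<\beta\}$, where $-\infty\le\alpha<\beta\le\infty$, with Dirichlet series $\sum_{n\ge1}a_ne^{\lambda_ns}$, whose set of Fourier exponents $\{\lambda_1,\lambda_2,\ldots\}$ is linearly independent over $\mathbb{Q}$ and has at least three elements. Let $\sigma_0\in(\alpha,\beta)$. If $\sigma_0$ is a boundary point of $R_f$, then $\sigma_0$ satisfies all the inequalities $$|a_j|e^{\sigma_0\lambda_j}\le\sum_{i\ge1,\ i\ne j}|a_i|e^{\sigma_0\lambda_i}\qquad(j=1,2,\ldots),$$ and exactly one of them is an equality.
   Context: Write $s=\sigma+it$ with $\sigma,t\in\mathbb{R}$. A function $f$, analytic in the vertical strip $U=\{\sigma+it:\alpha<\sigma<\beta\}$, is called almost periodic in $U$ if for every reduced strip $\{\alpha_1\le\sigma\le\beta_1\}$ with $\alpha<\alpha_1<\beta_1<\beta$ and every $\varepsilon>0$ there is $l>0$ such that each interval of length $l$ on the real line contains a number $\tau$ with $|f(s+i\tau)-f(s)|\le\varepsilon$ for all $s$ in the reduced strip. Equivalently, $f$ is a uniform limit, on every reduced strip of $U$, of exponential polynomials $a_1e^{\lambda_1s}+\cdots+a_ne^{\lambda_ns}$ with $a_j\in\mathbb{C}$, $\lambda_j\in\mathbb{R}$. Fourier exponents and Dirichlet series: for $\lambda\in\mathbb{R}$ the number $a(\lambda)=\lim_{T\to\infty}\frac1{2T}\int_{-T}^{T}f(\sigma+it)e^{-\lambda(\sigma+it)}\,dt$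 exists and does not depend on $\sigma\in(\alpha,\beta)$. It is nonzero for at most countably many $\lambda$, called the Fourier exponents of $f$; enumerating them as $\lambda_1,\lambda_2,\ldots$ (distinct; finitely or infinitely many) and putting $a_n=a(\lambda_n)\neq0$, the series $\sum_{n\ge1}a_ne^{\lambda_ns}$ is the Dirichlet series of $f$. It is a known fact that if the Fourier exponents are linearly independent over $\mathbb{Q}$, the Dirichlet series converges absolutely to $f$ in $U$. The set $R_f$ is defined by $R_f:=\overline{\{\operatorname{Re}s: f(s)=0,\ s\in U\}}\cap(\alpha,\beta)$, where the bar denotes closure in $\mathbb{R}$. *)

theory Defs
  imports "HOL-Analysis.Analysis"
begin

definition vertical_strip :: "ereal \<Rightarrow> ereal \<Rightarrow> complex set" where
  "vertical_strip \<alpha> \<beta> = {s. \<alpha> < ereal (Re s) \<and> ereal (Re s) < \<beta>}"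

definition almost_periodic_in_strip :: "(complex \<Rightarrow> complex) \<Rightarrow> ereal \<Rightarrow> ereal \<Rightarrow> bool" where
  "almost_periodic_in_strip f \<alpha> \<beta> \<longleftrightarrow>
     f analytic_on vertical_strip \<alpha> \<beta> \<and>
     (\<forall>\<alpha>\<^sub>1 \<beta>\<^sub>1 \<epsilon> :: real. \<alpha> < ereal \<alpha>\<^sub>1 \<longrightarrow> \<alpha>\<^sub>1 < \<beta>\<^sub>1 \<longrightarrow> ereal \<beta>\<^sub>1 < \<beta> \<longrightarrow> 0 < \<epsilon> \<longrightarrow>
        (\<exists>l>0. \<forall>x::real. \<exists>\<tau>\<in>{x..x+l}. \<forall>s. \<alpha>\<^sub>1 \<le> Re s \<and> Re s \<le> \<beta>\<^sub>1 \<longrightarrow>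
           norm (f (s + \<i> * complex_of_real \<tau>) - f s) \<le> \<epsilon>))"

text \<open>The value is the common limit of the means over all vertical lines in the strip.
  For an almost periodic function this limit exists and is the same on every line; for
  a function without this property the value is unspecified.\<close>

definition fourier_coeff :: "(complex \<Rightarrow> complex) \<Rightarrow> ereal \<Rightarrow> ereal \<Rightarrow> real \<Rightarrow> complex" where
  "fourier_coeff f \<alpha> \<beta> \<mu> =
     (THE a. \<forall>\<sigma>::real. \<alpha> < ereal \<sigma> \<longrightarrow> ereal \<sigma> < \<beta> \<longrightarrow>
        ((\<lambda>T::real. 1 / (2 * complex_of_real T) *
             integral {-T..T} (\<lambda>t. f (Complex \<sigma> t) * exp (- (complex_of_real \<mu> * Complex \<sigma> t))))
          \<longlongrightarrow> a) at_top)"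

definition fourier_exponents :: "(complex \<Rightarrow> complex) \<Rightarrow> ereal \<Rightarrow> ereal \<Rightarrow> real set" where
  "fourier_exponents f \<alpha> \<beta> = {\<mu>. fourier_coeff f \<alpha> \<beta> \<mu> \<noteq> 0}"

text \<open>The Dirichlet series is represented by its index set \<open>I\<close>, coefficients \<open>a\<close> and
  exponents \<open>lam\<close>. Only the values of \<open>a\<close> and \<open>lam\<close> on \<open>I\<close> matter.\<close>

definition is_dirichlet_series ::
  "(complex \<Rightarrow> complex) \<Rightarrow> ereal \<Rightarrow> ereal \<Rightarrow> nat set \<Rightarrow> (nat \<Rightarrow> complex) \<Rightarrow> (nat \<Rightarrow> real) \<Rightarrow> bool" where
  "is_dirichlet_series f \<alpha> \<beta> I a lam \<longleftrightarrow>
     (I = {1..} \<or> (\<exists>N. I = {1..N})) \<and>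
     bij_betw lam I (fourier_exponents f \<alpha> \<beta>) \<and>
     (\<forall>n\<in>I. a n = fourier_coeff f \<alpha> \<beta> (lam n))"

definition zero_abscissas :: "(complex \<Rightarrow> complex) \<Rightarrow> ereal \<Rightarrow> ereal \<Rightarrow> real set" where
  "zero_abscissas f \<alpha> \<beta> =
     closure (Re ` {s \<in> vertical_strip \<alpha> \<beta>. f s = 0}) \<inter> {\<sigma>. \<alpha> < ereal \<sigma> \<and> ereal \<sigma> < \<beta>}"

text \<open>The reals as a vector space over the rationals; its notion
  \<open>real_over_rat.independent\<close> is linear independence over the rationals.\<close>

global_interpretation real_over_rat: vector_space "\<lambda>(q::rat) (x::real). of_rat q * x"
  by unfold_locales (simp_all add: algebra_simps of_rat_add of_rat_mult)

end

(* By Kronecker's theorem, if the exponents are independent, the vertical translates f(s + it)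
approximate every series obtained from the Dirichlet series by multiplying its terms with
arbitrary unimodular constants. With r_n = |a_n| exp(lambda_n sigma), such a series vanishes at
sigma for a suitable choice of the constants iff there is a closed polygon with sides r_n, that is
iff no r_n exceeds the sum of the others. Hurwitz's theorem then produces zeros of f near every
sigma with this property, while one dominating term excludes zeros on nearby lines. The
inequalities depend continuously on sigma, and all but finitely many of them hold trivially near a
given point. So on the boundary of R_f all of them hold and one is an equality. Two equalities
would make all other terms zero.

That the Dirichlet series converges absolutely to f is shown on each vertical line. Testing f
against Riesz products, whose Fourier coefficients on the exponents of f are explicit by
independence, bounds the sum of the moduli of the coefficients. The difference of f and the series
has vanishing Fourier coefficients, and is zero by the uniqueness theorem for almost periodic
functions. The latter follows by sampling F at N points of a long interval [0, T]: the discrete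
Fourier coefficients are uniformly small, whereas their fourth moment, the mean square of the cyclic
autocorrelation of F, stays bounded away from zero because F has many almost periods. *)
theory Submission
  imports Defs "HOL-Complex_Analysis.Complex_Analysis"
begin

text \<open>In the uniqueness theorem the order of choices is the obstacle. The lower bound for the
  largest discrete coefficient comes from proportions of almost periods, which depend neither on the
  number of samples nor on their spacing. So it is fixed before the length of the interval and the
  number of samples. Low discrete frequencies are then Riemann sums of true averages, small
  uniformly on a bounded range of frequencies. High ones are handled by summation by parts, for
  which the function has to be Lipschitz: for f on a line this is Cauchy's estimate, for the series
  it comes from absolute convergence on two neighbouring lines.

  Kronecker's theorem controls only finitely many exponents at a time. The others are controlled on
  a whole closed strip at once by the terms on its two edges, because exp(mu x) is at most the sum
  of its values at the two ends. This makes the approximation by translates uniform on a strip, as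
  Hurwitz's theorem requires.

  Sums run over the set of exponents itself; the enumeration enters only in the last proof.\<close>

section \<open>Almost periodic functions on the real line\<close>

text \<open>This is Bochner's condition: the translates of \<open>F\<close> are totally bounded in the uniform norm.
  In the form of a finite colouring of the translations, closure under sums and products only
  requires combining two colourings.\<close>

definition ap :: "(real \<Rightarrow> complex) \<Rightarrow> bool" where
  "ap F \<longleftrightarrow> continuous_on UNIV F \<and>
     (\<forall>\<epsilon>>0. \<exists>c::real \<Rightarrow> nat. finite (range c) \<and>
        (\<forall>x y. c x = c y \<longrightarrow> (\<forall>t. norm (F (t + x) - F (t + y)) \<le> \<epsilon>)))"

lemma apE:
  assumes "ap F" "\<epsilon> > 0"
  obtains c :: "real \<Rightarrow> nat" where "finite (range c)"
    "\<And>x y t. c x = c y \<Longrightarrow> norm (F (t + x) - F (t + y)) \<le> \<epsilon>"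
  using assms unfolding ap_def by meson

lemma ap_continuous: "ap F \<Longrightarrow> continuous_on A F"
  unfolding ap_def using continuous_on_subset by blast

lemma ap_integrable: "ap F \<Longrightarrow> F integrable_on {a..b::real}"
  by (intro integrable_continuous_real ap_continuous)

text \<open>One representative per colour makes a finite, hence bounded, set. If \<open>c\<close> is
  a colouring as in \<open>ap\<close>, the number \<open>x - r x\<close> is an almost period at
  distance at most \<open>K\<close> from \<open>x\<close>.\<close>

lemma finite_colouring_representatives:
  fixes c :: "real \<Rightarrow> nat"
  assumes "finite (range c)"
  obtains K r where "K > 0" "\<And>x. c (r x) = c x" "\<And>x. \<bar>r x\<bar> \<le> K"
proof -
  define r where "r = (\<lambda>x. inv c (c x))"
  have "r ` UNIV \<subseteq> inv c ` range c" by (auto simp: r_def)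
  then have "finite (range r)" using assms finite_subset by blast
  then obtain K where K: "\<And>x. \<bar>r x\<bar> \<le> K"
    using finite_imp_bounded[of "range r"] by (auto simp: bounded_iff)
  show thesis
  proof (rule that[of "max K 1" r])
    show "c (r x) = c x" for x by (simp add: r_def f_inv_into_f)
    show "\<bar>r x\<bar> \<le> max K 1" for x using K[of x] by simp
  qed simp
qed

lemma ap_relatively_dense:
  assumes "ap F" "\<epsilon> > 0"
  obtains l where "l > 0" "\<And>x. \<exists>p\<in>{x..x+l}. \<forall>t. norm (F (t + p) - F t) \<le> \<epsilon>"
proof -
  obtain c :: "real \<Rightarrow> nat" where c: "finite (range c)"
    "\<And>x y t. c x = c y \<Longrightarrow> norm (F (t + x) - F (t + y)) \<le> \<epsilon>"
    using apE[OF assms] by metis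
  obtain K r where r: "K > 0" "\<And>x. c (r x) = c x" "\<And>x. \<bar>r x\<bar> \<le> K"
    using finite_colouring_representatives[OF c(1)] by metis
  show thesis
  proof (rule that[of "2*K"])
    fix x
    \<comment> \<open>The representative lies in [-K, K], so starting from x + K puts the almost
      period into [x, x + 2K].\<close>
    let ?p = "(x + K) - r (x + K)"
    have "norm (F (t + ?p) - F t) \<le> \<epsilon>" for t
      using c(2)[OF r(2)[of "x+K", symmetric], of "t - r (x + K)"] by (simp add: algebra_simps)
    moreover have "?p \<in> {x..x+2*K}" using r(3)[of "x+K"] by (auto simp: abs_le_iff)
    ultimately show "\<exists>p\<in>{x..x+2*K}. \<forall>t. norm (F (t + p) - F t) \<le> \<epsilon>" by blast
  qed (use r in simp)
qed

text \<open>An almost period brings any \<open>t\<close> into the compact interval [0, l] and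
  changes the value by at most 1.\<close>

lemma bohr_bounded:
  fixes F :: "real \<Rightarrow> complex"
  assumes F: "continuous_on UNIV F"
    and bohr: "\<And>\<epsilon>. \<epsilon> > 0 \<Longrightarrow> \<exists>l>0. \<forall>x. \<exists>p\<in>{x..x+l}. \<forall>t. norm (F (t + p) - F t) \<le> \<epsilon>"
  obtains B where "B > 0" "\<And>t. norm (F t) \<le> B"
proof -
  obtain l where l: "l > 0" "\<And>x. \<exists>p\<in>{x..x+l}. \<forall>t. norm (F (t + p) - F t) \<le> 1"
    using bohr[of 1] by auto
  have "compact (F ` {0..l})"
    by (intro compact_continuous_image continuous_on_subset[OF F]) auto
  then have "bounded (F ` {0..l})" by (rule compact_imp_bounded)
  then obtain C where C: "\<And>t. t \<in> {0..l} \<Longrightarrow> norm (F t) \<le> C"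
    unfolding bounded_iff by blast
  have "norm (F t) \<le> max C 0 + 1" for t
  proof -
    obtain p where p: "p \<in> {-t..-t+l}" "\<And>t. norm (F (t + p) - F t) \<le> 1" using l(2) by blast
    have "norm (F (t + p)) \<le> C" using p by (intro C) auto
    then show ?thesis using p(2)[of t] norm_triangle_ineq2[of "F t" "F (t+p)"]
      by (simp add: norm_minus_commute)
  qed
  then show thesis by (intro that[of "max C 0 + 1"]) auto
qed

text \<open>A single almost period moves both points into a compact interval, where \<open>F\<close>
  is uniformly continuous.\<close>

lemma bohr_uniformly_continuous:
  fixes F :: "real \<Rightarrow> complex"
  assumes F: "continuous_on UNIV F"
    and bohr: "\<And>\<epsilon>. \<epsilon> > 0 \<Longrightarrow> \<exists>l>0. \<forall>x. \<exists>p\<in>{x..x+l}. \<forall>t. norm (F (t + p) - F t) \<le> \<epsilon>"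
    and "\<epsilon> > 0"
  obtains d where "d > 0" "\<And>s t. \<bar>s - t\<bar> < d \<Longrightarrow> norm (F s - F t) \<le> \<epsilon>"
proof -
  obtain l where l: "l > 0" "\<And>x. \<exists>p\<in>{x..x+l}. \<forall>t. norm (F (t + p) - F t) \<le> \<epsilon>/3"
    using bohr[of "\<epsilon>/3"] \<open>\<epsilon> > 0\<close> by auto
  \<comment> \<open>The point \<open>t\<close> is moved into [0, l]; the margin 1 on both sides
    makes room for \<open>s\<close>, which is kept closer than 1 to \<open>t\<close>.\<close>
  have "uniformly_continuous_on {-1..l+1} F"
    by (intro compact_uniformly_continuous continuous_on_subset[OF F]) auto
  then obtain d where d: "d > 0" "\<And>s t. s \<in> {-1..l+1} \<Longrightarrow> t \<in> {-1..l+1} \<Longrightarrow> dist s t < d \<Longrightarrow> dist (F s) (F t) < \<epsilon>/3"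
    using \<open>\<epsilon> > 0\<close> unfolding uniformly_continuous_on_def by (metis (no_types, lifting) divide_pos_pos zero_less_numeral)
  show thesis
  proof (rule that[of "min d 1"])
    fix s t :: real assume st: "\<bar>s - t\<bar> < min d 1"
    obtain p where p: "p \<in> {-t..-t+l}" "\<And>t. norm (F (t + p) - F t) \<le> \<epsilon>/3" using l(2) by blast
    have "dist (F (s+p)) (F (t+p)) < \<epsilon>/3"
      by (intro d) (use st p(1) in \<open>auto simp: dist_real_def\<close>)
    moreover have "F s - F t = (F (s+p) - F (t+p)) - (F (s+p) - F s) + (F (t+p) - F t)" by simp
    ultimately show "norm (F s - F t) \<le> \<epsilon>"
      using p(2)[of s] p(2)[of t] norm_triangle_ineq4[of "F (s+p) - F (t+p)" "F (s+p) - F s"]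
        norm_triangle_ineq[of "(F (s+p) - F (t+p)) - (F (s+p) - F s)" "F (t+p) - F t"]
      by (simp add: dist_norm)
  qed (use d in simp)
qed

text \<open>Each translation is an almost period plus a remainder in [0, l]. By uniform continuity
  the cell of length \<open>d\<close> that contains the remainder can serve as the colour.\<close>

lemma bohr_imp_ap:
  fixes F :: "real \<Rightarrow> complex"
  assumes F: "continuous_on UNIV F"
    and bohr: "\<And>\<epsilon>. \<epsilon> > 0 \<Longrightarrow> \<exists>l>0. \<forall>x. \<exists>p\<in>{x..x+l}. \<forall>t. norm (F (t + p) - F t) \<le> \<epsilon>"
  shows "ap F"
  unfolding ap_def
proof (intro conjI F allI impI)
  fix \<epsilon> :: real assume "\<epsilon> > 0"
  obtain l where l: "l > 0" "\<And>x. \<exists>p\<in>{x..x+l}. \<forall>t. norm (F (t + p) - F t) \<le> \<epsilon>/3"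
    using bohr[of "\<epsilon>/3"] \<open>\<epsilon> > 0\<close> by auto
  obtain d where d: "d > 0" "\<And>s t. \<bar>s - t\<bar> < d \<Longrightarrow> norm (F s - F t) \<le> \<epsilon>/3"
    using bohr_uniformly_continuous[OF F bohr, of "\<epsilon>/3"] \<open>\<epsilon> > 0\<close> by auto
  \<comment> \<open>With the almost period in [x - l, x] the remainder \<open>x - p x\<close> is
    nonnegative, so \<open>nat\<close> loses nothing in the colour.\<close>
  obtain p where p: "\<And>x. p x \<in> {x-l..x-l+l}" "\<And>x t. norm (F (t + p x) - F t) \<le> \<epsilon>/3"
    using l(2)[of "x - l" for x] by metis
  define c where "c = (\<lambda>x. nat \<lfloor>(x - p x) / d\<rfloor>)"
  show "\<exists>c::real \<Rightarrow> nat. finite (range c) \<and> (\<forall>x y. c x = c y \<longrightarrow> (\<forall>t. norm (F (t + x) - F (t + y)) \<le> \<epsilon>))"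
  proof (intro exI[of _ c] conjI allI impI)
    have "c x \<le> nat \<lfloor>l/d\<rfloor>" for x
      unfolding c_def using p(1)[of x] d(1) by (intro nat_mono floor_mono divide_right_mono) auto
    then have "range c \<subseteq> {..nat \<lfloor>l/d\<rfloor>}" by auto
    then show "finite (range c)" using finite_subset by blast
  next
    fix x y t assume eq: "c x = c y"
    have nn: "(x - p x)/d \<ge> 0" "(y - p y)/d \<ge> 0" using p(1)[of x] p(1)[of y] d(1) by auto
    then have "\<lfloor>(x - p x)/d\<rfloor> = \<lfloor>(y - p y)/d\<rfloor>" using eq unfolding c_def
      by (simp add: nat_eq_iff2)
    then have "\<bar>(x - p x)/d - (y - p y)/d\<bar> < 1" by linarith
    then have "\<bar>(x - p x) - (y - p y)\<bar> < d"
      using d(1) by (simp add: diff_divide_distrib[symmetric] field_simps)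
    then have 1: "norm (F (t + (x - p x)) - F (t + (y - p y))) \<le> \<epsilon>/3" by (intro d(2)) auto
    have 2: "norm (F (t + x) - F (t + (x - p x))) \<le> \<epsilon>/3" using p(2)[of "t + (x - p x)" x] by simp
    have 3: "norm (F (t + y) - F (t + (y - p y))) \<le> \<epsilon>/3" using p(2)[of "t + (y - p y)" y] by simp
    let ?a = "F (t + x) - F (t + (x - p x))" and ?b = "F (t + (x - p x)) - F (t + (y - p y))"
      and ?c = "F (t + y) - F (t + (y - p y))"
    have "F (t + x) - F (t + y) = ?a + ?b - ?c" by simp
    then show "norm (F (t + x) - F (t + y)) \<le> \<epsilon>"
      using 1 2 3 norm_triangle_ineq[of ?a ?b] norm_triangle_ineq4[of "?a + ?b" ?c] by simp
  qed
qed

lemma ap_bounded: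
  assumes "ap F"
  obtains B where "B > 0" "\<And>t. norm (F t) \<le> B"
proof -
  have "\<exists>l>0. \<forall>x. \<exists>p\<in>{x..x+l}. \<forall>t. norm (F (t + p) - F t) \<le> \<epsilon>" if "\<epsilon> > 0" for \<epsilon>
    using ap_relatively_dense[OF assms that] by metis
  then show thesis using bohr_bounded[OF ap_continuous[OF assms]] that by blast
qed

lemma ap_colouring2:
  assumes "ap F" "ap G" "\<epsilon> > 0"
  obtains c :: "real \<Rightarrow> nat" where "finite (range c)"
    "\<And>x y t. c x = c y \<Longrightarrow> norm (F (t + x) - F (t + y)) \<le> \<epsilon>"
    "\<And>x y t. c x = c y \<Longrightarrow> norm (G (t + x) - G (t + y)) \<le> \<epsilon>"
proof -
  obtain c :: "real \<Rightarrow> nat" where c: "finite (range c)"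
    "\<And>x y t. c x = c y \<Longrightarrow> norm (F (t + x) - F (t + y)) \<le> \<epsilon>"
    using apE[OF assms(1,3)] by metis
  obtain d :: "real \<Rightarrow> nat" where d: "finite (range d)"
    "\<And>x y t. d x = d y \<Longrightarrow> norm (G (t + x) - G (t + y)) \<le> \<epsilon>"
    using apE[OF assms(2,3)] by metis
  let ?e = "\<lambda>x. prod_encode (c x, d x)"
  have "range ?e \<subseteq> prod_encode ` (range c \<times> range d)" by auto
  then have "finite (range ?e)" using c(1) d(1) finite_subset by blast
  then show thesis using c(2) d(2) by (intro that[of ?e]) auto
qed

lemma ap_add:
  assumes "ap F" "ap G" shows "ap (\<lambda>t. F t + G t)"
  unfolding ap_def
proof (intro conjI allI impI)
  show "continuous_on UNIV (\<lambda>t. F t + G t)" by (intro continuous_intros ap_continuous assms)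
  fix \<epsilon> :: real assume "\<epsilon> > 0"
  then obtain c :: "real \<Rightarrow> nat" where c: "finite (range c)"
    "\<And>x y t. c x = c y \<Longrightarrow> norm (F (t + x) - F (t + y)) \<le> \<epsilon>/2"
    "\<And>x y t. c x = c y \<Longrightarrow> norm (G (t + x) - G (t + y)) \<le> \<epsilon>/2"
    using ap_colouring2[OF assms, of "\<epsilon>/2"] by (metis half_gt_zero)
  have "norm (F (t + x) + G (t + x) - (F (t + y) + G (t + y))) \<le> \<epsilon>" if "c x = c y" for x y t
    using norm_triangle_ineq[of "F (t + x) - F (t + y)" "G (t + x) - G (t + y)"] c(2,3)[OF that, of t]
    by (simp add: algebra_simps)
  then show "\<exists>c::real \<Rightarrow> nat. finite (range c) \<and> (\<forall>x y. c x = c y \<longrightarrow>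
      (\<forall>t. norm (F (t + x) + G (t + x) - (F (t + y) + G (t + y))) \<le> \<epsilon>))"
    using c(1) by blast
qed

lemma ap_mult:
  assumes "ap F" "ap G" shows "ap (\<lambda>t. F t * G t)"
  unfolding ap_def
proof (intro conjI allI impI)
  show "continuous_on UNIV (\<lambda>t. F t * G t)" by (intro continuous_intros ap_continuous assms)
  fix \<epsilon> :: real assume "\<epsilon> > 0"
  obtain B where B: "B > 0" "\<And>t. norm (F t) \<le> B" using ap_bounded[OF assms(1)] by metis
  obtain C where C: "C > 0" "\<And>t. norm (G t) \<le> C" using ap_bounded[OF assms(2)] by metis
  define e where "e = \<epsilon> / (B + C)"
  have e: "e > 0" "e * (B + C) = \<epsilon>" using B C \<open>\<epsilon> > 0\<close> by (auto simp: e_def)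
  obtain c :: "real \<Rightarrow> nat" where c: "finite (range c)"
    "\<And>x y t. c x = c y \<Longrightarrow> norm (F (t + x) - F (t + y)) \<le> e"
    "\<And>x y t. c x = c y \<Longrightarrow> norm (G (t + x) - G (t + y)) \<le> e"
    using ap_colouring2[OF assms e(1)] by metis
  have "norm (F (t + x) * G (t + x) - F (t + y) * G (t + y)) \<le> \<epsilon>" if "c x = c y" for x y t
  proof -
    have "F (t + x) * G (t + x) - F (t + y) * G (t + y)
        = F (t + x) * (G (t + x) - G (t + y)) + (F (t + x) - F (t + y)) * G (t + y)"
      by (simp add: algebra_simps)
    also have "norm \<dots> \<le> B * e + e * C"
      by (rule norm_triangle_le, unfold norm_mult, intro add_mono mult_mono)
        (use B C c(2,3)[OF that] e in auto)
    also have "\<dots> = \<epsilon>" using e(2) by (simp add: algebra_simps)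
    finally show ?thesis .
  qed
  then show "\<exists>c::real \<Rightarrow> nat. finite (range c) \<and> (\<forall>x y. c x = c y \<longrightarrow>
      (\<forall>t. norm (F (t + x) * G (t + x) - F (t + y) * G (t + y)) \<le> \<epsilon>))"
    using c(1) by blast
qed

lemma ap_const: "ap (\<lambda>t. z)"
  unfolding ap_def by (auto intro!: exI[of _ "\<lambda>_. 0"])

lemma ap_uniform_limit:
  assumes "\<And>\<epsilon>. \<epsilon> > 0 \<Longrightarrow> \<exists>G. ap G \<and> (\<forall>t. norm (F t - G t) \<le> \<epsilon>)"
  shows "ap F"
  unfolding ap_def
proof (intro conjI allI impI)
  fix \<epsilon> :: real assume "\<epsilon> > 0"
  then obtain G where G: "ap G" "\<And>t. norm (F t - G t) \<le> \<epsilon>/3"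
    using assms[of "\<epsilon>/3"] by auto
  obtain c :: "real \<Rightarrow> nat" where c: "finite (range c)"
    "\<And>x y t. c x = c y \<Longrightarrow> norm (G (t + x) - G (t + y)) \<le> \<epsilon>/3"
    using apE[OF G(1), of "\<epsilon>/3"] \<open>\<epsilon> > 0\<close> by (metis divide_pos_pos zero_less_numeral)
  have "norm (F (t + x) - F (t + y)) \<le> \<epsilon>" if "c x = c y" for x y t
  proof -
    let ?a = "F (t+x) - G (t+x)" and ?b = "G (t+x) - G (t+y)" and ?c = "F (t+y) - G (t+y)"
    have "F (t + x) - F (t + y) = ?a + ?b - ?c" by simp
    then show ?thesis
      using G(2)[of "t+x"] c(2)[OF that, of t] G(2)[of "t+y"]
        norm_triangle_ineq[of ?a ?b] norm_triangle_ineq4[of "?a + ?b" ?c] by simp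
  qed
  then show "\<exists>c::real \<Rightarrow> nat. finite (range c) \<and> (\<forall>x y. c x = c y \<longrightarrow>
      (\<forall>t. norm (F (t + x) - F (t + y)) \<le> \<epsilon>))" using c(1) by blast
next
  have "\<forall>n. \<exists>G. ap G \<and> (\<forall>t. norm (F t - G t) \<le> 1 / real (Suc n))" using assms by simp
  then obtain G where G: "\<And>n. ap (G n)" "\<And>n t. norm (F t - G n t) \<le> 1 / real (Suc n)" by metis
  have "uniform_limit UNIV G F sequentially"
  proof (rule uniform_limitI)
    fix e :: real assume "e > 0"
    then obtain N where N: "1 / real (Suc N) < e" by (metis nat_approx_posE)
    show "\<forall>\<^sub>F n in sequentially. \<forall>x\<in>UNIV. dist (G n x) (F x) < e"
    proof (rule eventually_sequentiallyI[of N], intro ballI)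
      fix n x assume "N \<le> n"
      then have "1 / real (Suc n) \<le> 1 / real (Suc N)" by (intro divide_left_mono) auto
      then show "dist (G n x) (F x) < e" using G(2)[of x n] N by (simp add: dist_norm norm_minus_commute)
    qed
  qed
  then show "continuous_on UNIV F"
    by (rule uniform_limit_theorem[rotated]) (auto intro!: always_eventually ap_continuous G(1))
qed

text \<open>Multiples of the period 2 pi / |mu| are almost periods with error zero, and each
  interval of that length contains one.\<close>

lemma ap_cis: "ap (\<lambda>t. cis (\<mu> * t))"
proof (rule bohr_imp_ap)
  show "continuous_on UNIV (\<lambda>t. cis (\<mu> * t))" by (intro continuous_intros)
  fix \<epsilon> :: real assume "\<epsilon> > 0"
  show "\<exists>l>0. \<forall>x. \<exists>p\<in>{x..x+l}. \<forall>t. norm (cis (\<mu> * (t + p)) - cis (\<mu> * t)) \<le> \<epsilon>"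
  proof (cases "\<mu> = 0")
    case True
    then have "\<exists>p\<in>{x..x+1}. \<forall>t. norm (cis (\<mu> * (t + p)) - cis (\<mu> * t)) \<le> \<epsilon>" for x
      using \<open>\<epsilon> > 0\<close> by (intro bexI[of _ x]) auto
    then show ?thesis using zero_less_one by blast
  next
    case False
    define q where "q = 2 * pi / \<bar>\<mu>\<bar>"
    have q: "q > 0" using False by (auto simp: q_def)
    have "\<exists>p\<in>{x..x+q}. \<forall>t. norm (cis (\<mu> * (t + p)) - cis (\<mu> * t)) \<le> \<epsilon>" for x
    proof
      define k where "k = \<lceil>x / q\<rceil>"
      have k: "x \<le> of_int k * q" "of_int k * q \<le> x + q"
      proof -
        have "x / q \<le> of_int k" "of_int k \<le> x / q + 1" unfolding k_def by linarith+
        then show "x \<le> of_int k * q" "of_int k * q \<le> x + q" using q by (auto simp: field_simps)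
      qed
      then show "of_int k * q \<in> {x..x+q}" by auto
      have "\<mu> * (of_int k * q) = (if \<mu> > 0 then 2 * pi * of_int k else 2 * pi * of_int (- k))"
        using False by (auto simp: q_def)
      then have "cis (\<mu> * (of_int k * q)) = 1"
        by (metis cis_multiple_2pi Ints_of_int)
      then have "cis (\<mu> * (t + of_int k * q)) = cis (\<mu> * t)" for t
        by (simp only: ring_distribs cis_mult[symmetric]) simp
      then show "\<forall>t. norm (cis (\<mu> * (t + of_int k * q)) - cis (\<mu> * t)) \<le> \<epsilon>" using \<open>\<epsilon> > 0\<close> by simp
    qed
    then show ?thesis using q by blast
  qed
qed

subsection \<open>Mean values\<close>

definition avg :: "(real \<Rightarrow> complex) \<Rightarrow> real \<Rightarrow> real \<Rightarrow> complex" where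
  "avg F x T = integral {x..x+T} F / of_real T"

text \<open>Uniformity in the starting point \<open>x\<close> is built in: it allows windows to be
  joined, translated and centred at 0.\<close>

definition has_mean :: "(real \<Rightarrow> complex) \<Rightarrow> complex \<Rightarrow> bool" where
  "has_mean F a \<longleftrightarrow> (\<forall>\<epsilon>>0. \<exists>T\<^sub>0>0. \<forall>T\<ge>T\<^sub>0. \<forall>x. norm (avg F x T - a) \<le> \<epsilon>)"

lemma norm_integral_le:
  fixes F :: "real \<Rightarrow> complex"
  assumes "continuous_on {a..b} F" "\<And>t. t \<in> {a..b} \<Longrightarrow> norm (F t) \<le> B" "a \<le> b"
  shows "norm (integral {a..b} F) \<le> B * (b - a)"
  by (rule integral_bound[OF assms(3,1,2)])

lemma norm_avg_le:
  assumes "ap F" "\<And>t. norm (F t) \<le> B" "T > 0"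
  shows "norm (avg F x T) \<le> B"
  using norm_integral_le[OF ap_continuous[OF assms(1)], of x "x+T" B] assms(2,3)
  by (simp add: avg_def norm_divide divide_le_eq)

lemma integral_translate:
  fixes F :: "real \<Rightarrow> complex"
  assumes "continuous_on UNIV F"
  shows "integral {a+u..b+u} F = integral {a..b} (\<lambda>t. F (t + u))"
proof -
  have "(F has_integral integral {a+u..b+u} F) (cbox (a+u) (b+u))"
    using integrable_continuous_real[OF continuous_on_subset[OF assms]] by (simp add: has_integral_iff)
  from has_integral_affinity'[OF this, of 1 u] show ?thesis by (simp add: integral_unique add.commute)
qed

lemma avg_translate: "ap F \<Longrightarrow> avg F (x + u) T = avg (\<lambda>t. F (t + u)) x T"
  using integral_translate[of F x u "x + T"] by (simp add: avg_def ap_continuous add_ac)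

lemma ap_translate: "ap F \<Longrightarrow> ap (\<lambda>t. F (t + u))"
  unfolding ap_def
proof (elim conjE, intro conjI allI impI)
  assume "continuous_on UNIV F"
  then show "continuous_on UNIV (\<lambda>t. F (t + u))"
    by (rule continuous_on_compose2) (auto intro!: continuous_intros)
  fix \<epsilon> :: real assume "\<epsilon> > 0" and h: "\<forall>\<epsilon>>0. \<exists>c::real \<Rightarrow> nat. finite (range c) \<and>
        (\<forall>x y. c x = c y \<longrightarrow> (\<forall>t. norm (F (t + x) - F (t + y)) \<le> \<epsilon>))"
  then obtain c :: "real \<Rightarrow> nat" where c: "finite (range c)"
      "\<And>x y t. c x = c y \<Longrightarrow> norm (F (t + x) - F (t + y)) \<le> \<epsilon>" by meson
  have "norm (F (t + x + u) - F (t + y + u)) \<le> \<epsilon>" if "c x = c y" for x y t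
    using c(2)[OF that, of "t + u"] by (simp add: add_ac)
  then show "\<exists>c::real \<Rightarrow> nat. finite (range c) \<and> (\<forall>x y. c x = c y \<longrightarrow>
       (\<forall>t. norm (F (t + x + u) - F (t + y + u)) \<le> \<epsilon>))" using c(1) by blast
qed

lemma avg_diff:
  assumes "ap F" "ap G"
  shows "avg (\<lambda>t. F t - G t) x T = avg F x T - avg G x T"
  using integral_diff[OF ap_integrable[OF assms(1)] ap_integrable[OF assms(2)]]
  by (simp add: avg_def diff_divide_distrib)

lemma avg_add:
  assumes "ap F" "ap G"
  shows "avg (\<lambda>t. F t + G t) x T = avg F x T + avg G x T"
  using integral_add[OF ap_integrable[OF assms(1)] ap_integrable[OF assms(2)]]
  by (simp add: avg_def add_divide_distrib)

lemma ap_cmult: "ap F \<Longrightarrow> ap (\<lambda>t. z * F t)"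
  by (rule ap_mult[OF ap_const])

lemma ap_diff: "ap F \<Longrightarrow> ap G \<Longrightarrow> ap (\<lambda>t. F t - G t)"
  using ap_add[OF _ ap_cmult[of G "-1"]] by simp

lemma norm_avg_diff_le:
  assumes "ap F" "ap G" "\<And>t. norm (F t - G t) \<le> e" "T > 0"
  shows "norm (avg F x T - avg G x T) \<le> e"
  using norm_avg_le[OF ap_diff[OF assms(1,2)] assms(3,4)] by (simp add: avg_diff assms)

lemma avg_shift_le:
  assumes "ap F" "\<And>t. norm (F t) \<le> B" "T > 0"
  shows "norm (avg F x T - avg F y T) \<le> 2 * B * \<bar>x - y\<bar> / T"
proof -
  have *: "norm (integral {x..x+T} F - integral {y..y+T} F) \<le> 2 * B * (y - x)" if "x \<le> y" for x y
  proof -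
    have i: "F integrable_on {a..b}" for a b by (rule ap_integrable[OF assms(1)])
    have "integral {x..y} F + integral {y..y+T} F = integral {x..y+T} F"
      using that assms(3) by (intro Henstock_Kurzweil_Integration.integral_combine i) auto
    moreover have "integral {x..x+T} F + integral {x+T..y+T} F = integral {x..y+T} F"
      using that assms(3) by (intro Henstock_Kurzweil_Integration.integral_combine i) auto
    moreover have "a - b = c - d" if "c + b = e" "a + d = e" for a b c d e :: complex
      using that by (auto simp: algebra_simps)
    ultimately have "integral {x..x+T} F - integral {y..y+T} F = integral {x..y} F - integral {x+T..y+T} F"
      by blast
    also have "norm \<dots> \<le> B * (y - x) + B * ((y+T) - (x+T))"
      by (intro norm_triangle_le_diff add_mono norm_integral_le ap_continuous[OF assms(1)])
        (use that assms in auto)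
    finally show ?thesis by (simp add: algebra_simps)
  qed
  have "norm (integral {x..x+T} F - integral {y..y+T} F) \<le> 2 * B * \<bar>x - y\<bar>"
    using *[of x y] *[of y x] by (cases "x \<le> y") (auto simp: norm_minus_commute)
  then show ?thesis using assms(3)
    by (simp add: avg_def diff_divide_distrib[symmetric] norm_divide divide_right_mono)
qed

text \<open>Replacing \<open>x\<close> by the representative of its colour changes the translate of
  \<open>F\<close> by at most epsilon/4 everywhere. The representative is bounded independently of
  \<open>x\<close>, so a long window hardly notices it.\<close>

lemma avg_uniform:
  assumes "ap F" "\<epsilon> > 0"
  obtains T\<^sub>0 where "T\<^sub>0 > 0" "\<And>T x y. T \<ge> T\<^sub>0 \<Longrightarrow> norm (avg F x T - avg F y T) \<le> \<epsilon>"
proof -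
  obtain B where B: "B > 0" "\<And>t. norm (F t) \<le> B" using ap_bounded[OF assms(1)] by metis
  obtain c :: "real \<Rightarrow> nat" where c: "finite (range c)"
    "\<And>x y t. c x = c y \<Longrightarrow> norm (F (t + x) - F (t + y)) \<le> \<epsilon>/4"
    using apE[OF assms(1), of "\<epsilon>/4"] assms(2) by (metis divide_pos_pos zero_less_numeral)
  obtain K r where r: "K > 0" "\<And>x. c (r x) = c x" "\<And>x. \<bar>r x\<bar> \<le> K"
    using finite_colouring_representatives[OF c(1)] by metis
  \<comment> \<open>Moving the start of the window by at most \<open>K\<close> costs 2 B K / T,
    which is at most epsilon/4 from here on.\<close>
  define T\<^sub>0 where "T\<^sub>0 = 8 * B * K / \<epsilon>"
  have T0: "T\<^sub>0 > 0" using B r assms by (auto simp: T\<^sub>0_def)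
  have *: "norm (avg F x T - avg F 0 T) \<le> \<epsilon>/2" if "T \<ge> T\<^sub>0" for T x
  proof -
    have T: "T > 0" using that T0 by simp
    have "norm (avg F (0 + x) T - avg F (0 + r x) T) \<le> \<epsilon>/4"
      unfolding avg_translate[OF assms(1)]
      using c(2)[of x "r x"] r(2) by (intro norm_avg_diff_le ap_translate assms T) auto
    moreover have "norm (avg F (r x) T - avg F 0 T) \<le> \<epsilon>/4"
    proof -
      have "norm (avg F (r x) T - avg F 0 T) \<le> 2 * B * \<bar>r x - 0\<bar> / T"
        by (rule avg_shift_le[OF assms(1) B(2) T])
      also have "\<dots> \<le> 2 * B * K / T\<^sub>0"
        using T T0 that B r(3)[of x] r(1) by (intro frac_le mult_left_mono) auto
      also have "\<dots> = \<epsilon>/4" using B r assms by (simp add: T\<^sub>0_def)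
      finally show ?thesis .
    qed
    ultimately show ?thesis using norm_triangle_ineq[of "avg F x T - avg F (r x) T" "avg F (r x) T - avg F 0 T"]
      by simp
  qed
  show thesis
  proof (rule that[OF T0])
    fix T x y assume "T \<ge> T\<^sub>0"
    then show "norm (avg F x T - avg F y T) \<le> \<epsilon>"
      using *[of T x] *[of T y] norm_triangle_ineq4[of "avg F x T - avg F 0 T" "avg F y T - avg F 0 T"] by simp
  qed
qed

lemma integral_blocks:
  fixes F :: "real \<Rightarrow> complex"
  assumes "continuous_on UNIV F" "h \<ge> 0"
  shows "integral {x..x + real n * h} F = (\<Sum>k<n. integral {x + real k * h..x + real k * h + h} F)"
proof (induction n)
  case (Suc n)
  have "integral {x..x + real n * h} F + integral {x + real n * h..x + real (Suc n) * h} F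
      = integral {x..x + real (Suc n) * h} F"
    using assms(2) by (intro Henstock_Kurzweil_Integration.integral_combine integrable_continuous_real
      continuous_on_subset[OF assms(1)]) (auto intro!: mult_right_mono)
  then show ?case using Suc by (simp add: algebra_simps)
qed simp

text \<open>A window of length nT is composed of n windows of length T with different starting
  points, hence the hypothesis for all \<open>y\<close>.\<close>

lemma avg_multiple_le:
  assumes "ap F" "T > 0" "n > 0" "\<And>y. norm (avg F y T - a) \<le> e"
  shows "norm (avg F x (real n * T) - a) \<le> e"
proof -
  have "avg F x (real n * T) - a = (\<Sum>k<n. (avg F (x + real k * T) T - a)) / of_nat n"
    using assms(2,3) integral_blocks[OF ap_continuous[OF assms(1)], of T x n]
    by (simp add: avg_def sum_subtractf field_simps sum_divide_distrib[symmetric])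
  also have "norm \<dots> \<le> (\<Sum>k<n. e) / real n"
    unfolding norm_divide using assms(3,4) by (intro divide_mono order.trans[OF norm_sum] sum_mono) auto
  finally show ?thesis using assms(3) by simp
qed

lemma avg_extend_le:
  assumes "ap F" "\<And>t. norm (F t) \<le> B" "0 < S" "S \<le> T"
  shows "norm (avg F x T - avg F x S) \<le> 2 * B * (T - S) / T"
proof -
  have i: "F integrable_on {a..b}" for a b by (rule ap_integrable[OF assms(1)])
  have "integral {x..x+S} F + integral {x+S..x+T} F = integral {x..x+T} F"
    using assms(3,4) by (intro Henstock_Kurzweil_Integration.integral_combine i) auto
  then have "of_real S * avg F x S + integral {x+S..x+T} F = of_real T * avg F x T"
    using assms(3,4) by (simp add: avg_def)
  then have "(avg F x T - avg F x S) * of_real T = integral {x+S..x+T} F - (of_real (T - S)) * avg F x S"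
    by (simp add: algebra_simps)
  then have "avg F x T - avg F x S = (integral {x+S..x+T} F - (of_real (T - S)) * avg F x S) / of_real T"
    using assms(3,4) by (simp add: eq_divide_eq)
  also have "norm \<dots> \<le> (B * ((x+T) - (x+S)) + (T - S) * B) / T"
  proof -
    have "norm (integral {x+S..x+T} F - (of_real (T - S)) * avg F x S) \<le> B * ((x+T) - (x+S)) + (T - S) * B"
      using assms norm_avg_le[OF assms(1,2,3), of x]
      by (intro norm_triangle_le_diff add_mono norm_integral_le ap_continuous[OF assms(1)])
        (auto simp: norm_mult simp del: of_real_diff intro!: mult_left_mono)
    then show ?thesis using assms by (simp add: norm_divide divide_right_mono)
  qed
  finally show ?thesis by (simp add: algebra_simps)
qed

text \<open>Take \<open>T\<close> such that averages over length \<open>T\<close> hardly depend on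
  the position. A long window is filled by such windows up to a remainder shorter than
  \<open>T\<close>, so all long averages are close to one number.\<close>

lemma ap_has_mean:
  assumes "ap F"
  obtains a where "has_mean F a"
proof -
  obtain B where B: "B > 0" "\<And>t. norm (F t) \<le> B" using ap_bounded[OF assms(1)] by metis
  have key: "\<exists>T>0. \<exists>S\<^sub>0>0. \<forall>S\<ge>S\<^sub>0. \<forall>x. norm (avg F x S - avg F 0 T) \<le> \<epsilon>" if \<epsilon>: "\<epsilon> > 0" for \<epsilon>
  proof -
    obtain T where T: "T > 0" "\<And>x y. norm (avg F x T - avg F y T) \<le> \<epsilon>/2"
      using avg_uniform[OF assms, of "\<epsilon>/2"] \<epsilon> by (metis half_gt_zero order_refl)
    \<comment> \<open>The first summand makes room for at least one full window, the second makes
      the cost 2 B T / S of the remainder at most epsilon/2.\<close>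
    define S\<^sub>0 where "S\<^sub>0 = T + 4 * B * T / \<epsilon>"
    have S0: "S\<^sub>0 > 0" using T B \<epsilon> by (auto simp: S\<^sub>0_def intro!: add_pos_pos)
    have "norm (avg F x S - avg F 0 T) \<le> \<epsilon>" if "S \<ge> S\<^sub>0" for S x
    proof -
      have ST: "S \<ge> T" "S \<ge> 4 * B * T / \<epsilon>" "S > 0"
        using that S0 T B \<epsilon> by (auto simp: S\<^sub>0_def intro: order.trans[rotated])
      define n where "n = nat \<lfloor>S / T\<rfloor>"
      have "1 \<le> S / T" using ST T by simp
      then have fl: "\<lfloor>S / T\<rfloor> \<ge> 1" by (simp add: le_floor_iff)
      have n: "n > 0" "real n \<le> S / T" "S / T \<le> real n + 1" unfolding n_def using fl
        by (auto simp: of_nat_nat)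
      have n': "real n * T \<le> S" "S \<le> real n * T + T" using n T by (auto simp: field_simps)
      have 1: "norm (avg F x (real n * T) - avg F 0 T) \<le> \<epsilon>/2"
        by (rule avg_multiple_le[OF assms T(1) n(1) T(2)])
      have "norm (avg F x S - avg F x (real n * T)) \<le> 2 * B * (S - real n * T) / S"
        using n n' T by (intro avg_extend_le[OF assms B(2)]) auto
      also have "\<dots> \<le> 2 * B * T / S" using n' B ST by (intro divide_right_mono mult_left_mono) auto
      also have "\<dots> \<le> \<epsilon>/2" using ST \<epsilon> by (simp add: field_simps)
      finally show ?thesis using 1 norm_triangle_ineq[of "avg F x S - avg F x (real n * T)" "avg F x (real n * T) - avg F 0 T"]
        by simp
    qed
    then show ?thesis using S0 T(1) by blast
  qed
  have "Cauchy (\<lambda>n. avg F 0 (real n))"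
  proof (rule metric_CauchyI)
    fix e :: real assume "e > 0"
    then obtain T S0 where T: "S0 > 0" "\<And>S. S \<ge> S0 \<Longrightarrow> norm (avg F 0 S - avg F 0 T) \<le> e/3"
      using key[of "e/3"] by (metis divide_pos_pos zero_less_numeral)
    show "\<exists>M. \<forall>m\<ge>M. \<forall>n\<ge>M. dist (avg F 0 (real m)) (avg F 0 (real n)) < e"
    proof (intro exI[of _ "nat \<lceil>S0\<rceil>"] allI impI)
      fix m n assume "nat \<lceil>S0\<rceil> \<le> m" "nat \<lceil>S0\<rceil> \<le> n"
      then have "real m \<ge> S0" "real n \<ge> S0" by linarith+
      then show "dist (avg F 0 (real m)) (avg F 0 (real n)) < e"
        using T(2)[of "real m"] T(2)[of "real n"] \<open>e > 0\<close>
          norm_triangle_ineq4[of "avg F 0 (real m) - avg F 0 T" "avg F 0 (real n) - avg F 0 T"]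
        by (simp add: dist_norm)
    qed
  qed
  then obtain a where a: "(\<lambda>n. avg F 0 (real n)) \<longlonglongrightarrow> a" using Cauchy_convergent convergent_def by metis
  have "has_mean F a" unfolding has_mean_def
  proof (intro allI impI)
    fix \<epsilon> :: real assume "\<epsilon> > 0"
    then obtain T S0 where T: "S0 > 0" "\<And>S x. S \<ge> S0 \<Longrightarrow> norm (avg F x S - avg F 0 T) \<le> \<epsilon>/2"
      using key[of "\<epsilon>/2"] by (metis half_gt_zero)
    have "norm (a - avg F 0 T) \<le> \<epsilon>/2"
    proof (rule Lim_bounded[of "\<lambda>n. norm (avg F 0 (real n) - avg F 0 T)" _ "nat \<lceil>S0\<rceil>"])
      show "(\<lambda>n. norm (avg F 0 (real n) - avg F 0 T)) \<longlonglongrightarrow> norm (a - avg F 0 T)"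
        by (intro tendsto_intros a)
      show "\<forall>n\<ge>nat \<lceil>S0\<rceil>. norm (avg F 0 (real n) - avg F 0 T) \<le> \<epsilon>/2"
      proof (intro allI impI)
        fix n assume "nat \<lceil>S0\<rceil> \<le> n"
        then have "real n \<ge> S0" by linarith
        then show "norm (avg F 0 (real n) - avg F 0 T) \<le> \<epsilon>/2" by (rule T(2))
      qed
    qed
    then have "norm (avg F x S - a) \<le> \<epsilon>" if "S \<ge> S0" for S x
      using T(2)[OF that, of x] norm_triangle_ineq4[of "avg F x S - avg F 0 T" "a - avg F 0 T"] by simp
    then show "\<exists>T\<^sub>0>0. \<forall>T\<ge>T\<^sub>0. \<forall>x. norm (avg F x T - a) \<le> \<epsilon>" using T(1) by blast
  qed
  then show thesis by (rule that)
qed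

lemma has_mean_tendsto: "has_mean F a \<Longrightarrow> ((\<lambda>T. avg F (x T) T) \<longlongrightarrow> a) at_top"
proof (rule tendstoI)
  fix e :: real assume "has_mean F a" "e > 0"
  then obtain T0 where "\<And>T x. T \<ge> T0 \<Longrightarrow> norm (avg F x T - a) \<le> e/2"
    unfolding has_mean_def by (metis half_gt_zero)
  then show "\<forall>\<^sub>F T in at_top. dist (avg F (x T) T) a < e"
    using \<open>e > 0\<close> unfolding eventually_at_top_linorder
    by (intro exI[of _ T0]) (smt (verit) dist_norm field_sum_of_halves)
qed

lemma has_mean_unique: "has_mean F a \<Longrightarrow> has_mean F b \<Longrightarrow> a = b"
  using has_mean_tendsto[of F _ "\<lambda>_. 0"] tendsto_unique[OF trivial_limit_at_top_linorder] by blast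

text \<open>A uniform mean exists by almost periodicity, so the limit along windows starting at 0
  identifies it. Rules for means thereby reduce to limit laws.\<close>

lemma ap_has_mean_tendsto:
  assumes "ap F" "((\<lambda>T. avg F 0 T) \<longlongrightarrow> a) at_top"
  shows "has_mean F a"
proof -
  obtain b where b: "has_mean F b" using ap_has_mean[OF assms(1)] by metis
  have "a = b" using has_mean_tendsto[OF b, of "\<lambda>_. 0"] assms(2)
    tendsto_unique[OF trivial_limit_at_top_linorder] by blast
  then show ?thesis using b by simp
qed

lemma has_mean_add:
  assumes "ap F" "ap G" "has_mean F a" "has_mean G b"
  shows "has_mean (\<lambda>t. F t + G t) (a + b)"
  by (rule ap_has_mean_tendsto[OF ap_add[OF assms(1,2)]], unfold avg_add[OF assms(1,2)])
    (intro tendsto_intros has_mean_tendsto assms)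

lemma has_mean_cmult:
  assumes "ap F" "has_mean F a"
  shows "has_mean (\<lambda>t. z * F t) (z * a)"
proof (rule ap_has_mean_tendsto[OF ap_cmult[OF assms(1)]])
  have "avg (\<lambda>t. z * F t) 0 = (\<lambda>T. z * avg F 0 T)" by (simp add: avg_def fun_eq_iff)
  then show "(avg (\<lambda>t. z * F t) 0 \<longlongrightarrow> z * a) at_top"
    using assms(2) by (auto intro!: tendsto_intros has_mean_tendsto)
qed

lemma has_mean_norm_le:
  assumes "has_mean F a" "ap F" "\<And>t. norm (F t) \<le> B"
  shows "norm a \<le> B"
proof (rule tendsto_upperbound)
  show "((\<lambda>T. norm (avg F 0 T)) \<longlongrightarrow> norm a) at_top" by (intro tendsto_intros has_mean_tendsto assms)
  show "\<forall>\<^sub>F T in at_top. norm (avg F 0 T) \<le> B"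
    using eventually_gt_at_top[of 0] by eventually_elim (rule norm_avg_le[OF assms(2,3)])
qed simp

lemma has_mean_cis: "has_mean (\<lambda>t. cis (\<mu> * t)) (if \<mu> = 0 then 1 else 0)"
proof (rule ap_has_mean_tendsto[OF ap_cis])
  show "(avg (\<lambda>t. cis (\<mu> * t)) 0 \<longlongrightarrow> (if \<mu> = 0 then 1 else 0)) at_top"
  proof (cases "\<mu> = 0")
    case True
    have "\<forall>\<^sub>F T in at_top. avg (\<lambda>t. cis (\<mu> * t)) 0 T = 1"
      using eventually_gt_at_top[of 0] by eventually_elim (simp add: avg_def True scaleR_conv_of_real)
    then show ?thesis using True by (simp add: tendsto_eventually)
  next
    case False
    have int: "integral {0..T} (\<lambda>t. cis (\<mu> * t)) = (cis (\<mu> * T) - 1) / (\<i> * of_real \<mu>)" if "T > 0" for T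
    proof -
      have "((\<lambda>t. cis (\<mu> * t)) has_integral
          (cis (\<mu> * T) / (\<i> * of_real \<mu>) - cis (\<mu> * 0) / (\<i> * of_real \<mu>))) {0..T}"
        using that False
        by (intro fundamental_theorem_of_calculus)
          (auto simp: cis_conv_exp field_simps intro!: derivative_eq_intros has_vector_derivative_real_field)
      then show ?thesis by (simp add: integral_unique diff_divide_distrib)
    qed
    have "((\<lambda>T. (2 / \<bar>\<mu>\<bar>) / T) \<longlongrightarrow> 0) at_top"
      by (rule real_tendsto_divide_at_top[OF tendsto_const filterlim_ident])
    moreover have "\<forall>\<^sub>F T in at_top. norm (avg (\<lambda>t. cis (\<mu> * t)) 0 T) \<le> (2 / \<bar>\<mu>\<bar>) / T"
      using eventually_gt_at_top[of 0]
    proof eventually_elim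
      case (elim T)
      have "norm (cis (\<mu> * T) - 1) \<le> 2" using norm_triangle_ineq4[of "cis (\<mu> * T)" 1] by simp
      then have "norm ((cis (\<mu> * T) - 1) / (\<i> * of_real \<mu>) / of_real T) \<le> 2 / \<bar>\<mu>\<bar> / T"
        using elim by (simp add: norm_divide norm_mult divide_right_mono)
      then show ?case using elim by (simp add: avg_def int)
    qed
    ultimately have "((\<lambda>T. avg (\<lambda>t. cis (\<mu> * t)) 0 T) \<longlongrightarrow> 0) at_top"
      by (rule Lim_null_comparison[rotated])
    then show ?thesis using False by simp
  qed
qed

lemma has_mean_uniform_limit:
  assumes "ap F" "\<And>\<epsilon>. \<epsilon> > 0 \<Longrightarrow> \<exists>G b. ap G \<and> has_mean G b \<and> norm (b - a) \<le> \<epsilon> \<and> (\<forall>t. norm (F t - G t) \<le> \<epsilon>)"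
  shows "has_mean F a"
proof -
  obtain m where m: "has_mean F m" using ap_has_mean[OF assms(1)] by metis
  have "norm (m - a) \<le> \<epsilon>" if \<epsilon>: "\<epsilon> > 0" for \<epsilon>
  proof -
    obtain G b where G: "ap G" "has_mean G b" "norm (b - a) \<le> \<epsilon>/2" "\<And>t. norm (F t - G t) \<le> \<epsilon>/2"
      using assms(2)[OF half_gt_zero[OF \<epsilon>]] by blast
    have "has_mean (\<lambda>t. F t + (-1) * G t) (m + (-1) * b)"
      by (intro has_mean_add has_mean_cmult ap_cmult assms(1) G m)
    then have "norm (m - b) \<le> \<epsilon>/2"
      using has_mean_norm_le[of "\<lambda>t. F t - G t" "m - b" "\<epsilon>/2"] ap_diff[OF assms(1) G(1)] G(4) by simp
    then show ?thesis using G(3) norm_triangle_ineq[of "m - b" "b - a"] by simp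
  qed
  then have "m = a" using field_le_epsilon[of "norm (m - a)" 0] by simp
  then show ?thesis using m by simp
qed

section \<open>Estimates on the unit circle\<close>

lemma norm_cis_diff: "norm (cis a - cis b) = 2 * \<bar>sin ((a - b) / 2)\<bar>"
proof -
  have "cis a - cis b = cis b * (cis (a - b) - 1)" by (simp add: algebra_simps cis_mult)
  then show ?thesis using dist_exp_i_1[of "a - b"] by (simp add: norm_mult cis_conv_exp)
qed

lemma norm_cis_diff_le: "norm (cis a - cis b) \<le> \<bar>a - b\<bar>"
  using abs_sin_x_le_abs_x[of "(a - b) / 2"] by (simp add: norm_cis_diff)

text \<open>A weak form of Jordan's inequality. Up to pi/3 the function sin v - v/2 increases
  because cos(pi/3) = 1/2; beyond, sin v is at least 0.8 while v/2 is at most pi/4.\<close>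

lemma abs_sin_ge_half:
  assumes "\<bar>u\<bar> \<le> pi / 2" shows "\<bar>sin u\<bar> \<ge> \<bar>u\<bar> / 2"
proof -
  have *: "sin v \<ge> v / 2" if v: "0 \<le> v" "v \<le> pi / 2" for v :: real
  proof (cases "v \<le> pi / 3")
    case True
    have "sin 0 - 0 / 2 \<le> sin v - v / 2"
    proof (rule DERIV_nonneg_imp_nondecreasing[OF v(1)])
      fix x assume x: "0 \<le> x" "x \<le> v"
      have "cos (pi / 3) \<le> cos x" using x True by (intro cos_monotone_0_pi_le) auto
      then have "0 \<le> cos x - 1 / 2" by (simp add: cos_60)
      then show "\<exists>y. ((\<lambda>x. sin x - x / 2) has_real_derivative y) (at x) \<and> 0 \<le> y"
        by (intro exI[of _ "cos x - 1 / 2"]) (auto intro!: derivative_eq_intros)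
    qed
    then show ?thesis by simp
  next
    case False
    have "sin (pi / 3) \<le> sin v" using False v by (intro sin_monotone_2pi_le) auto
    moreover have "1.6 \<le> sqrt (3::real)" by (rule real_le_rsqrt) (simp add: power2_eq_square)
    then have "sin (pi / 3) \<ge> (0.8::real)" by (simp add: sin_60)
    moreover have "v / 2 \<le> 0.8" using v pi_less_4 pi_approx by simp
    ultimately show ?thesis by simp
  qed
  show ?thesis using *[of "\<bar>u\<bar>"] assms by (cases "u \<ge> 0") auto
qed

subsection \<open>The uniqueness theorem\<close>

definition unity :: "nat \<Rightarrow> int \<Rightarrow> complex" where
  "unity N z = cis (2 * pi * real_of_int z / real N)"

lemma unity_add: "unity N (a + b) = unity N a * unity N b"
  by (simp add: unity_def cis_mult ring_distribs add_divide_distrib)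

lemma unity_0 [simp]: "unity N 0 = 1"
  by (simp add: unity_def)

lemma norm_unity [simp]: "norm (unity N z) = 1"
  by (simp add: unity_def)

lemma cnj_unity: "cnj (unity N z) = unity N (- z)"
  by (simp add: unity_def cis_cnj)

lemma unity_multiple:
  assumes "N > 0" shows "unity N (int N * z) = 1"
proof -
  have "2 * pi * real_of_int (int N * z) / real N = 2 * pi * real_of_int z" using assms by simp
  then show ?thesis unfolding unity_def by (metis Ints_of_int cis_multiple_2pi)
qed

lemma unity_power: "unity N z ^ k = unity N (z * int k)"
  unfolding unity_def Complex.DeMoivre by (simp add: mult_ac)

lemma unity_eq_1:
  assumes "unity N z = 1" "\<bar>z\<bar> < int N" shows "z = 0"
proof (rule ccontr)
  assume "z \<noteq> 0"
  have N: "N > 0" using assms by linarith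
  have "sin (pi * \<bar>real_of_int z\<bar> / real N) > 0"
    using assms(2) \<open>z \<noteq> 0\<close> N by (intro sin_gt_zero) (auto simp: divide_less_eq zero_less_divide_iff)
  then have "sin (pi * real_of_int z / real N) \<noteq> 0" by (cases "z \<ge> 0") auto
  then show False using norm_cis_diff[of "2 * pi * real_of_int z / real N" 0] assms(1)
    by (simp add: unity_def)
qed

lemma unity_orthogonal:
  assumes "N > 0" "m < N" "m' < N"
  shows "(\<Sum>k<N. unity N ((int m - int m') * int k)) = (if m = m' then of_nat N else 0)"
proof (cases "m = m'")
  case False
  have "\<bar>int m - int m'\<bar> < int N" using assms by linarith
  then have "unity N (int m - int m') \<noteq> 1" using unity_eq_1[of N "int m - int m'"] False by auto
  then show ?thesis using False assms unity_multiple[of N "int m - int m'"]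
    by (simp add: unity_power[symmetric] geometric_sum) (simp add: unity_power mult.commute)
qed simp

text \<open>The factor 1/N makes the coefficient a mean of samples, comparable with
  \<open>avg\<close>.\<close>

definition dft :: "nat \<Rightarrow> (nat \<Rightarrow> complex) \<Rightarrow> nat \<Rightarrow> complex" where
  "dft N y m = (\<Sum>k<N. y k * unity N (- int m * int k)) / of_nat N"

lemma unity_mod: "N > 0 \<Longrightarrow> unity N (int m * int (i mod N)) = unity N (int m * int i)"
proof -
  assume "N > 0"
  have "int m * int i = int m * int (i mod N) + int N * (int m * int (i div N))"
    by (metis (no_types, opaque_lifting) distrib_left mod_mult_div_eq mult.left_commute of_nat_add of_nat_mult)
  then show ?thesis using \<open>N > 0\<close> by (simp add: unity_add unity_multiple)
qed

lemma dft_inversion: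
  assumes "N > 0" and per: "\<And>i. y (i mod N) = y i"
  shows "y i = (\<Sum>m<N. dft N y m * unity N (int m * int i))"
proof -
  let ?i = "i mod N"
  have i: "?i < N" using assms by simp
  have u: "unity N (- int m * int k) * unity N (int m * int ?i) = unity N ((int ?i - int k) * int m)" for m k
    by (subst unity_add[symmetric]) (simp add: algebra_simps)
  have "(\<Sum>m<N. dft N y m * unity N (int m * int ?i))
      = (\<Sum>m<N. \<Sum>k<N. y k * unity N ((int ?i - int k) * int m)) / of_nat N"
    by (simp only: dft_def times_divide_eq_left sum_distrib_right mult.assoc u sum_divide_distrib)
  also have "\<dots> = (\<Sum>k<N. y k * (\<Sum>m<N. unity N ((int ?i - int k) * int m))) / of_nat N"
    by (subst sum.swap) (simp add: sum_distrib_left)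
  also have "\<dots> = (\<Sum>k<N. y k * (if ?i = k then of_nat N else 0)) / of_nat N"
    by (intro arg_cong2[of _ _ _ _ "(/)"] sum.cong arg_cong2[of _ _ _ _ "(*)"] unity_orthogonal refl)
      (use assms i in auto)
  also have "\<dots> = (\<Sum>k<N. if k = ?i then y k * of_nat N else 0) / of_nat N"
    by (intro arg_cong2[of _ _ _ _ "(/)"] sum.cong) auto
  also have "\<dots> = y ?i" using assms i by (simp add: sum.delta)
  finally show ?thesis using assms by (simp add: unity_mod)
qed

text \<open>Stated for arbitrary coefficients because it is applied twice below: to the coefficients
  of the samples and to their squared moduli.\<close>

lemma parseval:
  assumes "N > 0"
  shows "(\<Sum>k<N. (norm (\<Sum>m<N. d m * unity N (int m * int k)))\<^sup>2) = real N * (\<Sum>m<N. (norm (d m))\<^sup>2)"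
proof -
  have "complex_of_real (\<Sum>k<N. (norm (\<Sum>m<N. d m * unity N (int m * int k)))\<^sup>2)
     = (\<Sum>k<N. (\<Sum>m<N. d m * unity N (int m * int k)) * cnj (\<Sum>m<N. d m * unity N (int m * int k)))"
    by (simp only: of_real_sum complex_norm_square)
  also have "\<dots> = (\<Sum>k<N. \<Sum>m<N. \<Sum>m'<N. d m * cnj (d m') * unity N ((int m - int m') * int k))"
  proof -
    have "d m * unity N (int m * int k) * (cnj (d m') * unity N (- (int m' * int k)))
        = d m * cnj (d m') * unity N ((int m - int m') * int k)" for m m' k
      using unity_add[of N "int m * int k" "- (int m' * int k)"] by (simp add: left_diff_distrib)
    then show ?thesis by (simp only: cnj_sum sum_product complex_cnj_mult cnj_unity)
  qed
  also have "\<dots> = (\<Sum>m<N. \<Sum>m'<N. d m * cnj (d m') * (\<Sum>k<N. unity N ((int m - int m') * int k)))"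
    by (subst sum.swap, rule sum.cong[OF refl], subst sum.swap, simp add: sum_distrib_left)
  also have "\<dots> = (\<Sum>m<N. \<Sum>m'<N. d m * cnj (d m') * (if m = m' then of_nat N else 0))"
    by (intro sum.cong refl arg_cong2[of _ _ _ _ "(*)"] unity_orthogonal) (use assms in auto)
  also have "\<dots> = (\<Sum>m<N. \<Sum>m'<N. if m = m' then d m * cnj (d m') * of_nat N else 0)"
    by (intro sum.cong refl) auto
  also have "\<dots> = of_real (real N * (\<Sum>m<N. (norm (d m))\<^sup>2))"
    by (simp add: sum.delta sum_distrib_left) (simp add: mult_ac flip: complex_norm_square)
  finally show ?thesis by (simp only: of_real_eq_iff)
qed

text \<open>The cyclic autocorrelation of \<open>y\<close> has Fourier coefficients \<open>|dft N y m|\<^sup>2\<close>, so its mean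
  square is the fourth moment of the coefficients of \<open>y\<close>.\<close>

lemma autocorrelation_le:
  assumes "N > 0" and per: "\<And>i. y (i mod N) = y i" and B: "\<And>i. norm (y i) \<le> B"
    and \<eta>: "\<And>m. m < N \<Longrightarrow> norm (dft N y m) \<le> \<eta>"
  shows "(\<Sum>j<N. (norm ((\<Sum>k<N. y (k + j) * cnj (y k)) / of_nat N))\<^sup>2) \<le> real N * \<eta>\<^sup>2 * B\<^sup>2"
proof -
  let ?c = "dft N y"
  have r: "(\<Sum>k<N. y (k + j) * cnj (y k)) / of_nat N
      = (\<Sum>m<N. of_real ((norm (?c m))\<^sup>2) * unity N (int m * int j))" for j
  proof -
    have "(\<Sum>k<N. y (k + j) * cnj (y k)) / of_nat N
       = (\<Sum>k<N. \<Sum>m<N. ?c m * unity N (int m * int (k + j)) * cnj (y k)) / of_nat N"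
    proof -
      have "y (k + j) * cnj (y k) = (\<Sum>m<N. ?c m * unity N (int m * int (k + j)) * cnj (y k))" for k
        by (subst dft_inversion[where y = y and i = "k + j", OF assms(1) per]) (rule sum_distrib_right)
      then show ?thesis by simp
    qed
    also have "\<dots> = (\<Sum>m<N. \<Sum>k<N. ?c m * unity N (int m * int j) * (cnj (y k) * unity N (int m * int k))) / of_nat N"
      by (subst sum.swap) (simp add: distrib_left unity_add mult_ac)
    also have "\<dots> = (\<Sum>m<N. ?c m * unity N (int m * int j) * ((\<Sum>k<N. cnj (y k) * unity N (int m * int k)) / of_nat N))"
      by (simp add: sum_divide_distrib sum_distrib_left)
    also have "\<dots> = (\<Sum>m<N. ?c m * unity N (int m * int j) * cnj (?c m))"
      by (simp add: dft_def cnj_unity)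
    also have "\<dots> = (\<Sum>m<N. of_real ((norm (?c m))\<^sup>2) * unity N (int m * int j))"
      by (intro sum.cong refl) (simp only: complex_norm_square mult_ac)
    finally show ?thesis .
  qed
  have "real N * (\<Sum>m<N. (norm (?c m))\<^sup>2) = (\<Sum>k<N. (norm (y k))\<^sup>2)"
    unfolding parseval[OF assms(1), symmetric]
    by (simp only: dft_inversion[where y = y, OF assms(1) per, symmetric])
  also have "\<dots> \<le> (\<Sum>k<N. B\<^sup>2)" by (intro sum_mono power_mono B) auto
  finally have c2: "(\<Sum>m<N. (norm (?c m))\<^sup>2) \<le> B\<^sup>2" using assms(1) by simp
  \<comment> \<open>Parseval for the coefficients |c_m|^2. Of the four factors |c_m| two are then
    bounded by eta and the other two are summed by the first application.\<close>
  have "(\<Sum>j<N. (norm ((\<Sum>k<N. y (k + j) * cnj (y k)) / of_nat N))\<^sup>2)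
      = real N * (\<Sum>m<N. (norm (complex_of_real ((norm (?c m))\<^sup>2)))\<^sup>2)"
    unfolding r by (rule parseval[OF assms(1)])
  also have "\<dots> = real N * (\<Sum>m<N. (norm (?c m))\<^sup>2 * (norm (?c m))\<^sup>2)"
    by (simp add: power2_eq_square norm_mult)
  also have "\<dots> \<le> real N * (\<Sum>m<N. \<eta>\<^sup>2 * (norm (?c m))\<^sup>2)"
    by (intro mult_left_mono sum_mono mult_right_mono power_mono \<eta>) auto
  also have "\<dots> \<le> real N * (\<eta>\<^sup>2 * B\<^sup>2)"
    unfolding sum_distrib_left[symmetric] using c2 by (intro mult_left_mono) auto
  finally show ?thesis by (simp add: mult.assoc)
qed

text \<open>Differences of indices of the same colour are almost periods, so pigeonhole gives
  a positive proportion of them, independently of the step \<open>h\<close>.\<close>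

lemma ap_many_almost_periods:
  assumes "ap F" "\<epsilon> > 0"
  obtains K :: nat where "K > 0"
    "\<And>h J. J \<le> K * card {j. j < J \<and> (\<forall>t. norm (F (t + real j * h) - F t) \<le> \<epsilon>)}"
proof -
  obtain c :: "real \<Rightarrow> nat" where c: "finite (range c)"
    "\<And>x y t. c x = c y \<Longrightarrow> norm (F (t + x) - F (t + y)) \<le> \<epsilon>"
    using apE[OF assms] by metis
  define K where "K = card (range c)"
  have K: "K > 0" using c(1) by (simp add: K_def card_gt_0_iff)
  have "J \<le> K * card {j. j < J \<and> (\<forall>t. norm (F (t + real j * h) - F t) \<le> \<epsilon>)}" for J h
  proof -
    let ?S = "{j. j < J \<and> (\<forall>t. norm (F (t + real j * h) - F t) \<le> \<epsilon>)}"
    let ?cls = "\<lambda>v. {j. j < J \<and> c (real j * h) = v}"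
    have cls: "card (?cls v) \<le> card ?S" for v
    proof (cases "?cls v = {}")
      case False
      \<comment> \<open>Subtracting the least index of the colour class keeps all differences
        natural numbers below \<open>J\<close>.\<close>
      define j0 where "j0 = Min (?cls v)"
      have j0: "j0 \<in> ?cls v" "\<And>j. j \<in> ?cls v \<Longrightarrow> j0 \<le> j" unfolding j0_def using False Min_in[of "?cls v"] by (simp_all only: finite_Collect_less_nat finite_Collect_conjI) (auto intro: Min_le)
      have inj: "inj_on (\<lambda>j. j - j0) (?cls v)" using j0(2) by (intro inj_onI) (metis eq_diff_iff)
      have "(\<lambda>j. j - j0) ` ?cls v \<subseteq> ?S"
      proof safe
        fix j t assume j: "j < J" "v = c (real j * h)"
        then have ge: "j0 \<le> j" using j0(2) by simp
        show "j - j0 < J" using j by simp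
        show "norm (F (t + real (j - j0) * h) - F t) \<le> \<epsilon>"
          using c(2)[of "real j * h" "real j0 * h" "t - real j0 * h"] j j0(1) ge
          by (simp add: of_nat_diff algebra_simps)
      qed
      then show ?thesis using card_inj_on_le[OF inj] by simp
    qed (simp only: card.empty)
    have "{..<J} = (\<Union>v\<in>range c. ?cls v)" by auto
    then have "J = card (\<Union>v\<in>range c. ?cls v)" by (metis card_lessThan)
    also have "\<dots> \<le> (\<Sum>v\<in>range c. card (?cls v))" by (rule card_UN_le[OF c(1)])
    also have "\<dots> \<le> K * card ?S" using sum_bounded_above[of "range c" "\<lambda>v. card (?cls v)" "card ?S"] cls
      by (simp add: K_def)
    finally show ?thesis .
  qed
  then show thesis using K that by blast
qed

section \<open>Lower bound for the discrete coefficients\<close>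

text \<open>At a lag that is an almost period, the autocorrelation is close to the mean square
  \<open>P\<close> of the samples. The proportion of such lags and the lower bound for
  \<open>P\<close> do not depend on \<open>h\<close>.\<close>

lemma ap_discrete_coefficients_large:
  assumes "ap F" "F 0 \<noteq> 0"
  obtains \<eta> N\<^sub>0 where "\<eta> > 0" "\<And>N h. N \<ge> N\<^sub>0 \<Longrightarrow> N > 0 \<and> (\<exists>m<N. norm (dft N (\<lambda>i. F (real (i mod N) * h)) m) > \<eta>)"
proof -
  obtain B where B: "B > 0" "\<And>t. norm (F t) \<le> B" using ap_bounded[OF assms(1)] by metis
  define c where "c = norm (F 0) / 2"
  have c: "c > 0" "c \<le> B" using assms(2) B(2)[of 0] B(1) by (auto simp: c_def)
  obtain K1 where K1: "K1 > 0" "\<And>h J. J \<le> K1 * card {j. j < J \<and> (\<forall>t. norm (F (t + real j * h) - F t) \<le> c)}"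
    by (rule ap_many_almost_periods[OF assms(1) c(1)]) blast
  \<comment> \<open>A lower bound for \<open>P\<close>: at least the fraction 1/K1 of the sample
    points are almost periods up to \<open>c\<close>, and there |F| is at least |F 0| - c =
    c.\<close>
  define \<kappa> where "\<kappa> = c\<^sup>2 / real K1"
  have \<kappa>: "\<kappa> > 0" using c K1 by (simp add: \<kappa>_def)
  have "\<kappa> \<le> c\<^sup>2 / 1" unfolding \<kappa>_def using K1 by (intro divide_left_mono) auto
  also have "\<dots> \<le> B\<^sup>2" using c by (simp add: power_mono)
  finally have \<kappa>B: "\<kappa> \<le> B\<^sup>2" .
  \<comment> \<open>Replacing a sample by one shifted by an almost period costs e * B = kappa/4 in
    each product.\<close>
  define e where "e = \<kappa> / (4 * B)"
  have e: "e > 0" using \<kappa> B by (simp add: e_def)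
  obtain K2 where K2: "K2 > 0" "\<And>h J. J \<le> K2 * card {j. j < J \<and> (\<forall>t. norm (F (t + real j * h) - F t) \<le> e)}"
    by (rule ap_many_almost_periods[OF assms(1) e(1)]) blast
  \<comment> \<open>The proportion of good lags, at least kappa / (16 B^2 K2), times the least value
    of |r j|^2 at such a lag.\<close>
  define \<theta> where "\<theta> = \<kappa> / (16 * B\<^sup>2) / real K2 * (\<kappa> / 2)\<^sup>2"
  have \<theta>: "\<theta> > 0" using \<kappa> B K2 by (simp add: \<theta>_def)
  define \<eta> where "\<eta> = sqrt \<theta> / (2 * B)"
  have \<eta>: "\<eta> > 0" "\<eta>\<^sup>2 * B\<^sup>2 < \<theta>" using \<theta> B by (simp_all add: \<eta>_def power_divide power_mult_distrib)
  \<comment> \<open>Makes kappa N / (8 B^2) at least 2, so that rounding it down to \<open>J\<close>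
    loses at most half of it.\<close>
  define N\<^sub>0 where "N\<^sub>0 = nat \<lceil>16 * B\<^sup>2 / \<kappa>\<rceil>"
  have N0: "16 * B\<^sup>2 / \<kappa> \<le> real N\<^sub>0" unfolding N\<^sub>0_def by linarith
  have "N > 0 \<and> (\<exists>m<N. norm (dft N (\<lambda>i. F (real (i mod N) * h)) m) > \<eta>)" if "N \<ge> N\<^sub>0" for N h
  proof (rule ccontr)
    have "16 * B\<^sup>2 / \<kappa> \<le> real N" using N0 that by simp
    then have N: "\<kappa> * real N \<ge> 16 * B\<^sup>2" using \<kappa> by (simp add: field_simps)
    then have Npos: "N > 0" using B \<kappa> by (intro Nat.gr0I) auto
    define y where "y = (\<lambda>i. F (real (i mod N) * h))"
    assume "\<not> (N > 0 \<and> (\<exists>m<N. norm (dft N (\<lambda>i. F (real (i mod N) * h)) m) > \<eta>))"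
    then have small: "\<And>m. m < N \<Longrightarrow> norm (dft N y m) \<le> \<eta>" using Npos by (force simp: y_def)
    have per: "y (i mod N) = y i" for i by (simp add: y_def)
    have yB: "norm (y i) \<le> B" for i by (simp add: y_def B)
    define r where "r = (\<lambda>j. (\<Sum>k<N. y (k + j) * cnj (y k)) / of_nat N)"
    define P where "P = (\<Sum>k<N. (norm (y k))\<^sup>2) / real N"
    have P: "P \<ge> \<kappa>"
    proof -
      let ?S = "{j. j < N \<and> (\<forall>t. norm (F (t + real j * h) - F t) \<le> c)}"
      have "c \<le> norm (y k)" if "k \<in> ?S" for k
      proof -
        have "norm (F (0 + real k * h) - F 0) \<le> c" "k < N" using that by blast+
        then show ?thesis using norm_triangle_ineq2[of "F 0" "F (real k * h)"]
          by (simp add: y_def c_def norm_minus_commute)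
      qed
      then have "(\<Sum>k\<in>?S. c\<^sup>2) \<le> (\<Sum>k\<in>?S. (norm (y k))\<^sup>2)"
        using c by (intro sum_mono power_mono) auto
      also have "\<dots> \<le> (\<Sum>k<N. (norm (y k))\<^sup>2)" by (intro sum_mono2) auto
      finally have 1: "real (card ?S) * c\<^sup>2 \<le> P * real N" using Npos by (simp add: P_def)
      have "real N \<le> real K1 * real (card ?S)"
        unfolding of_nat_mult[symmetric] by (rule of_nat_mono[OF K1(2)])
      then have "real N * c\<^sup>2 \<le> real K1 * real (card ?S) * c\<^sup>2" by (intro mult_right_mono) auto
      also have "\<dots> = real K1 * (real (card ?S) * c\<^sup>2)" by (rule mult.assoc)
      also have "\<dots> \<le> real K1 * (P * real N)" using 1 by (intro mult_left_mono) auto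
      finally have "c\<^sup>2 * real N \<le> (real K1 * P) * real N" by (simp add: mult_ac)
      then have "c\<^sup>2 \<le> real K1 * P" using Npos by simp
      then show ?thesis using K1 by (simp add: \<kappa>_def divide_le_eq mult_ac)
    qed
    \<comment> \<open>At a lag j only j of the N products wrap around the end of the sample, where
      almost periodicity is of no help. Each of these errs by at most 2 B^2, so for lags below
      \<open>J\<close> they cost at most kappa/4 in the mean.\<close>
    define J where "J = nat \<lfloor>\<kappa> * real N / (8 * B\<^sup>2)\<rfloor>"
    have X: "\<kappa> * real N / (8 * B\<^sup>2) \<ge> 2" using N B by (simp add: field_simps)
    then have J: "real J \<le> \<kappa> * real N / (8 * B\<^sup>2)" "real J \<ge> \<kappa> * real N / (16 * B\<^sup>2)"
    proof -
      let ?X = "\<kappa> * real N / (8 * B\<^sup>2)"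
      have "real J \<le> ?X" "real J \<ge> ?X - 1" using X unfolding J_def by linarith+
      moreover have "\<kappa> * real N / (16 * B\<^sup>2) = ?X / 2" by simp
      ultimately show "real J \<le> ?X" "real J \<ge> \<kappa> * real N / (16 * B\<^sup>2)" using X by linarith+
    qed
    have "real J \<le> real N"
    proof -
      have "\<kappa> \<le> 8 * B\<^sup>2" using \<kappa>B zero_le_power2[of B] by linarith
      then have "\<kappa> * real N \<le> (8 * B\<^sup>2) * real N" by (intro mult_right_mono) auto
      then have "\<kappa> * real N / (8 * B\<^sup>2) \<le> real N" using B by (simp add: divide_le_eq mult_ac)
      then show ?thesis using J by linarith
    qed
    then have JN: "J \<le> N" by simp
    let ?S = "{j. j < J \<and> (\<forall>t. norm (F (t + real j * h) - F t) \<le> e)}"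
    have rbig: "norm (r j) \<ge> \<kappa> / 2" if j: "j \<in> ?S" for j
    proof -
      have jJ: "j < J" "\<And>t. norm (F (t + real j * h) - F t) \<le> e" using j by blast+
      have d: "norm (y (k + j) - y k) \<le> (if k < N - j then e else 2 * B)" if "k < N" for k
      proof (cases "k < N - j")
        case True
        then show ?thesis using jJ(2)[of "real k * h"] that
          by (simp add: y_def algebra_simps)
      next
        case False
        then show ?thesis using norm_triangle_ineq4[of "y (k + j)" "y k"] yB[of k] yB[of "k+j"] by simp
      qed
      have "r j - of_real P = (\<Sum>k<N. (y (k + j) - y k) * cnj (y k)) / of_nat N"
        by (simp add: r_def P_def complex_norm_square left_diff_distrib sum_subtractf
            diff_divide_distrib del: of_real_power)
      also have "norm \<dots> \<le> (\<Sum>k<N. (if k < N - j then e else 2 * B) * B) / real N"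
        unfolding norm_divide norm_of_nat
        by (intro divide_right_mono order.trans[OF norm_sum] sum_mono, unfold norm_mult complex_mod_cnj, intro mult_mono d yB)
          (use e B in auto)
      also have "\<dots> \<le> (\<Sum>k<N. e * B + (if k < N - j then 0 else 2 * B * B)) / real N"
        using e B by (intro divide_right_mono sum_mono) auto
      also have "(\<Sum>k<N. e * B + (if k < N - j then 0 else 2 * B * B)) = real N * (e * B) + real j * (2 * B * B)"
      proof -
        have "(\<Sum>k<N. (if k < N - j then 0 else 2 * B * B)) = (\<Sum>k\<in>{N-j..<N}. 2 * B * B)"
          by (rule sum.mono_neutral_cong_right) auto
        then show ?thesis using jJ JN by (simp add: sum.distrib)
      qed
      also have "(real N * (e * B) + real j * (2 * B * B)) / real N = e * B + real j * (2 * B * B) / real N"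
        using Npos by (simp add: field_simps)
      also have "\<dots> \<le> \<kappa> / 4 + \<kappa> / 4"
      proof (rule add_mono)
        show "e * B \<le> \<kappa> / 4" using B by (simp add: e_def)
        have "real j * (8 * B * B) \<le> \<kappa> * real N"
        proof -
          have "real j \<le> \<kappa> * real N / (8 * B\<^sup>2)" using jJ J by linarith
          then show ?thesis using B by (simp add: field_simps power2_eq_square)
        qed
        then show "real j * (2 * B * B) / real N \<le> \<kappa> / 4" using Npos by (simp add: field_simps)
      qed
      finally have "norm (r j - of_real P) \<le> \<kappa> / 2" by simp
      then show ?thesis using P norm_triangle_ineq2[of "complex_of_real P" "r j"] \<kappa>
        by (simp add: norm_minus_commute)
    qed
    have "real J \<le> real K2 * real (card ?S)"
      unfolding of_nat_mult[symmetric] by (rule of_nat_mono[OF K2(2)])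
    then have "\<kappa> * real N / (16 * B\<^sup>2) \<le> real K2 * real (card ?S)" using J by linarith
    then have "\<kappa> * real N / (16 * B\<^sup>2) / real K2 \<le> real (card ?S)"
      using K2(1) by (subst pos_divide_le_eq) (simp_all only: mult.commute of_nat_0_less_iff)
    then have card: "real (card ?S) \<ge> real N * (\<kappa> / (16 * B\<^sup>2) / real K2)"
      by (simp only: times_divide_eq_right mult.commute)
    have "real N * \<theta> = real N * (\<kappa> / (16 * B\<^sup>2) / real K2) * (\<kappa> / 2)\<^sup>2" by (simp add: \<theta>_def)
    also have "\<dots> \<le> real (card ?S) * (\<kappa> / 2)\<^sup>2" by (intro mult_right_mono card) auto
    also have "\<dots> = (\<Sum>j\<in>?S. (\<kappa> / 2)\<^sup>2)" by simp
    also have "\<dots> \<le> (\<Sum>j\<in>?S. (norm (r j))\<^sup>2)" using \<kappa> by (intro sum_mono power_mono rbig) auto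
    also have "\<dots> \<le> (\<Sum>j<N. (norm (r j))\<^sup>2)" using JN by (intro sum_mono2) auto
    also have "\<dots> \<le> real N * \<eta>\<^sup>2 * B\<^sup>2" unfolding r_def
      by (rule autocorrelation_le[OF Npos per yB small])
    finally have "real N * \<theta> \<le> real N * (\<eta>\<^sup>2 * B\<^sup>2)" by (simp add: mult.assoc)
    then have "\<theta> \<le> \<eta>\<^sup>2 * B\<^sup>2" using Npos by simp
    then show False using \<eta> by simp
  qed
  then show thesis using \<eta>(1) that by blast
qed

section \<open>Upper bound for the discrete coefficients\<close>

lemma lipschitz_mult_cis:
  assumes "\<And>s t. norm (F s - F t) \<le> L * \<bar>s - t\<bar>" "\<And>t. norm (F t) \<le> B"
  shows "norm (F s * cis (\<nu> * s) - F t * cis (\<nu> * t)) \<le> (L + \<bar>\<nu>\<bar> * B) * \<bar>s - t\<bar>"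
proof -
  have B: "B \<ge> 0" using assms(2)[of 0] norm_ge_zero[of "F 0"] by linarith
  have "F s * cis (\<nu> * s) - F t * cis (\<nu> * t) = (F s - F t) * cis (\<nu> * s) + F t * (cis (\<nu> * s) - cis (\<nu> * t))"
    by (simp add: algebra_simps)
  also have "norm \<dots> \<le> L * \<bar>s - t\<bar> * 1 + B * \<bar>\<nu> * s - \<nu> * t\<bar>"
    by (rule norm_triangle_le, unfold norm_mult, intro add_mono mult_mono assms norm_cis_diff_le)
      (use B assms(1)[of s t] in \<open>auto intro: order.trans[OF norm_ge_zero]\<close>)
  also have "\<bar>\<nu> * s - \<nu> * t\<bar> = \<bar>\<nu>\<bar> * \<bar>s - t\<bar>" by (simp add: right_diff_distrib[symmetric] abs_mult)
  finally show ?thesis by (simp add: algebra_simps)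
qed

lemma riemann_sum_le:
  assumes "ap G" "\<And>s t. norm (G s - G t) \<le> L * \<bar>s - t\<bar>" "T > 0" "N > 0"
  shows "norm (avg G 0 T - (\<Sum>k<N. G (real k * (T / real N))) / of_nat N) \<le> L * (T / real N)"
proof -
  define h where "h = T / real N"
  have h: "h > 0" "T = real N * h" using assms by (auto simp: h_def)
  have L: "L \<ge> 0" using order.trans[OF norm_ge_zero assms(2)[of 1 0]] by simp
  have blk: "norm (integral {0 + real k * h..0 + real k * h + h} G - of_real h * G (real k * h)) \<le> (L * h) * h" for k
  proof -
    let ?a = "real k * h"
    have "integral {?a..?a + h} G - of_real h * G ?a = integral {?a..?a + h} (\<lambda>t. G t - G ?a)"
      using h integral_diff[OF ap_integrable[OF assms(1), of ?a "?a + h"] integrable_const_ivl[of "G ?a" ?a "?a + h"]]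
      by (simp add: scaleR_conv_of_real)
    also have "norm \<dots> \<le> (L * h) * ((?a + h) - ?a)"
    proof (rule norm_integral_le)
      show "continuous_on {?a..?a + h} (\<lambda>t. G t - G ?a)" by (intro continuous_intros ap_continuous assms)
      fix t assume t: "t \<in> {?a..?a + h}"
      have "norm (G t - G ?a) \<le> L * \<bar>t - ?a\<bar>" by (rule assms)
      also have "\<dots> \<le> L * h" using t L by (intro mult_left_mono) auto
      finally show "norm (G t - G ?a) \<le> L * h" .
    qed (use h in auto)
    finally show ?thesis by simp
  qed
  have "avg G 0 T - (\<Sum>k<N. G (real k * h)) / of_nat N
     = (\<Sum>k<N. integral {0 + real k * h..0 + real k * h + h} G - of_real h * G (real k * h)) / of_real T"
    using integral_blocks[OF ap_continuous[OF assms(1)], of h 0 N] h assms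
    by (simp add: avg_def sum_subtractf diff_divide_distrib sum_distrib_left[symmetric])
  also have "norm \<dots> \<le> (\<Sum>k<N. (L * h) * h) / T"
    unfolding norm_divide using assms(3) blk
    by (intro divide_mono order.trans[OF norm_sum] sum_mono) (auto intro!: sum_nonneg)
  also have "\<dots> = L * h" using h assms by simp
  finally show ?thesis by (simp add: h_def)
qed

text \<open>Multiplication by the unimodular number \<open>cis (- \<nu> * x)\<close> counts the
  phase from the start of the window. The two phases then differ by at most |nu - nu'| T, wherever
  the window lies.\<close>

lemma avg_cis_lipschitz:
  assumes "ap F" "\<And>t. norm (F t) \<le> B" "T > 0"
  shows "norm (avg (\<lambda>t. F t * cis (\<nu> * t)) x T) \<le> norm (avg (\<lambda>t. F t * cis (\<nu>' * t)) x T) + B * \<bar>\<nu> - \<nu>'\<bar> * T"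
proof -
  have B: "B \<ge> 0" using assms(2)[of 0] norm_ge_zero[of "F 0"] by linarith
  have i: "(\<lambda>t. F t * cis (\<mu> * t)) integrable_on {x..x+T}" for \<mu>
    by (intro ap_integrable ap_mult ap_cis assms)
  let ?D = "\<lambda>\<mu>. integral {x..x+T} (\<lambda>t. F t * cis (\<mu> * t))"
  have "cis (- \<nu> * x) * ?D \<nu> - cis (- \<nu>' * x) * ?D \<nu>'
     = integral {x..x+T} (\<lambda>t. cis (- \<nu> * x) * (F t * cis (\<nu> * t)) - cis (- \<nu>' * x) * (F t * cis (\<nu>' * t)))"
    by (subst integral_diff) (auto intro!: integrable_on_cmult_left i)
  also have "norm \<dots> \<le> (B * \<bar>\<nu> - \<nu>'\<bar> * T) * ((x + T) - x)"
  proof (rule norm_integral_le)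
    show "continuous_on {x..x + T} (\<lambda>t. cis (- \<nu> * x) * (F t * cis (\<nu> * t)) - cis (- \<nu>' * x) * (F t * cis (\<nu>' * t)))"
      by (intro continuous_intros ap_continuous assms)
    fix t assume t: "t \<in> {x..x+T}"
    have "cis (- \<nu> * x) * (F t * cis (\<nu> * t)) - cis (- \<nu>' * x) * (F t * cis (\<nu>' * t))
       = F t * ((cis (- \<nu> * x) * cis (\<nu> * t)) - (cis (- \<nu>' * x) * cis (\<nu>' * t)))" by (simp add: algebra_simps)
    also have "\<dots> = F t * (cis (\<nu> * (t - x)) - cis (\<nu>' * (t - x)))"
      unfolding cis_mult by (simp add: algebra_simps)
    also have "norm \<dots> \<le> B * \<bar>\<nu> * (t - x) - \<nu>' * (t - x)\<bar>"
      unfolding norm_mult by (intro mult_mono norm_cis_diff_le assms B) auto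
    also have "\<bar>\<nu> * (t - x) - \<nu>' * (t - x)\<bar> = \<bar>\<nu> - \<nu>'\<bar> * \<bar>t - x\<bar>"
      by (simp add: left_diff_distrib[symmetric] abs_mult)
    also have "B * (\<bar>\<nu> - \<nu>'\<bar> * \<bar>t - x\<bar>) \<le> B * (\<bar>\<nu> - \<nu>'\<bar> * T)"
      using t B by (intro mult_left_mono) auto
    finally show "norm (cis (- \<nu> * x) * (F t * cis (\<nu> * t)) - cis (- \<nu>' * x) * (F t * cis (\<nu>' * t))) \<le> B * \<bar>\<nu> - \<nu>'\<bar> * T"
      by (simp add: mult.assoc)
  qed (use assms in auto)
  finally have "norm (cis (- \<nu> * x) * ?D \<nu> - cis (- \<nu>' * x) * ?D \<nu>') \<le> (B * \<bar>\<nu> - \<nu>'\<bar> * T) * T" by simp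
  then have "norm (?D \<nu>) \<le> norm (?D \<nu>') + (B * \<bar>\<nu> - \<nu>'\<bar> * T) * T"
    using norm_triangle_ineq2[of "cis (- \<nu> * x) * ?D \<nu>" "cis (- \<nu>' * x) * ?D \<nu>'"] by (simp add: norm_mult)
  then show ?thesis using assms(3) by (simp add: avg_def norm_divide divide_le_eq add_divide_distrib ring_distribs)
qed

text \<open>The supremum over \<open>x\<close> of the average over \<open>[x, x + T]\<close> does not increase when \<open>T\<close> is doubled,
  and for fixed \<open>T\<close> it is continuous in the frequency. Hence pointwise convergence to zero is
  uniform on compact sets of frequencies, as in Dini's theorem.\<close>

lemma coefficients_uniformly_small:
  assumes "ap F" "\<And>\<nu>. has_mean (\<lambda>t. F t * cis (\<nu> * t)) 0" "\<epsilon> > 0"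
  obtains n :: nat where "\<And>\<nu> x. \<bar>\<nu>\<bar> \<le> A \<Longrightarrow> norm (avg (\<lambda>t. F t * cis (\<nu> * t)) x (2 ^ n)) \<le> \<epsilon>"
proof -
  obtain B where B: "B > 0" "\<And>t. norm (F t) \<le> B" using ap_bounded[OF assms(1)] by metis
  let ?D = "\<lambda>\<nu> x n. avg (\<lambda>t. F t * cis (\<nu> * t)) x (2 ^ n)"
  have "\<exists>n. \<forall>x. norm (?D \<nu> x n) \<le> \<epsilon> / 2" for \<nu>
  proof -
    obtain T0 where T0: "\<And>T x. T \<ge> T0 \<Longrightarrow> norm (avg (\<lambda>t. F t * cis (\<nu> * t)) x T - 0) \<le> \<epsilon> / 2"
      using assms(2)[of \<nu>] assms(3) unfolding has_mean_def by (metis half_gt_zero)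
    obtain n :: nat where "T0 < 2 ^ n" using real_arch_pow[of 2 T0] by auto
    then show ?thesis using T0[of "2^n"] by auto
  qed
  then obtain n where n: "\<And>\<nu> x. norm (?D \<nu> x (n \<nu>)) \<le> \<epsilon> / 2" by metis
  \<comment> \<open>A change of the frequency by less than this costs at most B * delta * 2^n =
    epsilon/2.\<close>
  define \<delta> where "\<delta> = (\<lambda>\<nu>. \<epsilon> / (2 * B * 2 ^ n \<nu>))"
  have \<delta>: "\<delta> \<nu> > 0" for \<nu> using B assms(3) by (simp add: \<delta>_def)
  have near: "norm (?D \<nu>' x (n \<nu>)) \<le> \<epsilon>" if "dist \<nu> \<nu>' < \<delta> \<nu>" for \<nu> \<nu>' x
  proof -
    have "norm (?D \<nu>' x (n \<nu>)) \<le> norm (?D \<nu> x (n \<nu>)) + B * \<bar>\<nu>' - \<nu>\<bar> * 2 ^ n \<nu>"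
      by (intro avg_cis_lipschitz assms B) auto
    also have "B * \<bar>\<nu>' - \<nu>\<bar> * 2 ^ n \<nu> \<le> B * \<delta> \<nu> * 2 ^ n \<nu>"
      using that B by (intro mult_right_mono mult_left_mono) (auto simp: dist_real_def)
    also have "B * \<delta> \<nu> * 2 ^ n \<nu> = \<epsilon> / 2" using B by (simp add: \<delta>_def)
    finally show ?thesis using n[of \<nu> x] by simp
  qed
  obtain C where C: "C \<subseteq> {-A..A}" "finite C" "{-A..A} \<subseteq> (\<Union>\<nu>\<in>C. ball \<nu> (\<delta> \<nu>))"
  proof (rule compactE_image[of "{-A..A}" "{-A..A}" "\<lambda>\<nu>. ball \<nu> (\<delta> \<nu>)"])
    show "{-A..A} \<subseteq> (\<Union>\<nu>\<in>{-A..A}. ball \<nu> (\<delta> \<nu>))" using \<delta> by force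
  qed (auto intro: that)
  \<comment> \<open>All lengths being powers of 2, the greatest is a multiple of each length
    belonging to the finite cover. The 0 serves an empty cover.\<close>
  define M where "M = Max (insert 0 (n ` C))"
  have "norm (?D \<nu> x M) \<le> \<epsilon>" if "\<bar>\<nu>\<bar> \<le> A" for \<nu> x
  proof -
    have "\<nu> \<in> {-A..A}" using that by auto
    then obtain \<nu>' where \<nu>': "\<nu>' \<in> C" "dist \<nu>' \<nu> < \<delta> \<nu>'" using C by auto
    have nM: "n \<nu>' \<le> M" unfolding M_def using \<nu>' C by (intro Max_ge) auto
    have "norm (avg (\<lambda>t. F t * cis (\<nu> * t)) x (real (2 ^ (M - n \<nu>')) * 2 ^ n \<nu>') - 0) \<le> \<epsilon>"
      using near[OF \<nu>'(2)] by (intro avg_multiple_le ap_mult ap_cis assms(1)) auto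
    then show ?thesis using nM by (simp flip: power_add)
  qed
  then show thesis by (rule that)
qed

text \<open>Summation by parts: shifting the index by one multiplies the coefficient by
  \<open>unity N (int m)\<close>. So the left side is the modulus of a coefficient of the increments
  of \<open>y\<close>.\<close>

lemma dft_high_frequency:
  assumes "N > 0" "y (0 + N) = y 0" "\<And>k. k < N \<Longrightarrow> norm (y (Suc k) - y k) \<le> d k"
  shows "norm (dft N y m) * norm (unity N (int m) - 1) \<le> (\<Sum>k<N. d k) / real N"
proof -
  let ?z = "\<lambda>k. y k * unity N (- int m * int k)"
  have "(\<Sum>k<N. ?z (Suc k)) = (\<Sum>k<N. ?z k)"
  proof -
    have "?z N = ?z 0" using assms(1,2) unity_multiple[of N "- int m"] by (simp add: mult.commute)
    moreover have "(\<Sum>k<Suc N. ?z k) = ?z 0 + (\<Sum>k<N. ?z (Suc k))" by (rule sum.lessThan_Suc_shift)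
    moreover have "(\<Sum>k<Suc N. ?z k) = (\<Sum>k<N. ?z k) + ?z N" by simp
    ultimately show ?thesis by simp
  qed
  then have "dft N y m * unity N (int m) = (\<Sum>k<N. ?z (Suc k) * unity N (int m)) / of_nat N"
    by (simp only: dft_def times_divide_eq_left sum_distrib_right[symmetric])
  moreover have "?z (Suc k) * unity N (int m) = y (Suc k) * unity N (- int m * int k)" for k
  proof -
    have "- int m * int (Suc k) + int m = - int m * int k" by (simp add: algebra_simps)
    then show ?thesis by (simp only: mult.assoc unity_add[symmetric])
  qed
  ultimately have "dft N y m * unity N (int m) = (\<Sum>k<N. y (Suc k) * unity N (- int m * int k)) / of_nat N"
    by (simp only:)
  then have "dft N y m * (unity N (int m) - 1) = (\<Sum>k<N. (y (Suc k) - y k) * unity N (- int m * int k)) / of_nat N"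
    by (simp add: right_diff_distrib left_diff_distrib dft_def sum_subtractf diff_divide_distrib)
  then have "norm (dft N y m) * norm (unity N (int m) - 1)
      = norm (\<Sum>k<N. (y (Suc k) - y k) * unity N (- int m * int k)) / real N"
    by (metis norm_divide norm_mult norm_of_nat)
  also have "\<dots> \<le> (\<Sum>k<N. d k) / real N"
    using assms(3) by (intro divide_right_mono order.trans[OF norm_sum] sum_mono) (auto simp: norm_mult)
  finally show ?thesis .
qed

text \<open>The half angle pi z / N stays within [-pi/2, pi/2], where the sine has a linear lower
  bound; pi is then lowered to 2.\<close>

lemma unity_minus_1_ge:
  assumes "N > 0" "2 * \<bar>z\<bar> \<le> int N"
  shows "norm (unity N z - 1) \<ge> 2 * \<bar>real_of_int z\<bar> / real N"
proof -
  let ?u = "pi * real_of_int z / real N"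
  have "2 * \<bar>real_of_int z\<bar> \<le> real N" using assms(2) by linarith
  then have "\<bar>?u\<bar> \<le> pi / 2" using assms(1) by (simp add: abs_mult field_simps)
  from abs_sin_ge_half[OF this] have "2 * \<bar>sin ?u\<bar> \<ge> \<bar>?u\<bar>" by simp
  moreover have "norm (unity N z - 1) = 2 * \<bar>sin ?u\<bar>"
    using norm_cis_diff[of "2 * pi * real_of_int z / real N" 0] by (simp add: unity_def)
  moreover have "\<bar>?u\<bar> \<ge> 2 * \<bar>real_of_int z\<bar> / real N"
    using pi_gt3 by (auto simp: abs_mult intro!: divide_right_mono mult_right_mono)
  ultimately show ?thesis by linarith
qed

text \<open>Frequencies up to \<open>A\<close> per unit of time are Riemann sums of averages over
  [0, T]; those above fall to summation by parts, with one jump of at most 2 B from the end of the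
  sample back to its start. \<open>A\<close> depends on eta, \<open>T\<close> on \<open>A\<close>,
  and \<open>N\<close> on both.\<close>

lemma ap_discrete_coefficients_small:
  assumes "ap F" "\<And>s t. norm (F s - F t) \<le> L * \<bar>s - t\<bar>"
    and mean0: "\<And>\<nu>. has_mean (\<lambda>t. F t * cis (\<nu> * t)) 0" and "\<eta> > 0"
  obtains N h where "N \<ge> N\<^sub>0" "\<And>m. m < N \<Longrightarrow> norm (dft N (\<lambda>i. F (real (i mod N) * h)) m) \<le> \<eta>"
proof -
  obtain B where B: "B > 0" "\<And>t. norm (F t) \<le> B" using ap_bounded[OF assms(1)] by metis
  have L: "L \<ge> 0" using order.trans[OF norm_ge_zero assms(2)[of 1 0]] by simp
  \<comment> \<open>For |z| > A T, summation by parts gives the bound (L T + 2 B T) / (2 A T), which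
    is eta for this value.\<close>
  define A where "A = (L + 2 * B) / (2 * \<eta>)"
  have A: "A > 0" using B L \<open>\<eta> > 0\<close> by (simp add: A_def add_nonneg_pos)
  obtain n where n: "\<And>\<nu> x. \<bar>\<nu>\<bar> \<le> 2 * pi * A \<Longrightarrow> norm (avg (\<lambda>t. F t * cis (\<nu> * t)) x (2 ^ n)) \<le> \<eta> / 2"
    using coefficients_uniformly_small[OF assms(1) mean0 half_gt_zero[OF \<open>\<eta> > 0\<close>]] by metis
  define T :: real where "T = 2 ^ n"
  have T: "T \<ge> 1" by (simp add: T_def)
  \<comment> \<open>Large enough for the Riemann sum error (L + 2 pi A B) T / N to be at most
    eta/2.\<close>
  define N where "N = max (Suc N\<^sub>0) (nat \<lceil>(L + 2 * pi * A * B) * T * 2 / \<eta>\<rceil>)"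
  have N: "N > 0" "N \<ge> N\<^sub>0" by (auto simp: N_def)
  have "(L + 2 * pi * A * B) * T * 2 / \<eta> \<le> real N" unfolding N_def by linarith
  then have N2: "(L + 2 * pi * A * B) * (T / real N) \<le> \<eta> / 2" using \<open>\<eta> > 0\<close> N by (simp add: field_simps)
  define h where "h = T / real N"
  define y where "y = (\<lambda>i. F (real (i mod N) * h))"
  have "norm (dft N y m) \<le> \<eta>" if m: "m < N" for m
  proof -
    \<comment> \<open>The residue of \<open>m\<close> modulo \<open>N\<close> of least modulus:
      indices above N/2 stand for negative frequencies.\<close>
    define z where "z = (if 2 * m \<le> N then int m else int m - int N)"
    have z: "2 * \<bar>z\<bar> \<le> int N" using m by (auto simp: z_def)
    have um: "unity N (- int m * int k) = unity N (- z * int k)" for k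
    proof (cases "2 * m \<le> N")
      case False
      have "- z * int k = - int m * int k + int N * int k" using False by (simp add: z_def algebra_simps)
      then show ?thesis using unity_multiple[OF N(1)] by (simp only: unity_add mult_1_right)
    qed (simp add: z_def)
    have um1: "unity N (int m) = unity N z"
    proof (cases "2 * m \<le> N")
      case False
      have "int m = z + int N * 1" using False by (simp add: z_def)
      then show ?thesis using unity_multiple[OF N(1), of 1] by (metis unity_add mult_1_right)
    qed (simp add: z_def)
    show ?thesis
    proof (cases "\<bar>real_of_int z\<bar> \<le> A * T")
      case True
      define \<nu> where "\<nu> = - (2 * pi * real_of_int z / T)"
      have "\<bar>real_of_int z\<bar> / T \<le> A" using True T by (simp add: divide_le_eq)
      then have "2 * pi * (\<bar>real_of_int z\<bar> / T) \<le> 2 * pi * A" by (intro mult_left_mono) auto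
      then have \<nu>: "\<bar>\<nu>\<bar> \<le> 2 * pi * A" using T by (simp add: \<nu>_def abs_mult)
      have eq: "y k * unity N (- int m * int k) = F (real k * (T / real N)) * cis (\<nu> * (real k * (T / real N)))" if "k < N" for k
        using that T unfolding um by (simp add: y_def unity_def h_def \<nu>_def mult.assoc)
      have "dft N y m = (\<Sum>k<N. F (real k * (T / real N)) * cis (\<nu> * (real k * (T / real N)))) / of_nat N"
        unfolding dft_def by (intro arg_cong2[of _ _ _ _ "(/)"] sum.cong refl eq) auto
      moreover have "norm (avg (\<lambda>t. F t * cis (\<nu> * t)) 0 T
          - (\<Sum>k<N. F (real k * (T / real N)) * cis (\<nu> * (real k * (T / real N)))) / of_nat N)
          \<le> (L + \<bar>\<nu>\<bar> * B) * (T / real N)"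
        by (rule riemann_sum_le[where G = "\<lambda>t. F t * cis (\<nu> * t)"])
          (use assms(1,2) T N B in \<open>auto intro!: ap_mult ap_cis lipschitz_mult_cis\<close>)
      moreover have "(L + \<bar>\<nu>\<bar> * B) * (T / real N) \<le> (L + 2 * pi * A * B) * (T / real N)"
        using \<nu> B T by (intro mult_right_mono add_left_mono) auto
      moreover have "norm (avg (\<lambda>t. F t * cis (\<nu> * t)) 0 T) \<le> \<eta> / 2" using n[OF \<nu>] by (simp add: T_def)
      ultimately show ?thesis using N2
        norm_triangle_sub[of "dft N y m" "avg (\<lambda>t. F t * cis (\<nu> * t)) 0 T"]
        by (simp add: norm_minus_commute)
    next
      case False
      have "norm (dft N y m) * norm (unity N (int m) - 1)
          \<le> (\<Sum>k<N. if Suc k < N then L * h else 2 * B) / real N"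
      proof (rule dft_high_frequency[OF N(1)])
        fix k assume "k < N"
        show "norm (y (Suc k) - y k) \<le> (if Suc k < N then L * h else 2 * B)"
        proof (cases "Suc k < N")
          case True
          have "real (Suc k) * h - real k * h = h" by (simp add: algebra_simps)
          moreover have "h \<ge> 0" using T by (simp add: h_def)
          ultimately have "norm (F (real (Suc k) * h) - F (real k * h)) \<le> L * h"
            using assms(2)[of "real (Suc k) * h" "real k * h"] by (simp only: abs_of_nonneg)
          then show ?thesis using True by (simp add: y_def)
        next
          case False
          then show ?thesis using norm_triangle_ineq4[of "y (Suc k)" "y k"]
            B(2)[of "real (Suc k mod N) * h"] B(2)[of "real (k mod N) * h"] by (simp add: y_def)
        qed
      qed (simp add: y_def)
      also have "(\<Sum>k<N. if Suc k < N then L * h else 2 * B) \<le> L * T + 2 * B"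
      proof -
        have "(\<Sum>k<N. if Suc k < N then L * h else 2 * B) \<le> (\<Sum>k<N. L * h + (if k = N - 1 then 2 * B else 0))"
          using L B T by (intro sum_mono) (auto simp: h_def)
        also have "\<dots> = L * T + 2 * B" using N by (simp add: sum.distrib sum.delta h_def)
        finally show ?thesis .
      qed
      finally have 1: "norm (dft N y m) * norm (unity N (int m) - 1) \<le> (L * T + 2 * B) / real N"
        using N by (simp add: divide_right_mono)
      have "2 * (A * T) / real N \<le> 2 * \<bar>real_of_int z\<bar> / real N"
        using False by (intro divide_right_mono) auto
      also have "\<dots> \<le> norm (unity N (int m) - 1)" unfolding um1 by (rule unity_minus_1_ge[OF N(1) z])
      finally have "norm (dft N y m) * (2 * (A * T) / real N) \<le> norm (dft N y m) * norm (unity N (int m) - 1)"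
        by (intro mult_left_mono) auto
      also note 1
      \<comment> \<open>The jump term is multiplied by T, which is at least 1, so that T
        cancels.\<close>
      also have "(L * T + 2 * B) / real N \<le> (L * T + 2 * B * T) / real N"
        using T B by (intro divide_right_mono add_left_mono) auto
      also have "L * T + 2 * B * T = (2 * \<eta> * A) * T" using \<open>\<eta> > 0\<close> by (simp add: A_def distrib_right)
      also have "(2 * \<eta> * A) * T / real N = \<eta> * (2 * (A * T) / real N)" by simp
      finally show ?thesis
        by (rule mult_right_le_imp_le) (use A T N in simp)
    qed
  qed
  then show thesis using N(2) by (intro that[of N h]) (auto simp: y_def)
qed

lemma has_mean_translate: "ap F \<Longrightarrow> has_mean F a \<Longrightarrow> has_mean (\<lambda>t. F (t + u)) a"
  unfolding has_mean_def avg_translate[symmetric] by blast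

theorem ap_uniqueness:
  assumes "ap F" "\<And>s t. norm (F s - F t) \<le> L * \<bar>s - t\<bar>"
    and "\<And>\<nu>. has_mean (\<lambda>t. F t * cis (\<nu> * t)) 0"
  shows "F u = 0"
proof (rule ccontr)
  assume nz: "F u \<noteq> 0"
  let ?G = "\<lambda>t. F (t + u)"
  have G: "ap ?G" by (rule ap_translate[OF assms(1)])
  have mean: "has_mean (\<lambda>t. ?G t * cis (\<nu> * t)) 0" for \<nu>
  proof -
    have "has_mean (\<lambda>t. cis (- (\<nu> * u)) * (F (t + u) * cis (\<nu> * (t + u)))) (cis (- (\<nu> * u)) * 0)"
      using has_mean_translate[OF _ assms(3)[of \<nu>]] ap_mult[OF assms(1) ap_cis]
        ap_translate[OF ap_mult[OF assms(1) ap_cis]] by (intro has_mean_cmult) auto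
    also have "(\<lambda>t. cis (- (\<nu> * u)) * (F (t + u) * cis (\<nu> * (t + u)))) = (\<lambda>t. ?G t * cis (\<nu> * t))"
      by (auto simp: fun_eq_iff cis_mult ring_distribs mult_ac)
    finally show ?thesis by simp
  qed
  have lip: "norm (?G s - ?G t) \<le> L * \<bar>s - t\<bar>" for s t using assms(2)[of "s + u" "t + u"] by simp
  have "?G 0 \<noteq> 0" using nz by simp
  from ap_discrete_coefficients_large[OF G this] obtain \<eta> N\<^sub>0 where \<eta>: "\<eta> > 0"
    "\<And>N h. N \<ge> N\<^sub>0 \<Longrightarrow> N > 0 \<and> (\<exists>m<N. norm (dft N (\<lambda>i. ?G (real (i mod N) * h)) m) > \<eta>)" by metis
  obtain N h where "N \<ge> N\<^sub>0" "\<And>m. m < N \<Longrightarrow> norm (dft N (\<lambda>i. ?G (real (i mod N) * h)) m) \<le> \<eta>"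
    using ap_discrete_coefficients_small[OF G lip mean \<eta>(1), of N\<^sub>0] by metis
  then show False using \<eta>(2)[of N h] by (meson not_le)
qed

subsection \<open>Almost periodic functions in a strip\<close>

lemma open_vertical_strip: "open (vertical_strip \<alpha> \<beta>)"
  unfolding vertical_strip_def
  by (intro open_Collect_conj open_Collect_less continuous_intros)

lemma convex_vertical_strip: "convex (vertical_strip \<alpha> \<beta>)"
proof -
  have "vertical_strip \<alpha> \<beta> = Re -` {x. \<alpha> < ereal x \<and> ereal x < \<beta>}" by (auto simp: vertical_strip_def)
  moreover have "\<alpha> < ereal x \<and> ereal x < \<beta>" if "\<alpha> < ereal a" "ereal b < \<beta>" "a \<le> x" "x \<le> b" for a b x
    using that less_le_trans[of \<alpha> "ereal a" "ereal x"] le_less_trans[of "ereal x" "ereal b" \<beta>] by simp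
  then have "is_interval {x. \<alpha> < ereal x \<and> ereal x < \<beta>}"
    unfolding is_interval_1 mem_Collect_eq by blast
  ultimately show ?thesis
    by (simp only: is_interval_convex_1 convex_linear_vimage bounded_linear.linear[OF bounded_linear_Re])
qed

locale strip_ap =
  fixes f :: "complex \<Rightarrow> complex" and \<alpha> \<beta> :: ereal
  assumes nonempty: "\<alpha> < \<beta>" and ap_strip: "almost_periodic_in_strip f \<alpha> \<beta>"
begin

abbreviation inside :: "real \<Rightarrow> bool" where
  "inside \<sigma> \<equiv> \<alpha> < ereal \<sigma> \<and> ereal \<sigma> < \<beta>"

lemma inside_between: "inside a \<Longrightarrow> inside b \<Longrightarrow> a \<le> x \<Longrightarrow> x \<le> b \<Longrightarrow> inside x"
  using less_le_trans[of \<alpha> "ereal a" "ereal x"] le_less_trans[of "ereal x" "ereal b" \<beta>] by simp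

lemma holomorphic: "f holomorphic_on vertical_strip \<alpha> \<beta>"
  using ap_strip open_vertical_strip
  by (simp add: almost_periodic_in_strip_def analytic_on_open)

lemma almost_periods:
  assumes "inside a" "inside b" "a < b" "\<epsilon> > 0"
  obtains l where "l > 0" "\<And>x. \<exists>\<tau>\<in>{x..x+l}. \<forall>s. a \<le> Re s \<and> Re s \<le> b \<longrightarrow>
       norm (f (s + \<i> * complex_of_real \<tau>) - f s) \<le> \<epsilon>"
  using ap_strip assms unfolding almost_periodic_in_strip_def by meson

lemma margin:
  assumes "inside \<sigma>"
  obtains \<delta> where "\<delta> > 0" "\<And>x. \<bar>x - \<sigma>\<bar> \<le> \<delta> \<Longrightarrow> inside x"
proof -
  obtain a where a: "\<alpha> < ereal a" "a < \<sigma>" using ereal_dense2[of \<alpha> "ereal \<sigma>"] assms by auto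
  obtain b where b: "ereal b < \<beta>" "\<sigma> < b" using ereal_dense2[of "ereal \<sigma>" \<beta>] assms by auto
  have ab: "inside a" "inside b"
    using a b assms by (metis less_ereal.simps(1) less_trans)+
  show thesis
  proof (rule that[of "min (\<sigma> - a) (b - \<sigma>)"])
    fix x assume "\<bar>x - \<sigma>\<bar> \<le> min (\<sigma> - a) (b - \<sigma>)"
    then show "inside x" by (intro inside_between[OF ab]) auto
  qed (use a b in auto)
qed

text \<open>The argument for a line, with the rectangle [a, b] x [0, l] as the compact set.\<close>

lemma bounded_on_reduced_strip:
  assumes "inside a" "inside b" "a < b"
  obtains B where "B > 0" "\<And>s. a \<le> Re s \<Longrightarrow> Re s \<le> b \<Longrightarrow> norm (f s) \<le> B"
proof -
  obtain l where l: "l > 0" "\<And>x. \<exists>\<tau>\<in>{x..x+l}. \<forall>s. a \<le> Re s \<and> Re s \<le> b \<longrightarrow>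
       norm (f (s + \<i> * complex_of_real \<tau>) - f s) \<le> 1"
    using almost_periods[OF assms zero_less_one] by metis
  let ?K = "cbox (Complex a 0) (Complex b l)"
  have "?K \<subseteq> vertical_strip \<alpha> \<beta>"
    using inside_between[OF assms(1,2)] by (auto simp: vertical_strip_def in_cbox_complex_iff)
  then have "continuous_on ?K f"
    using holomorphic holomorphic_on_imp_continuous_on holomorphic_on_subset by blast
  then have "bounded (f ` ?K)" by (intro compact_imp_bounded compact_continuous_image compact_cbox)
  then obtain C where C: "\<And>s. s \<in> ?K \<Longrightarrow> norm (f s) \<le> C" unfolding bounded_iff by blast
  show thesis
  proof (rule that[of "max C 0 + 1"])
    fix s assume s: "a \<le> Re s" "Re s \<le> b"
    obtain \<tau> where \<tau>: "\<tau> \<in> {- Im s..- Im s + l}" "norm (f (s + \<i> * complex_of_real \<tau>) - f s) \<le> 1"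
      using l(2)[of "- Im s"] s by blast
    have "norm (f (s + \<i> * complex_of_real \<tau>)) \<le> C"
      using s \<tau> by (intro C) (auto simp: in_cbox_complex_iff)
    then show "norm (f s) \<le> max C 0 + 1"
      using \<tau>(2) norm_triangle_ineq2[of "f s" "f (s + \<i> * complex_of_real \<tau>)"]
      by (simp add: norm_minus_commute)
  qed simp
qed

lemma continuous_line:
  assumes "inside \<sigma>" "g holomorphic_on vertical_strip \<alpha> \<beta>"
  shows "continuous_on A (\<lambda>t. g (Complex \<sigma> t))"
proof -
  have "continuous_on (vertical_strip \<alpha> \<beta>) g" using assms holomorphic_on_imp_continuous_on by blast
  moreover have "continuous_on A (Complex \<sigma>)"
    unfolding Complex_eq by (intro continuous_intros)
  ultimately show ?thesis
    by (rule continuous_on_compose2) (use assms in \<open>auto simp: vertical_strip_def\<close>)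
qed

lemma ap_line:
  assumes "inside \<sigma>" shows "ap (\<lambda>t. f (Complex \<sigma> t))"
proof (rule bohr_imp_ap)
  show "continuous_on UNIV (\<lambda>t. f (Complex \<sigma> t))" by (rule continuous_line[OF assms holomorphic])
  fix \<epsilon> :: real assume "\<epsilon> > 0"
  obtain \<delta> where \<delta>: "\<delta> > 0" "\<And>x. \<bar>x - \<sigma>\<bar> \<le> \<delta> \<Longrightarrow> inside x" using margin[OF assms] by metis
  \<comment> \<open>Almost periods are provided for reduced strips of positive width only, so the
    line is taken as the left edge of one.\<close>
  have "inside (\<sigma> + \<delta>)" using \<delta> by simp
  then obtain l where l: "l > 0" "\<And>x. \<exists>\<tau>\<in>{x..x+l}. \<forall>s. \<sigma> \<le> Re s \<and> Re s \<le> \<sigma> + \<delta> \<longrightarrow>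
       norm (f (s + \<i> * complex_of_real \<tau>) - f s) \<le> \<epsilon>"
    using almost_periods[OF assms _ _ \<open>\<epsilon> > 0\<close>, of "\<sigma> + \<delta>"] \<delta> by (metis less_add_same_cancel1)
  have *: "Complex \<sigma> (t + p) = Complex \<sigma> t + \<i> * complex_of_real p" for t p
    by (simp add: complex_eq_iff)
  have "\<exists>p\<in>{x..x+l}. \<forall>t. norm (f (Complex \<sigma> (t + p)) - f (Complex \<sigma> t)) \<le> \<epsilon>" for x
  proof -
    obtain p where p: "p \<in> {x..x+l}" "\<And>s. \<sigma> \<le> Re s \<Longrightarrow> Re s \<le> \<sigma> + \<delta> \<Longrightarrow>
       norm (f (s + \<i> * complex_of_real p) - f s) \<le> \<epsilon>" using l(2)[of x] by blast
    have "norm (f (Complex \<sigma> (t + p)) - f (Complex \<sigma> t)) \<le> \<epsilon>" for t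
      unfolding * using \<delta>(1) by (intro p(2)) auto
    then show ?thesis using p(1) by blast
  qed
  then show "\<exists>l>0. \<forall>x. \<exists>p\<in>{x..x+l}. \<forall>t. norm (f (Complex \<sigma> (t + p)) - f (Complex \<sigma> t)) \<le> \<epsilon>"
    using l(1) by blast
qed

text \<open>Cauchy's estimate on discs of radius delta about the points of the line bounds the
  derivative there by B / delta.\<close>

lemma lipschitz_line:
  assumes "inside \<sigma>"
  obtains L where "\<And>s t. norm (f (Complex \<sigma> s) - f (Complex \<sigma> t)) \<le> L * \<bar>s - t\<bar>"
proof -
  obtain \<delta> where \<delta>: "\<delta> > 0" "\<And>x. \<bar>x - \<sigma>\<bar> \<le> \<delta> \<Longrightarrow> inside x" using margin[OF assms] by metis
  obtain B where B: "B > 0" "\<And>s. \<sigma> - \<delta> \<le> Re s \<Longrightarrow> Re s \<le> \<sigma> + \<delta> \<Longrightarrow> norm (f s) \<le> B"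
  proof (rule bounded_on_reduced_strip[of "\<sigma> - \<delta>" "\<sigma> + \<delta>"])
    show "inside (\<sigma> - \<delta>)" "inside (\<sigma> + \<delta>)" using \<delta> by auto
  qed (use \<delta> in auto)
  have Re: "\<bar>Re w - Re z\<bar> \<le> norm (z - w)" for w z :: complex
    using abs_Re_le_cmod[of "z - w"] by simp
  have deriv: "norm (deriv f z) \<le> B / \<delta>" if "Re z = \<sigma>" for z
  proof -
    have sub: "cball z \<delta> \<subseteq> vertical_strip \<alpha> \<beta>"
    proof
      fix w assume "w \<in> cball z \<delta>"
      then have "\<bar>Re w - \<sigma>\<bar> \<le> \<delta>" using Re[of w z] that by (simp add: dist_norm)
      then show "w \<in> vertical_strip \<alpha> \<beta>" using \<delta>(2) by (simp add: vertical_strip_def)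
    qed
    have "norm ((deriv ^^ 1) f z) \<le> fact 1 * B / \<delta> ^ 1"
    proof (rule Cauchy_inequality)
      show "f holomorphic_on ball z \<delta>"
        using holomorphic_on_subset[OF holomorphic] sub ball_subset_cball by blast
      show "continuous_on (cball z \<delta>) f"
        using holomorphic_on_imp_continuous_on holomorphic_on_subset[OF holomorphic sub] by blast
      fix w assume "norm (z - w) = \<delta>"
      then have "\<bar>Re w - \<sigma>\<bar> \<le> \<delta>" using Re[of w z] that by simp
      then show "norm (f w) \<le> B" by (intro B) (auto simp: abs_le_iff)
    qed (rule \<delta>)
    then show ?thesis by simp
  qed
  have "norm (f (Complex \<sigma> s) - f (Complex \<sigma> t)) \<le> B / \<delta> * norm (Complex \<sigma> s - Complex \<sigma> t)" for s t
  proof (rule field_differentiable_bound[where S = "{z. Re z = \<sigma>}" and f' = "deriv f"])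
    show "convex {z. Re z = \<sigma>}" by (auto simp: convex_def simp flip: distrib_right)
    fix z assume z: "z \<in> {z. Re z = \<sigma>}"
    then have "z \<in> vertical_strip \<alpha> \<beta>" using assms by (auto simp: vertical_strip_def)
    then show "(f has_field_derivative deriv f z) (at z within {z. Re z = \<sigma>})"
      using holomorphic_derivI[OF holomorphic open_vertical_strip] has_field_derivative_at_within by blast
    show "norm (deriv f z) \<le> B / \<delta>" using deriv z by simp
  qed auto
  moreover have "norm (Complex \<sigma> s - Complex \<sigma> t) = \<bar>s - t\<bar>" for s t
    by (simp add: cmod_def)
  ultimately show thesis using that by metis
qed

section \<open>Fourier coefficients on vertical lines\<close>

lemma exp_line: "exp (- (complex_of_real \<mu> * Complex \<sigma> t)) = of_real (exp (- (\<mu> * \<sigma>))) * cis (- \<mu> * t)"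
proof -
  have "- (complex_of_real \<mu> * Complex \<sigma> t) = of_real (- (\<mu> * \<sigma>)) + \<i> * of_real (- \<mu> * t)"
    by (simp add: Complex_eq algebra_simps)
  then show ?thesis by (simp only: exp_add cis_conv_exp exp_of_real)
qed

lemma ap_line_exp:
  assumes "inside \<sigma>"
  shows "ap (\<lambda>t. f (Complex \<sigma> t) * exp (- (complex_of_real \<mu> * Complex \<sigma> t)))"
  unfolding exp_line by (intro ap_mult ap_line ap_const ap_cis assms)

text \<open>In terms of a primitive of the integrand, the two integrals over \<open>[0, T]\<close> differ by the
  increments of the primitive along two horizontal segments, which are bounded in \<open>T\<close>.\<close>

lemma mean_independent_of_line:
  assumes "inside \<sigma>" "inside \<sigma>'" "\<sigma> < \<sigma>'"
    and "has_mean (\<lambda>t. f (Complex \<sigma> t) * exp (- (complex_of_real \<mu> * Complex \<sigma> t))) a"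
  shows "has_mean (\<lambda>t. f (Complex \<sigma>' t) * exp (- (complex_of_real \<mu> * Complex \<sigma>' t))) a"
proof (rule ap_has_mean_tendsto[OF ap_line_exp[OF assms(2)]])
  let ?k = "\<lambda>s. f s * exp (- (complex_of_real \<mu> * s))"
  have hol: "?k holomorphic_on vertical_strip \<alpha> \<beta>" by (intro holomorphic_intros holomorphic)
  obtain K where "\<And>x. x \<in> vertical_strip \<alpha> \<beta> \<Longrightarrow> (K has_field_derivative ?k x) (at x within vertical_strip \<alpha> \<beta>)"
    using holomorphic_convex_primitive'[OF convex_vertical_strip open_vertical_strip hol] by metis
  then have K: "(K has_field_derivative ?k x) (at x)" if "x \<in> vertical_strip \<alpha> \<beta>" for x
    using that at_within_open[OF that open_vertical_strip] by metis
  have int: "integral {0..T} (\<lambda>t. ?k (Complex \<sigma> t)) = (K (Complex \<sigma> T) - K (Complex \<sigma> 0)) / \<i>"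
    if "inside \<sigma>" "T > 0" for \<sigma> T
  proof -
    have "((\<lambda>t. K (Complex \<sigma> t) / \<i>) has_vector_derivative ?k (Complex \<sigma> t)) (at t within {0..T})" for t
    proof -
      have "(Complex \<sigma> has_vector_derivative \<i>) (at t within {0..T})"
        unfolding Complex_eq by (auto intro!: derivative_eq_intros has_vector_derivative_real_field)
      moreover have "(K has_field_derivative ?k (Complex \<sigma> t)) (at (Complex \<sigma> t) within Complex \<sigma> ` {0..T})"
        by (rule has_field_derivative_at_within, rule K) (use that in \<open>auto simp: vertical_strip_def\<close>)
      ultimately have "(K \<circ> Complex \<sigma> has_vector_derivative \<i> * ?k (Complex \<sigma> t)) (at t within {0..T})"
        by (rule field_vector_diff_chain_within)
      then have "((\<lambda>t. K (Complex \<sigma> t) / \<i>) has_vector_derivative (\<i> * ?k (Complex \<sigma> t)) / \<i>) (at t within {0..T})"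
        by (intro has_vector_derivative_divide) (simp add: o_def)
      then show ?thesis by simp
    qed
    then have "((\<lambda>t. ?k (Complex \<sigma> t)) has_integral (K (Complex \<sigma> T) / \<i> - K (Complex \<sigma> 0) / \<i>)) {0..T}"
      using that by (intro fundamental_theorem_of_calculus) auto
    then show ?thesis unfolding diff_divide_distrib by (rule integral_unique)
  qed
  obtain B where B: "B > 0" "\<And>s. \<sigma> \<le> Re s \<Longrightarrow> Re s \<le> \<sigma>' \<Longrightarrow> norm (f s) \<le> B"
    using bounded_on_reduced_strip[OF assms(1-3)] by metis
  define C where "C = B * exp (\<bar>\<mu>\<bar> * max \<bar>\<sigma>\<bar> \<bar>\<sigma>'\<bar>)"
  have kC: "norm (?k s) \<le> C" if "\<sigma> \<le> Re s" "Re s \<le> \<sigma>'" for s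
  proof -
    have "- (\<mu> * Re s) \<le> \<bar>\<mu>\<bar> * \<bar>Re s\<bar>" by (metis abs_ge_minus_self abs_mult)
    also have "\<dots> \<le> \<bar>\<mu>\<bar> * max \<bar>\<sigma>\<bar> \<bar>\<sigma>'\<bar>" using that by (intro mult_left_mono) auto
    finally show ?thesis unfolding norm_mult C_def using B that
      by (intro mult_mono) auto
  qed
  have Kdiff: "norm (K (Complex \<sigma>' T) - K (Complex \<sigma> T)) \<le> C * (\<sigma>' - \<sigma>)" for T
  proof -
    have "norm (K (Complex \<sigma>' T) - K (Complex \<sigma> T)) \<le> C * norm (Complex \<sigma>' T - Complex \<sigma> T)"
    proof (rule field_differentiable_bound[where S = "closed_segment (Complex \<sigma> T) (Complex \<sigma>' T)" and f' = ?k])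
      fix z assume "z \<in> closed_segment (Complex \<sigma> T) (Complex \<sigma>' T)"
      then obtain u where u: "0 \<le> u" "u \<le> 1" "z = (1 - u) *\<^sub>R Complex \<sigma> T + u *\<^sub>R Complex \<sigma>' T"
        by (auto simp: in_segment)
      have Rez: "Re z = \<sigma> + u * (\<sigma>' - \<sigma>)" unfolding u(3) by (simp add: algebra_simps)
      have "0 \<le> u * (\<sigma>' - \<sigma>)" "u * (\<sigma>' - \<sigma>) \<le> 1 * (\<sigma>' - \<sigma>)"
        using u assms(3) by (auto intro!: mult_right_mono mult_nonneg_nonneg)
      then have z: "\<sigma> \<le> Re z" "Re z \<le> \<sigma>'" unfolding Rez by auto
      show "norm (?k z) \<le> C" by (rule kC[OF z])
      have "z \<in> vertical_strip \<alpha> \<beta>" using inside_between[OF assms(1,2) z] by (simp add: vertical_strip_def)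
      then show "(K has_field_derivative ?k z) (at z within closed_segment (Complex \<sigma> T) (Complex \<sigma>' T))"
        by (rule has_field_derivative_at_within[OF K])
    qed auto
    then show ?thesis using assms(3) by (simp add: cmod_def)
  qed
  have "((\<lambda>T. avg (\<lambda>t. ?k (Complex \<sigma>' t)) 0 T - avg (\<lambda>t. ?k (Complex \<sigma> t)) 0 T) \<longlongrightarrow> 0) at_top"
  proof (rule Lim_null_comparison)
    show "\<forall>\<^sub>F T in at_top. norm (avg (\<lambda>t. ?k (Complex \<sigma>' t)) 0 T - avg (\<lambda>t. ?k (Complex \<sigma> t)) 0 T)
        \<le> (2 * C * (\<sigma>' - \<sigma>)) / T"
      using eventually_gt_at_top[of 0]
    proof eventually_elim
      case (elim T)
      have "avg (\<lambda>t. ?k (Complex \<sigma>' t)) 0 T - avg (\<lambda>t. ?k (Complex \<sigma> t)) 0 T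
         = ((K (Complex \<sigma>' T) - K (Complex \<sigma> T)) - (K (Complex \<sigma>' 0) - K (Complex \<sigma> 0))) / \<i> / of_real T"
        unfolding avg_def add_0 int[OF assms(1) elim] int[OF assms(2) elim]
        by (simp only: diff_divide_distrib) simp
      also have "norm \<dots> \<le> (C * (\<sigma>' - \<sigma>) + C * (\<sigma>' - \<sigma>)) / T"
        using elim Kdiff[of T] Kdiff[of 0]
          norm_triangle_ineq4[of "K (Complex \<sigma>' T) - K (Complex \<sigma> T)" "K (Complex \<sigma>' 0) - K (Complex \<sigma> 0)"]
        unfolding norm_divide norm_of_real norm_ii div_by_1 by (intro divide_mono) auto
      finally show ?case by (simp add: algebra_simps)
    qed
    show "((\<lambda>T. (2 * C * (\<sigma>' - \<sigma>)) / T) \<longlongrightarrow> 0) at_top"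
      by (rule real_tendsto_divide_at_top[OF tendsto_const filterlim_ident])
  qed
  from tendsto_add[OF this has_mean_tendsto[OF assms(4), of "\<lambda>_. 0"]]
  show "(avg (\<lambda>t. ?k (Complex \<sigma>' t)) 0 \<longlongrightarrow> a) at_top" by simp
qed

text \<open>A window of length T starting at -T/2 is symmetric, and T is then replaced by 2T. The
  starting point moves with T, which uniformity permits.\<close>

lemma symmetric_mean:
  assumes "has_mean F a"
  shows "((\<lambda>T. 1 / (2 * complex_of_real T) * integral {-T..T} F) \<longlongrightarrow> a) at_top"
proof -
  have "filterlim (\<lambda>T::real. 2 * T) at_top at_top"
    by (rule filterlim_tendsto_pos_mult_at_top[OF tendsto_const _ filterlim_ident]) simp
  from filterlim_compose[OF has_mean_tendsto[OF assms, of "\<lambda>T. - T / 2"] this]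
  show ?thesis by (simp add: avg_def)
qed

lemma has_mean_fourier_coeff:
  assumes "inside \<sigma>"
  shows "has_mean (\<lambda>t. f (Complex \<sigma> t) * exp (- (complex_of_real \<mu> * Complex \<sigma> t))) (fourier_coeff f \<alpha> \<beta> \<mu>)"
proof -
  let ?F = "\<lambda>\<sigma> t. f (Complex \<sigma> t) * exp (- (complex_of_real \<mu> * Complex \<sigma> t))"
  obtain a where a: "has_mean (?F \<sigma>) a" using ap_has_mean[OF ap_line_exp[OF assms]] by metis
  have all: "has_mean (?F \<sigma>') a" if \<sigma>': "inside \<sigma>'" for \<sigma>'
  proof (cases rule: linorder_cases[of \<sigma> \<sigma>'])
    case less then show ?thesis using mean_independent_of_line[OF assms \<sigma>' _ a] by simp
  next
    \<comment> \<open>\<open>mean_independent_of_line\<close> carries a mean to the right only, so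
      the mean on the line at sigma' is carried to sigma and compared there.\<close>
    case greater
    obtain b where b: "has_mean (?F \<sigma>') b" using ap_has_mean[OF ap_line_exp[OF \<sigma>']] by metis
    have "has_mean (?F \<sigma>) b" using mean_independent_of_line[OF \<sigma>' assms greater b] .
    then have "a = b" using a has_mean_unique by blast
    then show ?thesis using b by simp
  qed (use a in simp)
  have "fourier_coeff f \<alpha> \<beta> \<mu> = a"
    unfolding fourier_coeff_def
  proof (rule the_equality)
    show "\<forall>\<sigma>::real. \<alpha> < ereal \<sigma> \<longrightarrow> ereal \<sigma> < \<beta> \<longrightarrow>
        ((\<lambda>T::real. 1 / (2 * complex_of_real T) *
             integral {-T..T} (?F \<sigma>)) \<longlongrightarrow> a) at_top" using all symmetric_mean by blast
    fix b assume "\<forall>\<sigma>::real. \<alpha> < ereal \<sigma> \<longrightarrow> ereal \<sigma> < \<beta> \<longrightarrow>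
        ((\<lambda>T::real. 1 / (2 * complex_of_real T) *
             integral {-T..T} (?F \<sigma>)) \<longlongrightarrow> b) at_top"
    then have "((\<lambda>T::real. 1 / (2 * complex_of_real T) * integral {-T..T} (?F \<sigma>)) \<longlongrightarrow> b) at_top"
      using assms by blast
    then show "b = a" using symmetric_mean[OF a] tendsto_unique[OF trivial_limit_at_top_linorder] by blast
  qed
  then show ?thesis using a by simp
qed

text \<open>The sign is adapted to \<open>ap_uniqueness\<close>: multiplication by
  \<open>cis (\<nu> * t)\<close> singles out the exponent -nu.\<close>

lemma has_mean_line:
  assumes "inside \<sigma>"
  shows "has_mean (\<lambda>t. f (Complex \<sigma> t) * cis (\<nu> * t)) (fourier_coeff f \<alpha> \<beta> (- \<nu>) * exp (- \<nu> * \<sigma>))"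
proof -
  have "has_mean (\<lambda>t. of_real (exp (- \<nu> * \<sigma>)) * (f (Complex \<sigma> t) * exp (- (complex_of_real (- \<nu>) * Complex \<sigma> t))))
     (of_real (exp (- \<nu> * \<sigma>)) * fourier_coeff f \<alpha> \<beta> (- \<nu>))"
    by (intro has_mean_cmult has_mean_fourier_coeff ap_line_exp assms)
  moreover have "of_real (exp (- \<nu> * \<sigma>)) * (f (Complex \<sigma> t) * exp (- (complex_of_real (- \<nu>) * Complex \<sigma> t)))
      = f (Complex \<sigma> t) * cis (\<nu> * t)" for t
  proof -
    have "complex_of_real (exp (- \<nu> * \<sigma>)) * of_real (exp (- (- \<nu> * \<sigma>))) = 1"
      by (simp flip: of_real_mult exp_add)
    then show ?thesis unfolding exp_line minus_minus by (simp only: mult.left_commute mult.assoc[symmetric] mult_1)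
       (simp only: mult_1 mult_1_right)
  qed
  ultimately show ?thesis by (simp only: mult.commute)
qed

end

section \<open>Tails of unordered sums\<close>

lemma summable_tail:
  fixes g :: "real \<Rightarrow> real"
  assumes "g summable_on X" "\<And>x. x \<in> X \<Longrightarrow> g x \<ge> 0" "\<epsilon> > 0"
  obtains E where "finite E" "E \<subseteq> X" "infsum g (X - E) \<le> \<epsilon>"
proof -
  obtain E where E: "finite E" "E \<subseteq> X" "dist (sum g E) (infsum g X) \<le> \<epsilon>"
    using infsum_finite_approximation[OF assms(1,3)] by metis
  have "infsum g (X - E) = infsum g X - sum g E"
    using infsum_Diff[OF assms(1) summable_on_finite[OF E(1)] E(2)] E(1) by simp
  then show thesis using E that by (auto simp: dist_real_def)
qed

text \<open>The majorant \<open>g\<close> is kept apart from \<open>h\<close> because the terms will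
  depend on a point of the line or strip while their majorant does not.\<close>

lemma infsum_minus_sum_le:
  fixes h :: "real \<Rightarrow> complex"
  assumes "g summable_on X" "finite E" "E \<subseteq> X" "\<And>x. x \<in> X \<Longrightarrow> norm (h x) \<le> g x"
  shows "norm (infsum h X - sum h E) \<le> infsum g (X - E)"
proof -
  have g: "g summable_on A" if "A \<subseteq> X" for A using summable_on_subset_banach[OF assms(1) that] .
  have nh: "(\<lambda>x. norm (h x)) summable_on A" if "A \<subseteq> X" for A
    by (rule summable_on_comparison_test[OF g[OF that]]) (use assms(4) that in auto)
  have h: "h summable_on A" if "A \<subseteq> X" for A
    using abs_summable_summable[OF nh[OF that]] .
  have "infsum h (X - E) = infsum h X - sum h E"
    using infsum_Diff[OF h[OF order_refl] h[OF assms(3)] assms(3)] assms(2) by simp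
  then have "norm (infsum h X - sum h E) = norm (infsum h (X - E))" by simp
  also have "\<dots> \<le> infsum (\<lambda>x. norm (h x)) (X - E)" by (intro norm_infsum_bound nh) auto
  also have "\<dots> \<le> infsum g (X - E)" by (intro infsum_mono nh g) (use assms(4) in auto)
  finally show ?thesis .
qed

subsection \<open>Absolute convergence of the Dirichlet series\<close>

text \<open>The free phases theta are there to be matched with the arguments of the coefficients
  under test. For a finite subset of a rationally independent set the product has mean 1.\<close>

definition riesz :: "(real \<Rightarrow> real) \<Rightarrow> real set \<Rightarrow> real \<Rightarrow> real" where
  "riesz \<theta> E t = (\<Prod>\<mu>\<in>E. 1 + cos (\<mu> * t + \<theta> \<mu>))"

lemma riesz_nonneg: "riesz \<theta> E t \<ge> 0"
proof -
  have "1 + cos x \<ge> 0" for x :: real using cos_ge_minus_one[of x] by linarith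
  then show ?thesis unfolding riesz_def by (intro prod_nonneg) blast
qed

lemma cos_conv_cis: "complex_of_real (cos x) = (cis x + cis (- x)) / 2"
  by (simp add: complex_eq_iff)

lemma riesz_insert:
  assumes "finite E" "\<mu> \<notin> E"
  shows "complex_of_real (riesz \<theta> (insert \<mu> E) t) = of_real (riesz \<theta> E t)
     + cis (\<theta> \<mu>) / 2 * (of_real (riesz \<theta> E t) * cis (\<mu> * t))
     + cis (- \<theta> \<mu>) / 2 * (of_real (riesz \<theta> E t) * cis (- \<mu> * t))"
proof -
  have "complex_of_real (riesz \<theta> (insert \<mu> E) t) = (1 + of_real (cos (\<mu> * t + \<theta> \<mu>))) * of_real (riesz \<theta> E t)"
    using assms by (simp add: riesz_def)
  also have "complex_of_real (cos (\<mu> * t + \<theta> \<mu>)) = cis (\<theta> \<mu>) / 2 * cis (\<mu> * t) + cis (- \<theta> \<mu>) / 2 * cis (- \<mu> * t)"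
    unfolding cos_conv_cis by (simp add: cis_mult add.commute add_divide_distrib)
  finally show ?thesis by (simp only: distrib_left distrib_right mult_1 mult_ac add_ac)
qed

lemma ap_riesz: "finite E \<Longrightarrow> ap (\<lambda>t. of_real (riesz \<theta> E t))"
proof (induction E rule: finite_induct)
  case empty
  then show ?case by (simp add: riesz_def ap_const)
next
  case (insert \<mu> E)
  show ?case unfolding riesz_insert[OF insert(1,2)]
    by (intro ap_add ap_mult ap_const ap_cis insert.IH)
qed

text \<open>Multiplication by one more factor of the Riesz product replaces the Fourier coefficient
  \<open>c \<nu>\<close> by a combination of \<open>c \<nu>\<close> and \<open>c (\<nu> \<plusminus> \<mu>)\<close>; independence makes the latter
  vanish unless \<open>\<nu> = 0\<close>.\<close>

lemma has_mean_riesz: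
  assumes G: "ap G" "\<And>\<nu>. has_mean (\<lambda>t. G t * cis (\<nu> * t)) (c \<nu>)"
    and ind: "real_over_rat.independent \<Lambda>"
    and van: "\<And>\<mu> \<nu>. \<mu> \<in> \<Lambda> \<Longrightarrow> \<nu> \<in> real_over_rat.span (\<Lambda> - {\<mu>}) \<Longrightarrow> \<nu> \<noteq> 0 \<Longrightarrow> c (\<nu> + \<mu>) = 0 \<and> c (\<nu> - \<mu>) = 0"
    and "finite E" "E \<subseteq> \<Lambda>" "\<nu> \<in> real_over_rat.span (\<Lambda> - E)"
  shows "has_mean (\<lambda>t. G t * of_real (riesz \<theta> E t) * cis (\<nu> * t))
     (if \<nu> = 0 then c 0 + (\<Sum>\<mu>\<in>E. cis (\<theta> \<mu>) * c \<mu> + cis (- \<theta> \<mu>) * c (- \<mu>)) / 2 else c \<nu>)"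
  using assms(5-)
proof (induction E arbitrary: \<nu> rule: finite_induct)
  case empty
  then show ?case using G(2)[of \<nu>] by (cases "\<nu> = 0") (simp_all add: riesz_def)
next
  case (insert \<mu> E)
  let ?R = "\<lambda>t. complex_of_real (riesz \<theta> E t)"
  let ?v = "\<lambda>\<nu>. if \<nu> = 0 then c 0 + (\<Sum>\<mu>\<in>E. cis (\<theta> \<mu>) * c \<mu> + cis (- \<theta> \<mu>) * c (- \<mu>)) / 2 else c \<nu>"
  have \<mu>: "\<mu> \<in> \<Lambda> - E" "\<mu> \<in> \<Lambda>" using insert by auto
  have span1: "\<nu> \<in> real_over_rat.span (\<Lambda> - E)"
    using insert.prems real_over_rat.span_mono[of "\<Lambda> - insert \<mu> E" "\<Lambda> - E"] by blast
  have \<nu>: "\<nu> \<in> real_over_rat.span (\<Lambda> - {\<mu>})"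
    using insert.prems real_over_rat.span_mono[of "\<Lambda> - insert \<mu> E" "\<Lambda> - {\<mu>}"] by blast
  have \<mu>span: "\<mu> \<in> real_over_rat.span (\<Lambda> - E)" using \<mu> by (intro real_over_rat.span_base)
  have not: "\<mu> \<notin> real_over_rat.span (\<Lambda> - {\<mu>})"
    using ind \<mu> unfolding real_over_rat.dependent_def by blast
  have ne: "\<nu> + \<mu> \<noteq> 0" "\<nu> + (- \<mu>) \<noteq> 0"
  proof -
    show "\<nu> + \<mu> \<noteq> 0" using not real_over_rat.span_neg[OF \<nu>] by (metis add_eq_0_iff)
    show "\<nu> + (- \<mu>) \<noteq> 0" using not \<nu> by auto
  qed
  have E: "E \<subseteq> \<Lambda>" using insert by simp
  have IH: "has_mean (\<lambda>t. G t * ?R t * cis (\<nu> * t)) (?v \<nu>)"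
    "has_mean (\<lambda>t. G t * ?R t * cis ((\<nu> + \<mu>) * t)) (c (\<nu> + \<mu>))"
    "has_mean (\<lambda>t. G t * ?R t * cis ((\<nu> + - \<mu>) * t)) (c (\<nu> + - \<mu>))"
    using insert.IH[OF E span1] insert.IH[OF E real_over_rat.span_add[OF span1 \<mu>span]]
      insert.IH[OF E real_over_rat.span_add[OF span1 real_over_rat.span_neg[OF \<mu>span]]] ne by simp_all
  have apR: "ap (\<lambda>t. G t * ?R t * cis (\<eta> * t))" for \<eta>
    by (intro ap_mult G ap_riesz insert.hyps ap_cis)
  have "has_mean (\<lambda>t. (G t * ?R t * cis (\<nu> * t) + cis (\<theta> \<mu>) / 2 * (G t * ?R t * cis ((\<nu> + \<mu>) * t)))
       + cis (- \<theta> \<mu>) / 2 * (G t * ?R t * cis ((\<nu> + - \<mu>) * t)))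
     ((?v \<nu> + cis (\<theta> \<mu>) / 2 * c (\<nu> + \<mu>)) + cis (- \<theta> \<mu>) / 2 * c (\<nu> + - \<mu>))"
    by (intro has_mean_add has_mean_cmult ap_add ap_cmult apR IH)
  moreover have "(G t * ?R t * cis (\<nu> * t) + cis (\<theta> \<mu>) / 2 * (G t * ?R t * cis ((\<nu> + \<mu>) * t)))
       + cis (- \<theta> \<mu>) / 2 * (G t * ?R t * cis ((\<nu> + - \<mu>) * t))
     = G t * of_real (riesz \<theta> (insert \<mu> E) t) * cis (\<nu> * t)" for t
    unfolding riesz_insert[OF insert.hyps(1,2)] distrib_right cis_mult[symmetric]
    by (simp add: algebra_simps)
  moreover have "(?v \<nu> + cis (\<theta> \<mu>) / 2 * c (\<nu> + \<mu>)) + cis (- \<theta> \<mu>) / 2 * c (\<nu> + - \<mu>)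
    = (if \<nu> = 0 then c 0 + (\<Sum>\<mu>\<in>insert \<mu> E. cis (\<theta> \<mu>) * c \<mu> + cis (- \<theta> \<mu>) * c (- \<mu>)) / 2 else c \<nu>)"
    using van[OF \<mu>(2) \<nu>] insert.hyps by (cases "\<nu> = 0") (simp_all add: add_divide_distrib)
  ultimately show ?case by simp
qed

text \<open>Supplies the vanishing hypothesis of \<open>has_mean_riesz\<close>: the last two claims
  for the coefficients \<open>b (- \<nu>)\<close> of a function with exponents in \<Lambda>, the
  first for the constant function 1.\<close>

lemma independent_not_combination:
  assumes "real_over_rat.independent \<Lambda>" "\<mu> \<in> \<Lambda>" "\<nu> \<in> real_over_rat.span (\<Lambda> - {\<mu>})"
  shows "\<nu> + \<mu> \<noteq> 0" "- (\<nu> + \<mu>) \<notin> \<Lambda>" "\<nu> \<noteq> 0 \<Longrightarrow> - (\<nu> - \<mu>) \<notin> \<Lambda>"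
proof -
  have not: "\<mu> \<notin> real_over_rat.span (\<Lambda> - {\<mu>})"
    using assms unfolding real_over_rat.dependent_def by blast
  have base: "\<kappa> \<in> real_over_rat.span (\<Lambda> - {\<mu>})" if "\<kappa> \<in> \<Lambda>" "\<kappa> \<noteq> \<mu>" for \<kappa>
    using that by (intro real_over_rat.span_base) auto
  show "\<nu> + \<mu> \<noteq> 0" using not real_over_rat.span_neg[OF assms(3)] by (metis add_eq_0_iff)
  show "- (\<nu> + \<mu>) \<notin> \<Lambda>"
  proof
    assume m: "- (\<nu> + \<mu>) \<in> \<Lambda>"
    show False
    proof (cases "- (\<nu> + \<mu>) = \<mu>")
      \<comment> \<open>Here mu = -nu/2, so mu lies in the span of the other exponents; the scalar
        1/2 is rational but not an integer.\<close>
      case True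
      then have "of_rat (- 1 / 2) * \<nu> = \<mu>" by (simp add: of_rat_minus of_rat_divide field_simps)
      then show False using not real_over_rat.span_scale[OF assms(3), of "- 1 / 2"] by simp
    next
      case False
      from real_over_rat.span_neg[OF real_over_rat.span_add[OF base[OF m False] assms(3)]]
      show False using not by simp
    qed
  qed
  show "- (\<nu> - \<mu>) \<notin> \<Lambda>" if "\<nu> \<noteq> 0"
  proof
    assume m: "- (\<nu> - \<mu>) \<in> \<Lambda>"
    have "- (\<nu> - \<mu>) \<noteq> \<mu>" using that by simp
    from real_over_rat.span_add[OF base[OF m this] assms(3)]
    show False using not by simp
  qed
qed

text \<open>For theta the arguments of the coefficients, the mean of \<open>F\<close> times the
  Riesz product is half the sum of the moduli. The product is nonnegative of mean 1, so that mean is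
  at most \<open>B\<close> in modulus.\<close>

lemma riesz_bound:
  assumes F: "ap F" "\<And>t. norm (F t) \<le> B" "\<And>\<nu>. has_mean (\<lambda>t. F t * cis (\<nu> * t)) (b (- \<nu>))"
    and ind: "real_over_rat.independent \<Lambda>" and b: "\<And>\<mu>. \<mu> \<notin> \<Lambda> \<Longrightarrow> b \<mu> = 0"
    and E: "finite E" "E \<subseteq> \<Lambda>"
  shows "(\<Sum>\<mu>\<in>E. norm (b \<mu>)) \<le> 2 * B"
proof -
  define \<theta> where "\<theta> = (\<lambda>\<mu>. Arg (b \<mu>))"
  let ?R = "\<lambda>t. complex_of_real (riesz \<theta> E t)"
  note comb = independent_not_combination[OF ind]
  have "0 \<notin> \<Lambda>" using ind real_over_rat.dependent_zero by blast
  then have b0: "b 0 = 0" by (rule b)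
  have zero: "0 \<in> real_over_rat.span (\<Lambda> - A)" for A by (rule real_over_rat.span_zero)
  have "has_mean (\<lambda>t. F t * ?R t * cis (0 * t))
     (if (0::real) = 0 then b (- 0) + (\<Sum>\<mu>\<in>E. cis (\<theta> \<mu>) * b (- \<mu>) + cis (- \<theta> \<mu>) * b (- (- \<mu>))) / 2 else b (- 0))"
    by (rule has_mean_riesz[where c = "\<lambda>\<nu>. b (- \<nu>)" and \<Lambda> = \<Lambda>, OF F(1,3) ind _ E zero]) (use b comb in auto)
  moreover have "cis (\<theta> \<mu>) * b (- \<mu>) + cis (- \<theta> \<mu>) * b (- (- \<mu>)) = of_real (norm (b \<mu>))" if "\<mu> \<in> E" for \<mu>
  proof -
    \<comment> \<open>By independence -mu is no exponent (the case nu = 0), so the conjugate half of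
      the cosine contributes nothing.\<close>
    have "b (- \<mu>) = 0" using b comb(2)[OF _ zero, of \<mu>] that E by auto
    moreover have "b \<mu> = of_real (norm (b \<mu>)) * cis (\<theta> \<mu>)"
      using rcis_cmod_Arg[of "b \<mu>"] by (simp add: rcis_def \<theta>_def)
    then have "cis (- \<theta> \<mu>) * b \<mu> = of_real (norm (b \<mu>)) * (cis (\<theta> \<mu>) * cis (- \<theta> \<mu>))"
      by (metis mult.assoc mult.commute)
    ultimately show ?thesis by (simp add: cis_mult)
  qed
  ultimately have meanF: "has_mean (\<lambda>t. F t * ?R t) (of_real ((\<Sum>\<mu>\<in>E. norm (b \<mu>)) / 2))"
    using b0 by simp
  have "has_mean (\<lambda>t. 1 * ?R t * cis (0 * t))
     (if (0::real) = 0 then (if (0::real) = 0 then 1 else 0) + (\<Sum>\<mu>\<in>E. cis (\<theta> \<mu>) * (if \<mu> = 0 then 1 else 0)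
        + cis (- \<theta> \<mu>) * (if - \<mu> = 0 then 1 else 0)) / 2 else (if (0::real) = 0 then 1 else 0))"
  proof (rule has_mean_riesz[where c = "\<lambda>\<nu>. if \<nu> = 0 then 1 else 0" and \<Lambda> = \<Lambda>, OF ap_const _ ind _ E zero])
    show "has_mean (\<lambda>t. 1 * cis (\<nu> * t)) (if \<nu> = 0 then 1 else 0)" for \<nu> using has_mean_cis by simp
    fix \<mu> \<nu> assume h: "\<mu> \<in> \<Lambda>" "\<nu> \<in> real_over_rat.span (\<Lambda> - {\<mu>})" "\<nu> \<noteq> 0"
    have "- \<nu> + \<mu> \<noteq> 0" by (rule comb(1)[OF h(1) real_over_rat.span_neg[OF h(2)]])
    then show "(if \<nu> + \<mu> = 0 then 1 else 0) = (0::complex) \<and> (if \<nu> - \<mu> = 0 then 1 else 0) = (0::complex)"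
      using comb(1)[OF h(1,2)] by auto
  qed
  moreover have "\<mu> \<noteq> 0" if "\<mu> \<in> E" for \<mu> using that E \<open>0 \<notin> \<Lambda>\<close> by auto
  ultimately have mean1: "has_mean ?R 1" by simp
  \<comment> \<open>Positivity of the Riesz product enters here: the integral of its modulus is its
    integral, which tends to 1 in the mean.\<close>
  have le: "norm (avg (\<lambda>t. F t * ?R t) 0 T) \<le> B * norm (avg ?R 0 T)" if "T > 0" for T
  proof -
    have cont: "continuous_on {0..0+T} (riesz \<theta> E)"
      unfolding riesz_def by (intro continuous_intros)
    have int: "riesz \<theta> E integrable_on {0..0+T}" by (rule integrable_continuous_real[OF cont])
    have "norm (integral {0..0+T} (\<lambda>t. F t * ?R t)) \<le> integral {0..0+T} (\<lambda>t. B * riesz \<theta> E t)"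
    proof (rule Henstock_Kurzweil_Integration.integral_norm_bound_integral)
      show "(\<lambda>t. F t * ?R t) integrable_on {0..0+T}" by (intro ap_integrable ap_mult F ap_riesz E)
      show "(\<lambda>t. B * riesz \<theta> E t) integrable_on {0..0+T}"
        using integrable_on_cmult_left[OF int, of B] by simp
      show "norm (F t * ?R t) \<le> B * riesz \<theta> E t" for t
        using F(2)[of t] riesz_nonneg[of \<theta> E t] by (simp add: norm_mult mult_right_mono)
    qed
    also have "\<dots> = B * integral {0..0+T} (riesz \<theta> E)" by simp
    also have "integral {0..0+T} (riesz \<theta> E) \<le> norm (integral {0..0+T} ?R)"
    proof -
      have "integral {0..0+T} (of_real \<circ> riesz \<theta> E) = complex_of_real (integral {0..0+T} (riesz \<theta> E))"
        by (rule integral_linear[OF int bounded_linear_of_real])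
      then show ?thesis by (simp add: o_def)
    qed
    finally have "norm (integral {0..0+T} (\<lambda>t. F t * ?R t)) \<le> B * norm (integral {0..0+T} ?R)"
      using order.trans[OF norm_ge_zero F(2)[of 0]] by (simp add: mult_left_mono)
    then show ?thesis using that by (simp add: avg_def norm_divide divide_right_mono)
  qed
  have "norm (complex_of_real ((\<Sum>\<mu>\<in>E. norm (b \<mu>)) / 2)) \<le> B * norm (1::complex)"
  proof (rule tendsto_le[OF trivial_limit_at_top_linorder])
    show "((\<lambda>T. norm (avg (\<lambda>t. F t * ?R t) 0 T)) \<longlongrightarrow> norm (complex_of_real ((\<Sum>\<mu>\<in>E. norm (b \<mu>)) / 2))) at_top"
      by (intro tendsto_norm has_mean_tendsto meanF)
    show "((\<lambda>T. B * norm (avg ?R 0 T)) \<longlongrightarrow> B * norm (1::complex)) at_top"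
      by (intro tendsto_intros has_mean_tendsto mean1)
    show "\<forall>\<^sub>F T in at_top. norm (avg (\<lambda>t. F t * ?R t) 0 T) \<le> B * norm (avg ?R 0 T)"
      using eventually_gt_at_top[of 0] by eventually_elim (rule le)
  qed
  then show ?thesis unfolding norm_of_real by (simp add: sum_nonneg)
qed

section \<open>Absolutely convergent trigonometric series\<close>

lemma ap_sum: "finite E \<Longrightarrow> (\<And>i. i \<in> E \<Longrightarrow> ap (F i)) \<Longrightarrow> ap (\<lambda>t. \<Sum>i\<in>E. F i t)"
  by (induction E rule: finite_induct) (auto intro: ap_const ap_add)

lemma has_mean_sum:
  "finite E \<Longrightarrow> (\<And>i. i \<in> E \<Longrightarrow> ap (F i)) \<Longrightarrow> (\<And>i. i \<in> E \<Longrightarrow> has_mean (F i) (m i)) \<Longrightarrow>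
    has_mean (\<lambda>t. \<Sum>i\<in>E. F i t) (\<Sum>i\<in>E. m i)"
proof (induction E rule: finite_induct)
  case empty
  have "has_mean (\<lambda>t. 0 * cis (0 * t)) (0 * (if (0::real) = 0 then 1 else 0))"
    by (intro has_mean_cmult ap_cis has_mean_cis)
  then show ?case by simp
qed (auto intro!: has_mean_add ap_sum)

context
  fixes X :: "real set" and b :: "real \<Rightarrow> complex"
  assumes summable: "(\<lambda>\<mu>. norm (b \<mu>)) summable_on X"
begin

definition trig_series :: "real \<Rightarrow> complex" where
  "trig_series t = (\<Sum>\<^sub>\<infinity>\<mu>\<in>X. b \<mu> * cis (\<mu> * t))"

lemma trig_series_approx:
  assumes "\<epsilon> > 0"
  obtains E where "finite E" "E \<subseteq> X" "infsum (\<lambda>\<mu>. norm (b \<mu>)) (X - E) \<le> \<epsilon>"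
    "\<And>t. norm (trig_series t - (\<Sum>\<mu>\<in>E. b \<mu> * cis (\<mu> * t))) \<le> \<epsilon>"
proof -
  obtain E where E: "finite E" "E \<subseteq> X" "infsum (\<lambda>\<mu>. norm (b \<mu>)) (X - E) \<le> \<epsilon>"
    using summable_tail[OF summable _ assms] by auto
  have "norm (trig_series t - (\<Sum>\<mu>\<in>E. b \<mu> * cis (\<mu> * t))) \<le> \<epsilon>" for t
    unfolding trig_series_def
    by (rule order.trans[OF infsum_minus_sum_le[OF summable E(1,2)] E(3)]) (simp add: norm_mult)
  then show thesis using E that by blast
qed

lemma ap_trig_series: "ap trig_series"
proof (rule ap_uniform_limit)
  fix \<epsilon> :: real assume "\<epsilon> > 0"
  then obtain E where E: "finite E" "\<And>t. norm (trig_series t - (\<Sum>\<mu>\<in>E. b \<mu> * cis (\<mu> * t))) \<le> \<epsilon>"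
    using trig_series_approx by metis
  have "ap (\<lambda>t. \<Sum>\<mu>\<in>E. b \<mu> * cis (\<mu> * t))" by (intro ap_sum E ap_cmult ap_cis)
  then show "\<exists>G. ap G \<and> (\<forall>t. norm (trig_series t - G t) \<le> \<epsilon>)" using E(2) by blast
qed

text \<open>A finite partial sum has the right mean at -nu if it contains that exponent; otherwise
  the missing coefficient is part of the small tail.\<close>

lemma has_mean_trig_series:
  "has_mean (\<lambda>t. trig_series t * cis (\<nu> * t)) (if - \<nu> \<in> X then b (- \<nu>) else 0)"
proof (rule has_mean_uniform_limit[OF ap_mult[OF ap_trig_series ap_cis]])
  fix \<epsilon> :: real assume \<epsilon>: "\<epsilon> > 0"
  obtain E where E: "finite E" "E \<subseteq> X" "infsum (\<lambda>\<mu>. norm (b \<mu>)) (X - E) \<le> \<epsilon>"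
    "\<And>t. norm (trig_series t - (\<Sum>\<mu>\<in>E. b \<mu> * cis (\<mu> * t))) \<le> \<epsilon>"
    using trig_series_approx[OF \<epsilon>] by metis
  let ?G = "\<lambda>t. \<Sum>\<mu>\<in>E. b \<mu> * cis ((\<mu> + \<nu>) * t)"
  have G: "ap ?G" by (intro ap_sum E ap_cmult ap_cis)
  have "has_mean ?G (\<Sum>\<mu>\<in>E. b \<mu> * (if \<mu> + \<nu> = 0 then 1 else 0))"
    by (intro has_mean_sum E ap_cmult ap_cis has_mean_cmult has_mean_cis)
  also have "(\<Sum>\<mu>\<in>E. b \<mu> * (if \<mu> + \<nu> = 0 then 1 else 0)) = (\<Sum>\<mu>\<in>E. if \<mu> = - \<nu> then b \<mu> else 0)"
    by (intro sum.cong) auto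
  also have "\<dots> = (if - \<nu> \<in> E then b (- \<nu>) else 0)" using E(1) by (simp add: sum.delta)
  finally have m: "has_mean ?G (if - \<nu> \<in> E then b (- \<nu>) else 0)" .
  have close: "norm (trig_series t * cis (\<nu> * t) - ?G t) \<le> \<epsilon>" for t
  proof -
    have "trig_series t * cis (\<nu> * t) - ?G t = (trig_series t - (\<Sum>\<mu>\<in>E. b \<mu> * cis (\<mu> * t))) * cis (\<nu> * t)"
      by (simp add: left_diff_distrib sum_distrib_right distrib_right cis_mult mult.assoc)
    then show ?thesis using E(4)[of t] by (simp add: norm_mult)
  qed
  have "norm (b (- \<nu>)) \<le> \<epsilon>" if "- \<nu> \<in> X - E"
  proof -
    have "(\<lambda>\<mu>. norm (b \<mu>)) summable_on (X - E)" by (rule summable_on_subset_banach[OF summable]) auto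
    from finite_sum_le_infsum[OF this, of "{- \<nu>}"] that show ?thesis using E(3) by simp
  qed
  then have "norm ((if - \<nu> \<in> E then b (- \<nu>) else 0) - (if - \<nu> \<in> X then b (- \<nu>) else 0)) \<le> \<epsilon>"
    using E(2) \<epsilon> by auto
  then show "\<exists>G m. ap G \<and> has_mean G m \<and> norm (m - (if - \<nu> \<in> X then b (- \<nu>) else 0)) \<le> \<epsilon> \<and>
      (\<forall>t. norm (trig_series t * cis (\<nu> * t) - G t) \<le> \<epsilon>)"
    using G m close by blast
qed

lemma trig_series_lipschitz:
  assumes "(\<lambda>\<mu>. norm (b \<mu>) * \<bar>\<mu>\<bar>) summable_on X"
  shows "norm (trig_series s - trig_series t) \<le> infsum (\<lambda>\<mu>. norm (b \<mu>) * \<bar>\<mu>\<bar>) X * \<bar>s - t\<bar>"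
proof -
  have sm: "(\<lambda>\<mu>. b \<mu> * cis (\<mu> * t)) summable_on X" for t
    by (rule abs_summable_summable) (simp add: norm_mult summable)
  have bound: "norm (b \<mu> * cis (\<mu> * s) - b \<mu> * cis (\<mu> * t)) \<le> norm (b \<mu>) * \<bar>\<mu>\<bar> * \<bar>s - t\<bar>" for \<mu>
  proof -
    have "norm (b \<mu> * cis (\<mu> * s) - b \<mu> * cis (\<mu> * t)) = norm (b \<mu>) * norm (cis (\<mu> * s) - cis (\<mu> * t))"
      by (simp add: norm_mult flip: right_diff_distrib)
    also have "\<dots> \<le> norm (b \<mu>) * \<bar>\<mu> * s - \<mu> * t\<bar>" by (intro mult_left_mono norm_cis_diff_le) auto
    finally show ?thesis by (simp add: abs_mult mult.assoc flip: right_diff_distrib)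
  qed
  have R: "(\<lambda>\<mu>. norm (b \<mu>) * \<bar>\<mu>\<bar> * \<bar>s - t\<bar>) summable_on X" by (rule summable_on_cmult_left[OF assms])
  have N: "(\<lambda>\<mu>. norm (b \<mu> * cis (\<mu> * s) - b \<mu> * cis (\<mu> * t))) summable_on X"
    by (rule summable_on_comparison_test[OF R]) (use bound in auto)
  have "trig_series s - trig_series t = (\<Sum>\<^sub>\<infinity>\<mu>\<in>X. b \<mu> * cis (\<mu> * s) - b \<mu> * cis (\<mu> * t))"
    using infsum_add[OF sm[of s] summable_on_uminus[THEN iffD2, OF sm[of t]]]
    by (simp add: trig_series_def infsum_uminus)
  also have "norm \<dots> \<le> (\<Sum>\<^sub>\<infinity>\<mu>\<in>X. norm (b \<mu> * cis (\<mu> * s) - b \<mu> * cis (\<mu> * t)))"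
    by (rule norm_infsum_bound[OF N])
  also have "\<dots> \<le> (\<Sum>\<^sub>\<infinity>\<mu>\<in>X. norm (b \<mu>) * \<bar>\<mu>\<bar> * \<bar>s - t\<bar>)"
    by (rule infsum_mono[OF N R]) (use bound in auto)
  also have "\<dots> = infsum (\<lambda>\<mu>. norm (b \<mu>) * \<bar>\<mu>\<bar>) X * \<bar>s - t\<bar>"
    by (rule infsum_cmult_left) (use assms in auto)
  finally show ?thesis .
qed

end

section \<open>Expansion of the function on vertical lines\<close>

text \<open>Trades the factor |mu| of a derivative for exponentials that move the abscissa by delta
  in either direction.\<close>

lemma abs_exp_le:
  fixes \<mu> \<delta> :: real assumes "\<delta> > 0"
  shows "\<bar>\<mu>\<bar> \<le> (exp (\<delta> * \<mu>) + exp (- \<delta> * \<mu>)) / \<delta>"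
proof -
  have "\<delta> * \<bar>\<mu>\<bar> \<le> exp (\<delta> * \<bar>\<mu>\<bar>)" using exp_ge_add_one_self[of "\<delta> * \<bar>\<mu>\<bar>"] by linarith
  also have "\<dots> \<le> exp (\<delta> * \<mu>) + exp (- \<delta> * \<mu>)" by (cases "\<mu> \<ge> 0") (auto simp: abs_if)
  finally show ?thesis using assms by (simp add: pos_le_divide_eq mult.commute)
qed

locale strip_ap_independent = strip_ap +
  assumes independent: "real_over_rat.independent (fourier_exponents f \<alpha> \<beta>)"
begin

abbreviation \<Lambda> :: "real set" where "\<Lambda> \<equiv> fourier_exponents f \<alpha> \<beta>"
abbreviation A :: "real \<Rightarrow> complex" where "A \<equiv> fourier_coeff f \<alpha> \<beta>"

lemma A_eq_0: "\<mu> \<notin> \<Lambda> \<Longrightarrow> A \<mu> = 0"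
  by (simp add: fourier_exponents_def)

lemma abs_summable:
  assumes "inside \<sigma>"
  shows "(\<lambda>\<mu>. norm (A \<mu>) * exp (\<mu> * \<sigma>)) summable_on \<Lambda>"
proof -
  obtain B where B: "\<And>t. norm (f (Complex \<sigma> t)) \<le> B" using ap_bounded[OF ap_line[OF assms]] by metis
  have "(\<Sum>\<mu>\<in>E. norm (A \<mu>) * exp (\<mu> * \<sigma>)) \<le> 2 * B" if "finite E" "E \<subseteq> \<Lambda>" for E
  proof -
    have "(\<Sum>\<mu>\<in>E. norm (A \<mu> * of_real (exp (\<mu> * \<sigma>)))) \<le> 2 * B"
      using has_mean_line[OF assms]
      by (intro riesz_bound[OF ap_line[OF assms] B _ independent _ that]) (auto simp: A_eq_0)
    then show ?thesis by (simp add: norm_mult)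
  qed
  then show ?thesis
    by (intro nonneg_bdd_above_summable_on bdd_aboveI2[where M = "2 * B"]) auto
qed

lemma abs_summable_times_exponent:
  assumes "inside \<sigma>"
  shows "(\<lambda>\<mu>. norm (A \<mu>) * exp (\<mu> * \<sigma>) * \<bar>\<mu>\<bar>) summable_on \<Lambda>"
proof -
  obtain \<delta> where \<delta>: "\<delta> > 0" "\<And>x. \<bar>x - \<sigma>\<bar> \<le> \<delta> \<Longrightarrow> inside x" using margin[OF assms] by metis
  have "(\<lambda>\<mu>. (norm (A \<mu>) * exp (\<mu> * (\<sigma> + \<delta>)) + norm (A \<mu>) * exp (\<mu> * (\<sigma> - \<delta>))) * (1 / \<delta>)) summable_on \<Lambda>"
    by (intro summable_on_cmult_left summable_on_add abs_summable) (use \<delta> in auto)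
  then show ?thesis
  proof (rule summable_on_comparison_test)
    fix \<mu> assume "\<mu> \<in> \<Lambda>"
    have "norm (A \<mu>) * exp (\<mu> * \<sigma>) * \<bar>\<mu>\<bar> \<le> norm (A \<mu>) * exp (\<mu> * \<sigma>) * ((exp (\<delta> * \<mu>) + exp (- \<delta> * \<mu>)) / \<delta>)"
      by (intro mult_left_mono abs_exp_le \<delta>) auto
    also have "\<dots> = (norm (A \<mu>) * exp (\<mu> * (\<sigma> + \<delta>)) + norm (A \<mu>) * exp (\<mu> * (\<sigma> - \<delta>))) * (1 / \<delta>)"
    proof -
      have "exp (\<mu> * (\<sigma> + \<delta>)) = exp (\<mu> * \<sigma>) * exp (\<delta> * \<mu>)" "exp (\<mu> * (\<sigma> - \<delta>)) = exp (\<mu> * \<sigma>) * exp (- \<delta> * \<mu>)"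
        by (simp_all add: algebra_simps flip: exp_add)
      then show ?thesis by (simp only: distrib_left mult.assoc times_divide_eq_right mult_1_right)
    qed
    finally show "norm (A \<mu>) * exp (\<mu> * \<sigma>) * \<bar>\<mu>\<bar> \<le> (norm (A \<mu>) * exp (\<mu> * (\<sigma> + \<delta>)) + norm (A \<mu>) * exp (\<mu> * (\<sigma> - \<delta>))) * (1 / \<delta>)" .
  qed auto
qed

lemma line_expansion:
  assumes "inside \<sigma>"
  shows "f (Complex \<sigma> t) = (\<Sum>\<^sub>\<infinity>\<mu>\<in>\<Lambda>. A \<mu> * of_real (exp (\<mu> * \<sigma>)) * cis (\<mu> * t))"
proof -
  let ?b = "\<lambda>\<mu>. A \<mu> * of_real (exp (\<mu> * \<sigma>))"
  have sm: "(\<lambda>\<mu>. norm (?b \<mu>)) summable_on \<Lambda>" using abs_summable[OF assms] by (simp add: norm_mult)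
  let ?G = "trig_series \<Lambda> ?b"
  obtain L where L: "\<And>s t. norm (f (Complex \<sigma> s) - f (Complex \<sigma> t)) \<le> L * \<bar>s - t\<bar>"
    using lipschitz_line[OF assms] by metis
  let ?M = "infsum (\<lambda>\<mu>. norm (?b \<mu>) * \<bar>\<mu>\<bar>) \<Lambda>"
  have M: "norm (?G s - ?G t) \<le> ?M * \<bar>s - t\<bar>" for s t
    by (rule trig_series_lipschitz[OF sm]) (use abs_summable_times_exponent[OF assms] in \<open>simp add: norm_mult\<close>)
  have "f (Complex \<sigma> t) - ?G t = 0"
  proof (rule ap_uniqueness)
    show "ap (\<lambda>t. f (Complex \<sigma> t) - ?G t)" by (intro ap_diff ap_line assms ap_trig_series sm)
    show "norm ((f (Complex \<sigma> s) - ?G s) - (f (Complex \<sigma> t) - ?G t)) \<le> (L + ?M) * \<bar>s - t\<bar>" for s t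
    proof -
      have "(f (Complex \<sigma> s) - ?G s) - (f (Complex \<sigma> t) - ?G t) = (f (Complex \<sigma> s) - f (Complex \<sigma> t)) - (?G s - ?G t)"
        by simp
      also have "norm \<dots> \<le> L * \<bar>s - t\<bar> + ?M * \<bar>s - t\<bar>" by (intro norm_triangle_le_diff add_mono L M)
      finally show ?thesis by (simp add: distrib_right)
    qed
    fix \<nu>
    have "has_mean (\<lambda>t. f (Complex \<sigma> t) * cis (\<nu> * t) + (-1) * (?G t * cis (\<nu> * t)))
       (A (- \<nu>) * exp (- \<nu> * \<sigma>) + (-1) * (if - \<nu> \<in> \<Lambda> then ?b (- \<nu>) else 0))"
      by (intro has_mean_add has_mean_cmult ap_mult ap_cmult ap_cis ap_line ap_trig_series has_mean_line
          has_mean_trig_series assms sm)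
    moreover have "A (- \<nu>) * exp (- \<nu> * \<sigma>) + (-1) * (if - \<nu> \<in> \<Lambda> then ?b (- \<nu>) else 0) = 0"
      using A_eq_0[of "- \<nu>"] by simp
    moreover have "f (Complex \<sigma> t) * cis (\<nu> * t) + (-1) * (?G t * cis (\<nu> * t)) = (f (Complex \<sigma> t) - ?G t) * cis (\<nu> * t)" for t
      by (simp add: algebra_simps)
    ultimately show "has_mean (\<lambda>t. (f (Complex \<sigma> t) - ?G t) * cis (\<nu> * t)) 0" by simp
  qed
  then show ?thesis by (simp add: trig_series_def[OF sm])
qed

end

subsection \<open>Zeros of the function\<close>

text \<open>The modulus |x + y e^(i phi)| passes continuously from x + y to |x - y| as phi goes from
  0 to pi. The inequalities place z in between, and a side of length z closes the triangle.\<close>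

lemma triangle_phases:
  fixes x y z :: real
  assumes "0 \<le> x" "0 \<le> y" "0 \<le> z" "x \<le> y + z" "y \<le> x + z" "z \<le> x + y"
  obtains u v :: complex where "norm u = 1" "norm v = 1" "of_real x + of_real y * u + of_real z * v = 0"
proof -
  let ?g = "\<lambda>\<phi>. norm (complex_of_real x + of_real y * cis \<phi>)"
  have "\<exists>\<phi>\<ge>0. \<phi> \<le> pi \<and> ?g \<phi> = z"
  proof (rule IVT2')
    have "?g pi = \<bar>x - y\<bar>" by (metis cis_pi mult_minus1_right norm_of_real of_real_diff diff_conv_add_uminus)
    then show "?g pi \<le> z" using assms by auto
    have "?g 0 = x + y" using assms by (simp flip: of_real_add)
    then show "z \<le> ?g 0" using assms by simp
    show "continuous_on {0..pi} ?g" by (intro continuous_intros)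
  qed simp
  then obtain \<phi> where \<phi>: "?g \<phi> = z" by blast
  let ?w = "complex_of_real x + of_real y * cis \<phi>"
  show thesis
  proof (cases "z = 0")
    case True
    then show thesis using that[of "cis \<phi>" 1] \<phi> by simp
  next
    case False
    show thesis
    proof (rule that[of "cis \<phi>" "- ?w / of_real z"])
      show "norm (- ?w / of_real z) = 1"
        unfolding norm_divide norm_minus_cancel \<phi> using False assms(3) by simp
      show "of_real x + of_real y * cis \<phi> + of_real z * (- ?w / of_real z) = 0"
        using False by (simp only: nonzero_mult_div_cancel_left times_divide_eq_right of_real_eq_0_iff) simp
    qed simp
  qed
qed

text \<open>Take a minimal finite set of sides whose total exceeds half of the perimeter. One side of it,
  the rest of it and its complement form a triangle.\<close>

lemma polygon_phases:
  fixes r :: "real \<Rightarrow> real"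
  assumes "r summable_on X" "\<And>x. x \<in> X \<Longrightarrow> r x \<ge> 0" "\<And>x. x \<in> X \<Longrightarrow> 2 * r x \<le> infsum r X"
    "infsum r X > 0"
  obtains \<theta> :: "real \<Rightarrow> complex" where "\<And>x. norm (\<theta> x) = 1" "(\<Sum>\<^sub>\<infinity>x\<in>X. of_real (r x) * \<theta> x) = 0"
proof -
  let ?W = "infsum r X"
  let ?P = "\<lambda>E. finite E \<and> E \<subseteq> X \<and> sum r E > ?W / 2"
  \<comment> \<open>Any fraction below 1/2 would do: E0 then carries at least 2/3 of the
    perimeter.\<close>
  obtain E0 where "finite E0" "E0 \<subseteq> X" "dist (sum r E0) ?W \<le> ?W / 3"
    using infsum_finite_approximation[OF assms(1), of "?W / 3"] assms(4) by auto
  then have "?P E0" using assms(4) unfolding dist_real_def by linarith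
  then obtain E where E: "?P E" "\<And>E'. ?P E' \<Longrightarrow> card E \<le> card E'"
    using ex_has_least_nat[of ?P E0 card] by blast
  have "E \<noteq> {}" using E(1) assms(4) by auto
  then obtain k where k: "k \<in> E" by blast
  define x where "x = sum r (E - {k})"
  define z where "z = infsum r (X - E)"
  have "card (E - {k}) < card E" using E(1) k by (meson card_Diff1_less)
  then have "\<not> ?P (E - {k})" using E(2)[of "E - {k}"] by linarith
  then have x2: "x \<le> ?W / 2" using E(1) unfolding x_def by (meson Diff_subset finite_Diff not_le order.trans)
  have sE: "sum r E = x + r k" using sum.remove[of E k r] E(1) k by (simp add: x_def)
  have zW: "z = ?W - sum r E"
    using infsum_Diff[OF assms(1) summable_on_finite, of E] E(1) by (simp add: z_def)
  have nn: "0 \<le> x" "0 \<le> r k" "0 \<le> z"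
    using assms(2) E(1) k by (auto simp: x_def z_def intro!: sum_nonneg infsum_nonneg)
  have "2 * r k \<le> ?W" using assms(3) E(1) k by blast
  \<comment> \<open>The sides x, r k and z add up to the perimeter, so the triangle inequalities say
    that none exceeds half of it: x by minimality of E, r k by hypothesis, z because E carries more
    than half.\<close>
  then obtain u v :: complex where uv: "norm u = 1" "norm v = 1" "of_real x + of_real (r k) * u + of_real z * v = 0"
    using triangle_phases[OF nn] x2 zW sE E(1) by (smt (verit, best) field_sum_of_halves)
  define \<theta> where "\<theta> = (\<lambda>y. if y \<in> E - {k} then 1 else if y = k then u else v)"
  show thesis
  proof (rule that[of \<theta>])
    show "norm (\<theta> y) = 1" for y using uv by (simp add: \<theta>_def)
    let ?h = "\<lambda>y. of_real (r y) * \<theta> y"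
    have rc: "(\<lambda>y. norm (?h y)) summable_on X"
      using assms(1) by (rule summable_on_cong[THEN iffD1, rotated]) (use assms(2) uv in \<open>auto simp: norm_mult \<theta>_def\<close>)
    have "infsum ?h (X - E) = infsum ?h X - infsum ?h E"
      by (rule infsum_Diff[OF abs_summable_summable[OF rc] summable_on_finite]) (use E in auto)
    then have "infsum ?h X = sum ?h E + infsum ?h (X - E)" using E(1) by simp
    also have "sum ?h E = of_real x + of_real (r k) * u"
    proof -
      have "sum ?h E = ?h k + sum ?h (E - {k})" using E(1) k by (simp add: sum.remove)
      also have "sum ?h (E - {k}) = of_real x" unfolding x_def of_real_sum by (intro sum.cong) (auto simp: \<theta>_def)
      finally show ?thesis by (simp add: \<theta>_def)
    qed
    also have "infsum ?h (X - E) = infsum (\<lambda>y. of_real (r y) * v) (X - E)"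
      by (intro infsum_cong) (use k in \<open>auto simp: \<theta>_def\<close>)
    also have "\<dots> = infsum (\<lambda>y. complex_of_real (r y)) (X - E) * v"
      by (rule infsum_cmult_left')
    also have "infsum (\<lambda>y. complex_of_real (r y)) (X - E) = of_real z"
    proof -
      have "(r has_sum z) (X - E)" unfolding z_def
        by (intro has_sum_infsum summable_on_subset_banach[OF assms(1)]) auto
      from has_sum_of_real[OF this] show ?thesis by (rule infsumI)
    qed
    finally show "infsum ?h X = 0" using uv by simp
  qed
qed

text \<open>\<open>Kronecker_thm_1\<close> approximates real numbers modulo 1 under independence
  over the integers. So arguments are divided by 2 pi, the time is multiplied by it, and an integer
  relation is read as a rational one.\<close>

lemma kronecker_phases:
  assumes "real_over_rat.independent \<Lambda>" "finite E" "E \<subseteq> \<Lambda>" "\<epsilon> > 0" "\<And>\<mu>. \<mu> \<in> E \<Longrightarrow> norm (\<omega> \<mu>) = 1"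
  obtains t where "\<And>\<mu>. \<mu> \<in> E \<Longrightarrow> norm (cis (\<mu> * t) - \<omega> \<mu>) \<le> \<epsilon>"
proof -
  interpret int: Modules.module "\<lambda>r. (*) (real_of_int r)"
    by (simp add: Modules.module.intro distrib_left mult.commute)
  obtain e n where e: "bij_betw e {0..<n::nat} E" using ex_bij_betw_nat_finite[OF assms(2)] by blast
  have im: "e ` {..<n} = E" and inj: "inj_on e {..<n}"
    using e by (auto simp: bij_betw_def atLeast0LessThan)
  have ind: "int.independent (e ` {..<n})"
    unfolding im int.dependent_explicit
  proof safe
    fix T u v assume h: "finite T" "T \<subseteq> E" "(\<Sum>v\<in>T. real_of_int (u v) * v) = 0" "v \<in> T" "u v \<noteq> 0"
    have "(\<Sum>v\<in>T. of_rat (of_int (u v)) * v) = (0::real)" using h(3) by simp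
    then have "rat_of_int (u v) = 0"
      using real_over_rat.independentD[OF assms(1) h(1), of "\<lambda>v. of_int (u v)"] h assms(3) by blast
    then show False using h(5) by simp
  qed
  define \<gamma> where "\<gamma> = (\<lambda>i. Arg (\<omega> (e i)) / (2 * pi))"
  obtain t h where th: "\<And>i. i < n \<Longrightarrow> \<bar>t * e i - of_int (h i) - \<gamma> i\<bar> < \<epsilon> / (2 * pi)"
    using Kronecker_thm_1[OF ind inj, of "\<epsilon> / (2 * pi)" \<gamma>] assms(4) by (metis divide_pos_pos pi_gt_zero zero_less_numeral mult_pos_pos)
  show thesis
  proof (rule that[of "2 * pi * t"])
    fix \<mu> assume "\<mu> \<in> E"
    then obtain i where i: "i < n" "\<mu> = e i" using im by auto
    have "\<omega> \<mu> = cis (2 * pi * \<gamma> i)"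
      using rcis_cmod_Arg[of "\<omega> \<mu>"] assms(5)[OF \<open>\<mu> \<in> E\<close>] by (simp add: i \<gamma>_def rcis_def)
    also have "\<dots> = cis (2 * pi * \<gamma> i) * cis (2 * pi * of_int (h i))"
      by (metis Ints_of_int cis_multiple_2pi mult_1_right)
    also have "\<dots> = cis (2 * pi * (of_int (h i) + \<gamma> i))" by (simp add: cis_mult algebra_simps)
    finally have "norm (cis (\<mu> * (2 * pi * t)) - \<omega> \<mu>)
        \<le> \<bar>\<mu> * (2 * pi * t) - 2 * pi * (of_int (h i) + \<gamma> i)\<bar>" by (metis norm_cis_diff_le)
    also have "\<dots> = 2 * pi * \<bar>t * e i - of_int (h i) - \<gamma> i\<bar>"
    proof -
      have "\<mu> * (2 * pi * t) - 2 * pi * (of_int (h i) + \<gamma> i) = 2 * pi * (t * e i - of_int (h i) - \<gamma> i)"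
        by (simp add: i algebra_simps)
      then show ?thesis by (simp add: abs_mult)
    qed
    also have "\<dots> \<le> 2 * pi * (\<epsilon> / (2 * pi))" using th[OF i(1)] by (intro mult_left_mono) auto
    finally show "norm (cis (\<mu> * (2 * pi * t)) - \<omega> \<mu>) \<le> \<epsilon>" by simp
  qed
qed

section \<open>The moduli of the terms as functions of the abscissa\<close>

context strip_ap_independent
begin

definition r :: "real \<Rightarrow> real \<Rightarrow> real" where "r \<sigma> \<mu> = norm (A \<mu>) * exp (\<mu> * \<sigma>)"
text \<open>With the full sum, the inequality of one term against all others becomes
  \<open>2 * r \<sigma> \<mu> \<le> W \<sigma>\<close>, whose right side is the same for every
  exponent.\<close>

definition W :: "real \<Rightarrow> real" where "W \<sigma> = infsum (r \<sigma>) \<Lambda>"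

lemma r_nonneg: "r \<sigma> \<mu> \<ge> 0" by (simp add: r_def)

lemma r_summable: "inside \<sigma> \<Longrightarrow> r \<sigma> summable_on \<Lambda>"
  using abs_summable unfolding r_def by blast

lemma expansion:
  assumes "inside (Re s)"
  shows "f s = (\<Sum>\<^sub>\<infinity>\<mu>\<in>\<Lambda>. A \<mu> * exp (of_real \<mu> * s))"
proof -
  have "exp (of_real \<mu> * s) = of_real (exp (\<mu> * Re s)) * cis (\<mu> * Im s)" for \<mu>
    by (simp add: exp_eq_polar mult_ac)
  then show ?thesis using line_expansion[OF assms, of "Im s"] by (simp add: mult.assoc)
qed

lemma norm_term: "norm (A \<mu> * exp (of_real \<mu> * s)) = r (Re s) \<mu>"
  by (simp add: norm_mult r_def)

text \<open>exp(mu x) is monotone in x, hence largest at one of the two edges. The sum over both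
  edges is a summable majorant for the whole closed strip, on which the uniform estimates below
  rest.\<close>

lemma r_between:
  assumes "\<bar>x - \<sigma>\<bar> \<le> \<delta>"
  shows "r x \<mu> \<le> r (\<sigma> - \<delta>) \<mu> + r (\<sigma> + \<delta>) \<mu>"
proof -
  have "exp (\<mu> * x) \<le> exp (\<mu> * (\<sigma> - \<delta>)) + exp (\<mu> * (\<sigma> + \<delta>))"
  proof (cases "\<mu> \<ge> 0")
    case True
    then have "\<mu> * x \<le> \<mu> * (\<sigma> + \<delta>)" using assms by (intro mult_left_mono) auto
    then show ?thesis by (simp add: add_increasing)
  next
    case False
    then have "\<mu> * x \<le> \<mu> * (\<sigma> - \<delta>)" using assms by (intro mult_left_mono_neg) auto
    then show ?thesis by (simp add: add_increasing2)
  qed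
  then have "norm (A \<mu>) * exp (\<mu> * x) \<le> norm (A \<mu>) * (exp (\<mu> * (\<sigma> - \<delta>)) + exp (\<mu> * (\<sigma> + \<delta>)))"
    by (intro mult_left_mono) auto
  then show ?thesis by (simp add: r_def distrib_left)
qed

lemma W_isCont:
  assumes "inside \<sigma>" shows "isCont W \<sigma>"
proof -
  obtain \<delta> where \<delta>: "\<delta> > 0" "\<And>x. \<bar>x - \<sigma>\<bar> \<le> \<delta> \<Longrightarrow> inside x" using margin[OF assms] by metis
  let ?D = "\<lambda>\<mu>. r (\<sigma> - \<delta>) \<mu> + r (\<sigma> + \<delta>) \<mu>"
  let ?I = "{\<sigma> - \<delta>..\<sigma> + \<delta>}"
  have "uniform_limit ?I (\<lambda>E x. \<Sum>\<mu>\<in>E. r x \<mu>) (\<lambda>x. \<Sum>\<^sub>\<infinity>\<mu>\<in>\<Lambda>. r x \<mu>) (finite_subsets_at_top \<Lambda>)"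
  proof (rule Weierstrass_m_test_general)
    show "?D summable_on \<Lambda>" by (intro summable_on_add r_summable) (use \<delta> in auto)
    fix \<mu> x assume "\<mu> \<in> \<Lambda>" "x \<in> ?I"
    then show "norm (r x \<mu>) \<le> ?D \<mu>" using r_between[of x \<sigma> \<delta> \<mu>] r_nonneg[of x \<mu>] by (auto simp: abs_le_iff)
  qed
  then have "continuous_on ?I (\<lambda>x. \<Sum>\<^sub>\<infinity>\<mu>\<in>\<Lambda>. r x \<mu>)"
    by (rule uniform_limit_theorem[rotated]) (auto simp: r_def intro!: always_eventually continuous_intros)
  then have "continuous_on ?I W" by (simp add: W_def[abs_def])
  then show ?thesis by (rule continuous_on_interior) (use \<delta> in simp)
qed

lemma r_isCont: "isCont (\<lambda>x. r x \<mu>) \<sigma>"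
  unfolding r_def by (intro continuous_intros)

lemma eventually_inside: "inside \<sigma> \<Longrightarrow> \<forall>\<^sub>F x in nhds \<sigma>. inside x"
proof -
  assume "inside \<sigma>"
  then obtain \<delta> where \<delta>: "\<delta> > 0" "\<And>x. \<bar>x - \<sigma>\<bar> \<le> \<delta> \<Longrightarrow> inside x" using margin by metis
  then show ?thesis unfolding eventually_nhds_metric dist_real_def by (metis less_imp_le)
qed

lemma infsum_r_Diff:
  assumes "inside \<sigma>" "\<mu> \<in> \<Lambda>"
  shows "infsum (r \<sigma>) (\<Lambda> - {\<mu>}) = W \<sigma> - r \<sigma> \<mu>"
  using infsum_Diff[OF r_summable[OF assms(1)] summable_on_finite, of "{\<mu>}"] assms(2) by (simp add: W_def)

lemma isCont_tendsto_nhds: "isCont h x \<Longrightarrow> (h \<longlongrightarrow> h x) (nhds x)" for h :: "real \<Rightarrow> real"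
  by (simp add: isCont_def tendsto_at_iff_tendsto_nhds)

lemma no_zero:
  assumes "inside (Re s)" "\<mu> \<in> \<Lambda>" "2 * r (Re s) \<mu> > W (Re s)"
  shows "f s \<noteq> 0"
proof
  assume "f s = 0"
  let ?h = "\<lambda>\<mu>. A \<mu> * exp (of_real \<mu> * s)"
  have "norm (infsum ?h \<Lambda> - sum ?h {\<mu>}) \<le> infsum (r (Re s)) (\<Lambda> - {\<mu>})"
    by (rule infsum_minus_sum_le[OF r_summable[OF assms(1)]]) (use assms norm_term in auto)
  then have "norm (?h \<mu>) \<le> W (Re s) - r (Re s) \<mu>"
    using expansion[OF assms(1)] \<open>f s = 0\<close> infsum_r_Diff[OF assms(1,2)] by simp
  then show False using assms(3) by (simp add: norm_term)
qed

lemma dominant_not_in_closure: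
  assumes "inside \<sigma>" "\<mu> \<in> \<Lambda>" "2 * r \<sigma> \<mu> > W \<sigma>"
  shows "\<sigma> \<notin> closure (Re ` {s \<in> vertical_strip \<alpha> \<beta>. f s = 0})"
proof -
  have "isCont (\<lambda>x. 2 * r x \<mu> - W x) \<sigma>" by (intro continuous_intros W_isCont r_isCont assms)
  from isCont_tendsto_nhds[OF this]
  have "\<forall>\<^sub>F x in nhds \<sigma>. 2 * r x \<mu> - W x > 0" by (rule order_tendstoD) (use assms in simp)
  then obtain d where d: "d > 0" "\<And>x. dist x \<sigma> < d \<Longrightarrow> 2 * r x \<mu> - W x > 0"
    unfolding eventually_nhds_metric by blast
  show ?thesis
  proof
    assume "\<sigma> \<in> closure (Re ` {s \<in> vertical_strip \<alpha> \<beta>. f s = 0})"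
    then obtain s where s: "s \<in> vertical_strip \<alpha> \<beta>" "f s = 0" "dist (Re s) \<sigma> < d"
      using d(1) unfolding closure_approachable by auto
    then show False using no_zero[of s \<mu>] d(2)[of "Re s"] assms(2) by (auto simp: vertical_strip_def)
  qed
qed

section \<open>Limits of vertical translates and their zeros\<close>

text \<open>Kronecker's theorem adjusts the phases on a finite set of exponents; on the others two
  phases differ by at most 2, against a small tail of the majorant. Neither estimate involves Im
  s.\<close>

lemma translates_approximate:
  assumes \<delta>: "\<delta> > 0" "\<And>x. \<bar>x - \<sigma>\<bar> \<le> \<delta> \<Longrightarrow> inside x"
    and \<omega>: "\<And>\<mu>. \<mu> \<in> \<Lambda> \<Longrightarrow> norm (\<omega> \<mu>) = 1" and "\<epsilon> > 0"
  shows "\<exists>t. \<forall>s. \<bar>Re s - \<sigma>\<bar> \<le> \<delta> \<longrightarrow>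
     norm (f (s + \<i> * of_real t) - (\<Sum>\<^sub>\<infinity>\<mu>\<in>\<Lambda>. A \<mu> * \<omega> \<mu> * exp (of_real \<mu> * s))) \<le> \<epsilon>"
proof -
  let ?D = "\<lambda>\<mu>. r (\<sigma> - \<delta>) \<mu> + r (\<sigma> + \<delta>) \<mu>"
  have D: "?D summable_on \<Lambda>" by (intro summable_on_add r_summable) (use \<delta> in auto)
  have Dnn: "?D \<mu> \<ge> 0" for \<mu> using r_nonneg by (simp add: add_nonneg_nonneg)
  have D2: "(\<lambda>\<mu>. ?D \<mu> * 2) summable_on \<Lambda>" by (rule summable_on_cmult_left[OF D])
  obtain E where E: "finite E" "E \<subseteq> \<Lambda>" "infsum (\<lambda>\<mu>. ?D \<mu> * 2) (\<Lambda> - E) \<le> \<epsilon> / 2"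
    by (rule summable_tail[OF D2, of "\<epsilon> / 2"]) (use \<open>\<epsilon> > 0\<close> in \<open>auto simp: r_nonneg\<close>)
  \<comment> \<open>The 1 keeps \<open>M\<close> positive when the finite sum vanishes.\<close>
  define M where "M = sum ?D E + 1"
  define \<eta> where "\<eta> = \<epsilon> / (2 * M)"
  have "sum ?D E \<ge> 0" by (intro sum_nonneg Dnn)
  then have M: "M > 0" by (simp add: M_def)
  then have \<eta>: "\<eta> > 0" using \<open>\<epsilon> > 0\<close> by (simp add: \<eta>_def)
  have "sum ?D E * \<eta> \<le> M * \<eta>" using \<eta> by (intro mult_right_mono) (auto simp: M_def)
  also have "\<dots> = \<epsilon> / 2" using M by (simp add: \<eta>_def)
  finally have \<eta>2: "sum ?D E * \<eta> \<le> \<epsilon> / 2" .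
  obtain t where t: "\<And>\<mu>. \<mu> \<in> E \<Longrightarrow> norm (cis (\<mu> * t) - \<omega> \<mu>) \<le> \<eta>"
    using kronecker_phases[OF independent E(1,2) \<eta>, of \<omega>] \<omega> E(2) by blast
  show ?thesis
  proof (intro exI[of _ t] allI impI)
    fix s assume s: "\<bar>Re s - \<sigma>\<bar> \<le> \<delta>"
    have ins: "inside (Re s)" using \<delta> s by blast
    let ?h = "\<lambda>\<mu>. A \<mu> * exp (of_real \<mu> * s)"
    let ?k = "\<lambda>\<mu>. ?h \<mu> * (cis (\<mu> * t) - \<omega> \<mu>)"
    have h: "norm (?h \<mu>) \<le> ?D \<mu>" for \<mu> unfolding norm_term by (rule r_between[OF s])
    have c2: "norm (cis (\<mu> * t) - \<omega> \<mu>) \<le> 2" if "\<mu> \<in> \<Lambda>" for \<mu>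
      using norm_triangle_ineq4[of "cis (\<mu> * t)" "\<omega> \<mu>"] \<omega>[OF that] by simp
    have k: "norm (?k \<mu>) \<le> ?D \<mu> * 2" if "\<mu> \<in> \<Lambda>" for \<mu>
      unfolding norm_mult[of "?h \<mu>"] by (intro mult_mono h c2 that Dnn) auto
    have sm1: "(\<lambda>\<mu>. A \<mu> * exp (of_real \<mu> * (s + \<i> * of_real t))) summable_on \<Lambda>"
      by (rule abs_summable_summable, unfold norm_term) (use r_summable[OF ins] in simp)
    have sm2: "(\<lambda>\<mu>. A \<mu> * \<omega> \<mu> * exp (of_real \<mu> * s)) summable_on \<Lambda>"
    proof (rule abs_summable_summable)
      show "(\<lambda>\<mu>. norm (A \<mu> * \<omega> \<mu> * exp (of_real \<mu> * s))) summable_on \<Lambda>"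
        using r_summable[OF ins] by (rule summable_on_cong[THEN iffD1, rotated])
          (simp add: norm_mult \<omega> r_def)
    qed
    have ex: "A \<mu> * exp (of_real \<mu> * (s + \<i> * of_real t)) = ?h \<mu> * cis (\<mu> * t)" for \<mu>
      by (simp add: cis_conv_exp distrib_left exp_add mult_ac)
    have "f (s + \<i> * of_real t) - (\<Sum>\<^sub>\<infinity>\<mu>\<in>\<Lambda>. A \<mu> * \<omega> \<mu> * exp (of_real \<mu> * s))
       = (\<Sum>\<^sub>\<infinity>\<mu>\<in>\<Lambda>. A \<mu> * exp (of_real \<mu> * (s + \<i> * of_real t)) + - (A \<mu> * \<omega> \<mu> * exp (of_real \<mu> * s)))"
      using infsum_add[OF sm1 summable_on_uminus[THEN iffD2, OF sm2]] expansion[of "s + \<i> * of_real t"] ins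
      by (simp add: infsum_uminus)
    also have "\<dots> = infsum ?k \<Lambda>" unfolding ex by (intro infsum_cong) (simp add: algebra_simps)
    finally have eq: "f (s + \<i> * of_real t) - (\<Sum>\<^sub>\<infinity>\<mu>\<in>\<Lambda>. A \<mu> * \<omega> \<mu> * exp (of_real \<mu> * s)) = infsum ?k \<Lambda>" .
    have "norm (infsum ?k \<Lambda> - sum ?k E) \<le> \<epsilon> / 2"
      by (rule order.trans[OF infsum_minus_sum_le[OF D2 E(1,2)] E(3)]) (rule k)
    moreover have "norm (sum ?k E) \<le> (\<Sum>\<mu>\<in>E. ?D \<mu> * \<eta>)"
      by (rule order.trans[OF norm_sum sum_mono], unfold norm_mult[of "?h _"], intro mult_mono h t Dnn) auto
    moreover have "(\<Sum>\<mu>\<in>E. ?D \<mu> * \<eta>) = sum ?D E * \<eta>" by (rule sum_distrib_right[symmetric])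
    ultimately show "norm (f (s + \<i> * of_real t) - (\<Sum>\<^sub>\<infinity>\<mu>\<in>\<Lambda>. A \<mu> * \<omega> \<mu> * exp (of_real \<mu> * s))) \<le> \<epsilon>"
      unfolding eq using \<eta>2 norm_triangle_sub[of "infsum ?k \<Lambda>" "sum ?k E"] by linarith
  qed
qed

text \<open>A vertical translate has its zeros at the same abscissas as f. So it is enough that some
  translate vanishes in the strip, the limit \<open>g\<close> of translates having a zero on the
  line at sigma.\<close>

lemma zero_nearby:
  assumes \<delta>: "\<delta> > 0" "\<And>x. \<bar>x - \<sigma>\<bar> \<le> \<delta> \<Longrightarrow> inside x"
    and ineq: "\<And>\<mu>. \<mu> \<in> \<Lambda> \<Longrightarrow> 2 * r \<sigma> \<mu> \<le> W \<sigma>" and "W \<sigma> > 0"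
  obtains s where "\<bar>Re s - \<sigma>\<bar> < \<delta>" "f s = 0"
proof -
  have ins: "inside \<sigma>" using \<delta> by simp
  obtain \<theta> where \<theta>: "\<And>x. norm (\<theta> x :: complex) = 1" "(\<Sum>\<^sub>\<infinity>\<mu>\<in>\<Lambda>. of_real (r \<sigma> \<mu>) * \<theta> \<mu>) = 0"
    using polygon_phases[OF r_summable[OF ins] r_nonneg, folded W_def, OF ineq \<open>W \<sigma> > 0\<close>] by metis
  have Anz: "A \<mu> \<noteq> 0" if "\<mu> \<in> \<Lambda>" for \<mu> using that by (simp add: fourier_exponents_def)
  \<comment> \<open>Removes the argument of \<open>A \<mu>\<close> and inserts the direction of a
    polygon side, so that the series \<open>g\<close> at sigma is the closed polygon.\<close>
  define \<omega> where "\<omega> = (\<lambda>\<mu>. of_real (norm (A \<mu>)) * \<theta> \<mu> / A \<mu>)"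
  have \<omega>: "norm (\<omega> \<mu>) = 1" "A \<mu> * \<omega> \<mu> = of_real (norm (A \<mu>)) * \<theta> \<mu>" if "\<mu> \<in> \<Lambda>" for \<mu>
    using Anz[OF that] \<theta>(1) by (simp_all add: \<omega>_def norm_divide norm_mult)
  define g where "g = (\<lambda>s. \<Sum>\<^sub>\<infinity>\<mu>\<in>\<Lambda>. A \<mu> * \<omega> \<mu> * exp (of_real \<mu> * s))"
  have g0: "g (of_real \<sigma>) = 0"
  proof -
    have "g (of_real \<sigma>) = (\<Sum>\<^sub>\<infinity>\<mu>\<in>\<Lambda>. of_real (r \<sigma> \<mu>) * \<theta> \<mu>)" unfolding g_def
    proof (intro infsum_cong)
      fix \<mu> assume \<mu>: "\<mu> \<in> \<Lambda>"
      have "A \<mu> * \<omega> \<mu> * exp (of_real \<mu> * of_real \<sigma>) = of_real (norm (A \<mu>)) * \<theta> \<mu> * of_real (exp (\<mu> * \<sigma>))"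
        unfolding \<omega>(2)[OF \<mu>] by (simp flip: exp_of_real)
      then show "A \<mu> * \<omega> \<mu> * exp (of_real \<mu> * of_real \<sigma>) = of_real (r \<sigma> \<mu>) * \<theta> \<mu>"
        by (simp add: r_def)
    qed
    then show ?thesis using \<theta>(2) by simp
  qed
  have "\<forall>n. \<exists>t. \<forall>s. \<bar>Re s - \<sigma>\<bar> \<le> \<delta> \<longrightarrow> norm (f (s + \<i> * of_real t) - g s) \<le> 1 / real (Suc n)"
  proof
    fix n
    show "\<exists>t. \<forall>s. \<bar>Re s - \<sigma>\<bar> \<le> \<delta> \<longrightarrow> norm (f (s + \<i> * of_real t) - g s) \<le> 1 / real (Suc n)"
      unfolding g_def by (rule translates_approximate) (use \<delta> \<omega>(1) in auto)
  qed
  then obtain t where t: "\<And>n s. \<bar>Re s - \<sigma>\<bar> \<le> \<delta> \<Longrightarrow> norm (f (s + \<i> * of_real (t n)) - g s) \<le> 1 / real (Suc n)"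
    by metis
  define S where "S = vertical_strip (ereal (\<sigma> - \<delta>)) (ereal (\<sigma> + \<delta>))"
  have S: "s \<in> S \<longleftrightarrow> \<bar>Re s - \<sigma>\<bar> < \<delta>" for s by (auto simp: S_def vertical_strip_def abs_less_iff)
  let ?F = "\<lambda>n s. f (s + \<i> * of_real (t n))"
  have holF: "?F n holomorphic_on S" for n
  proof -
    have "(\<lambda>s. s + \<i> * of_real (t n)) ` S \<subseteq> vertical_strip \<alpha> \<beta>"
      using \<delta>(2) by (auto simp: S vertical_strip_def)
    then show ?thesis
      using holomorphic_on_compose_gen[of "\<lambda>s. s + \<i> * of_real (t n)" S f "vertical_strip \<alpha> \<beta>"] holomorphic
      by (simp add: o_def holomorphic_intros)
  qed
  have ul: "uniform_limit S ?F g sequentially"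
  proof (rule uniform_limitI)
    fix e :: real assume "e > 0"
    then obtain N where N: "1 / real (Suc N) < e" by (metis nat_approx_posE)
    show "\<forall>\<^sub>F n in sequentially. \<forall>s\<in>S. dist (?F n s) (g s) < e"
    proof (rule eventually_sequentiallyI[of N], intro ballI)
      fix n s assume "N \<le> n" "s \<in> S"
      have "1 / real (Suc n) \<le> 1 / real (Suc N)" using \<open>N \<le> n\<close> by (intro divide_left_mono) auto
      then show "dist (?F n s) (g s) < e" using t[of s n] \<open>s \<in> S\<close> N by (simp add: dist_norm S)
    qed
  qed
  have ulK: "uniform_limit K ?F g sequentially" if "K \<subseteq> S" for K
    using uniform_limit_on_subset[OF ul that] .
  have openS: "open S" unfolding S_def by (rule open_vertical_strip)
  have connS: "connected S" unfolding S_def by (rule convex_connected[OF convex_vertical_strip])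
  have holg: "g holomorphic_on S"
  proof (rule holomorphic_uniform_sequence[OF openS holF])
    fix x assume "x \<in> S"
    then obtain d where "d > 0" "cball x d \<subseteq> S" using openS open_contains_cball by blast
    then show "\<exists>d>0. cball x d \<subseteq> S \<and> uniform_limit (cball x d) ?F g sequentially" using ulK by blast
  qed
  have nonconst: "\<not> g constant_on S"
  proof
    assume "g constant_on S"
    moreover have "of_real \<sigma> \<in> S" using \<delta> by (simp add: S)
    \<comment> \<open>A constant \<open>g\<close> is zero because it vanishes at sigma. Its Fourier
      coefficients on that line would then all be zero, although none of the \<open>A \<mu>\<close>
      is.\<close>
    ultimately have gz: "g s = 0" if "s \<in> S" for s using g0 that unfolding constant_on_def by metis
    let ?b = "\<lambda>\<mu>. A \<mu> * \<omega> \<mu> * of_real (exp (\<mu> * \<sigma>))"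
    have sm: "(\<lambda>\<mu>. norm (?b \<mu>)) summable_on \<Lambda>"
      using r_summable[OF ins] by (rule summable_on_cong[THEN iffD1, rotated]) (simp add: norm_mult \<omega>(1) r_def)
    have "trig_series \<Lambda> ?b t = g (Complex \<sigma> t)" for t
      unfolding trig_series_def[OF sm] g_def
      by (intro infsum_cong) (simp add: exp_eq_polar mult.assoc)
    then have tz: "trig_series \<Lambda> ?b t = 0" for t using gz[of "Complex \<sigma> t"] \<delta> by (simp add: S)
    obtain \<mu> where \<mu>: "\<mu> \<in> \<Lambda>" using \<open>W \<sigma> > 0\<close> by (force simp: W_def)
    have "has_mean (\<lambda>t. 0) (?b \<mu>)" using has_mean_trig_series[OF sm, of "- \<mu>"] \<mu> by (simp add: tz)
    then have "?b \<mu> = 0" using has_mean_norm_le[of "\<lambda>t. 0" "?b \<mu>" 0] ap_const by simp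
    then show False using Anz[OF \<mu>] \<omega>(1)[OF \<mu>] by auto
  qed
  have "\<exists>n z. z \<in> S \<and> ?F n z = 0"
  proof (rule ccontr)
    assume "\<not> (\<exists>n z. z \<in> S \<and> ?F n z = 0)"
    then have "g (of_real \<sigma>) \<noteq> 0"
      using \<delta>(1) by (intro Hurwitz_no_zeros[OF openS connS holF holg ulK nonconst]) (auto simp: S)
    then show False using g0 by simp
  qed
  then obtain n z where "z \<in> S" "?F n z = 0" by blast
  then show thesis using that[of "z + \<i> * of_real (t n)"] by (simp add: S)
qed

lemma polygon_in_closure:
  assumes "inside \<sigma>" "\<And>\<mu>. \<mu> \<in> \<Lambda> \<Longrightarrow> 2 * r \<sigma> \<mu> \<le> W \<sigma>" "W \<sigma> > 0"
  shows "\<sigma> \<in> closure (Re ` {s \<in> vertical_strip \<alpha> \<beta>. f s = 0})"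
  unfolding closure_approachable
proof (intro allI impI)
  fix e :: real assume "e > 0"
  obtain \<delta> where \<delta>: "\<delta> > 0" "\<And>x. \<bar>x - \<sigma>\<bar> \<le> \<delta> \<Longrightarrow> inside x" using margin[OF assms(1)] by metis
  have "min \<delta> e > 0" "\<And>x. \<bar>x - \<sigma>\<bar> \<le> min \<delta> e \<Longrightarrow> inside x" using \<delta> \<open>e > 0\<close> by auto
  from this assms(2,3) obtain s where s: "\<bar>Re s - \<sigma>\<bar> < min \<delta> e" "f s = 0"
    by (rule zero_nearby) blast
  then have "inside (Re s)" using \<delta>(2)[of "Re s"] by simp
  then have "Re s \<in> Re ` {s \<in> vertical_strip \<alpha> \<beta>. f s = 0}" using s by (auto simp: vertical_strip_def)
  then show "\<exists>y\<in>Re ` {s \<in> vertical_strip \<alpha> \<beta>. f s = 0}. dist y \<sigma> < e"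
    using s(1) by (auto simp: dist_real_def)
qed

section \<open>Boundary points\<close>

lemma strict_inequalities_open:
  assumes "inside \<sigma>" "\<And>\<mu>. \<mu> \<in> \<Lambda> \<Longrightarrow> 2 * r \<sigma> \<mu> < W \<sigma>" "W \<sigma> > 0"
  shows "\<forall>\<^sub>F x in nhds \<sigma>. W x > 0 \<and> (\<forall>\<mu>\<in>\<Lambda>. 2 * r x \<mu> \<le> W x)"
proof -
  obtain \<delta> where \<delta>: "\<delta> > 0" "\<And>x. \<bar>x - \<sigma>\<bar> \<le> \<delta> \<Longrightarrow> inside x" using margin[OF assms(1)] by metis
  let ?D = "\<lambda>\<mu>. r (\<sigma> - \<delta>) \<mu> + r (\<sigma> + \<delta>) \<mu>"
  have D: "?D summable_on \<Lambda>" by (intro summable_on_add r_summable) (use \<delta> in auto)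
  have Dnn: "?D \<mu> \<ge> 0" for \<mu> using r_nonneg by (simp add: add_nonneg_nonneg)
  \<comment> \<open>A tail of at most W/4 bounds each single term outside \<open>E\<close>, on the
    whole neighbourhood. Doubled it is at most W/2, which nearby totals exceed by
    continuity.\<close>
  obtain E where E: "finite E" "E \<subseteq> \<Lambda>" "infsum ?D (\<Lambda> - E) \<le> W \<sigma> / 4"
    using summable_tail[OF D, of "W \<sigma> / 4"] Dnn assms(3) by auto
  have big: "2 * ?D \<mu> \<le> W \<sigma> / 2" if "\<mu> \<in> \<Lambda> - E" for \<mu>
  proof -
    have "?D summable_on (\<Lambda> - E)" by (rule summable_on_subset_banach[OF D]) auto
    from finite_sum_le_infsum[OF this, of "{\<mu>}"] that Dnn have "?D \<mu> \<le> infsum ?D (\<Lambda> - E)" by auto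
    from order.trans[OF this E(3)] show ?thesis by simp
  qed
  note nhds = isCont_tendsto_nhds[where x = \<sigma>]
  have "\<forall>\<^sub>F x in nhds \<sigma>. W x > W \<sigma> / 2"
    by (rule order_tendstoD[OF nhds[OF W_isCont[OF assms(1)]]]) (use assms(3) in simp)
  moreover have "\<forall>\<^sub>F x in nhds \<sigma>. dist x \<sigma> < \<delta>" using \<delta>(1) eventually_nhds_metric by blast
  moreover have "\<forall>\<^sub>F x in nhds \<sigma>. \<forall>\<mu>\<in>E. W x - 2 * r x \<mu> > 0"
  proof (rule eventually_ball_finite[OF E(1)], intro ballI)
    fix \<mu> assume "\<mu> \<in> E"
    have "isCont (\<lambda>x. W x - 2 * r x \<mu>) \<sigma>" by (intro continuous_intros W_isCont r_isCont assms)
    from nhds[OF this] show "\<forall>\<^sub>F x in nhds \<sigma>. W x - 2 * r x \<mu> > 0"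
      by (rule order_tendstoD) (use assms(2)[of \<mu>] E(2) \<open>\<mu> \<in> E\<close> in auto)
  qed
  ultimately show ?thesis
  proof eventually_elim
    case (elim x)
    have "2 * r x \<mu> \<le> W x" if "\<mu> \<in> \<Lambda>" for \<mu>
    proof (cases "\<mu> \<in> E")
      case True then show ?thesis using elim(3) by force
    next
      case False
      have "r x \<mu> \<le> ?D \<mu>" by (rule r_between) (use elim in \<open>simp add: dist_real_def\<close>)
      then show ?thesis using big[of \<mu>] that False elim(1) by force
    qed
    then show ?case using elim(1) assms(3) by auto
  qed
qed

theorem boundary_equality:
  assumes "inside \<sigma>" "\<sigma> \<in> frontier (zero_abscissas f \<alpha> \<beta>)" "infinite \<Lambda> \<or> 3 \<le> card \<Lambda>"
  shows "(\<forall>\<mu>\<in>\<Lambda>. 2 * r \<sigma> \<mu> \<le> W \<sigma>) \<and> (\<exists>!\<mu>. \<mu> \<in> \<Lambda> \<and> 2 * r \<sigma> \<mu> = W \<sigma>)"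
proof -
  let ?Z = "Re ` {s \<in> vertical_strip \<alpha> \<beta>. f s = 0}"
  have "\<sigma> \<in> closure (zero_abscissas f \<alpha> \<beta>)" using assms(2) by (simp add: frontier_def)
  \<comment> \<open>\<open>zero_abscissas\<close> is closed only relative to the open interval, but
    its closure adds nothing except limits of abscissas of zeros.\<close>
  also have "closure (zero_abscissas f \<alpha> \<beta>) \<subseteq> closure ?Z"
    unfolding zero_abscissas_def by (rule order.trans[OF closure_mono[OF inf_le1]]) simp
  finally have "\<sigma> \<in> closure ?Z" .
  then have le: "2 * r \<sigma> \<mu> \<le> W \<sigma>" if "\<mu> \<in> \<Lambda>" for \<mu>
    using dominant_not_in_closure[OF assms(1) that] by (meson not_le)
  have rpos: "r \<sigma> \<mu> > 0" if "\<mu> \<in> \<Lambda>" for \<mu> using that by (simp add: r_def fourier_exponents_def)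
  obtain T where "T \<subseteq> \<Lambda>" "card T = 3"
    using assms(3) obtain_subset_with_card_n[of 3 \<Lambda>] infinite_arbitrarily_large[of \<Lambda> 3] by blast
  then obtain x y z where xyz: "x \<in> \<Lambda>" "y \<in> \<Lambda>" "z \<in> \<Lambda>" "x \<noteq> y" "x \<noteq> z" "y \<noteq> z"
    by (auto simp: card_3_iff)
  have sum_le: "sum (r \<sigma>) E \<le> W \<sigma>" if "finite E" "E \<subseteq> \<Lambda>" for E
    unfolding W_def by (rule finite_sum_le_infsum[OF r_summable[OF assms(1)] that]) (rule r_nonneg)
  have Wpos: "W \<sigma> > 0" using sum_le[of "{x}"] rpos xyz by force
  have "\<exists>\<mu>. \<mu> \<in> \<Lambda> \<and> 2 * r \<sigma> \<mu> = W \<sigma>"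
  proof (rule ccontr)
    assume "\<not> ?thesis"
    then have "2 * r \<sigma> \<mu> < W \<sigma>" if "\<mu> \<in> \<Lambda>" for \<mu> using le[OF that] that by force
    from assms(1) this Wpos have "\<forall>\<^sub>F x in nhds \<sigma>. W x > 0 \<and> (\<forall>\<mu>\<in>\<Lambda>. 2 * r x \<mu> \<le> W x)"
      by (rule strict_inequalities_open)
    from this eventually_inside[OF assms(1)]
    have "\<forall>\<^sub>F x in nhds \<sigma>. x \<in> zero_abscissas f \<alpha> \<beta>"
    proof eventually_elim
      case (elim x)
      then have "x \<in> closure ?Z" by (intro polygon_in_closure) auto
      then show ?case using elim by (simp add: zero_abscissas_def)
    qed
    then have "\<sigma> \<in> interior (zero_abscissas f \<alpha> \<beta>)"
      unfolding eventually_nhds interior_def by auto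
    then show False using assms(2) by (simp add: frontier_def)
  qed
  moreover have "\<mu> = \<nu>" if "\<mu> \<in> \<Lambda>" "2 * r \<sigma> \<mu> = W \<sigma>" "\<nu> \<in> \<Lambda>" "2 * r \<sigma> \<nu> = W \<sigma>" for \<mu> \<nu>
  proof (rule ccontr)
    assume ne: "\<mu> \<noteq> \<nu>"
    obtain \<kappa> where \<kappa>: "\<kappa> \<in> \<Lambda>" "\<kappa> \<noteq> \<mu>" "\<kappa> \<noteq> \<nu>" using xyz by metis
    have "sum (r \<sigma>) {\<mu>, \<nu>, \<kappa>} \<le> W \<sigma>" by (rule sum_le) (use that \<kappa> in auto)
    then show False using ne \<kappa> that rpos[OF \<kappa>(1)] by auto
  qed
  ultimately show ?thesis using le by blast
qed

end

text \<open>The bijection \<open>lam\<close> carries the unordered sums from exponents to indices,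
  and its injectivity turns the unique exponent with equality into a unique index.\<close>

theorem proposition7:
  fixes f :: "complex \<Rightarrow> complex" and \<alpha> \<beta> :: ereal
    and I :: "nat set" and a :: "nat \<Rightarrow> complex" and lam :: "nat \<Rightarrow> real"
    and \<sigma>\<^sub>0 :: real
  assumes "\<alpha> < \<beta>"
    and "almost_periodic_in_strip f \<alpha> \<beta>"
    and "is_dirichlet_series f \<alpha> \<beta> I a lam"
    and "real_over_rat.independent (fourier_exponents f \<alpha> \<beta>)"
    and "infinite (fourier_exponents f \<alpha> \<beta>) \<or> 3 \<le> card (fourier_exponents f \<alpha> \<beta>)"
    and "\<alpha> < ereal \<sigma>\<^sub>0" and "ereal \<sigma>\<^sub>0 < \<beta>"
    and "\<sigma>\<^sub>0 \<in> frontier (zero_abscissas f \<alpha> \<beta>)"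
  shows "(\<forall>j\<in>I. norm (a j) * exp (\<sigma>\<^sub>0 * lam j)
              \<le> (\<Sum>\<^sub>\<infinity>i\<in>I - {j}. norm (a i) * exp (\<sigma>\<^sub>0 * lam i)))
       \<and> (\<exists>!j. j \<in> I \<and> norm (a j) * exp (\<sigma>\<^sub>0 * lam j)
              = (\<Sum>\<^sub>\<infinity>i\<in>I - {j}. norm (a i) * exp (\<sigma>\<^sub>0 * lam i)))"
proof -
  interpret strip_ap_independent f \<alpha> \<beta> by unfold_locales (fact assms)+
  have ins: "inside \<sigma>\<^sub>0" using assms by blast
  have bij: "bij_betw lam I \<Lambda>" and a: "\<And>n. n \<in> I \<Longrightarrow> a n = A (lam n)"
    using assms(3) by (auto simp: is_dirichlet_series_def)
  have tm: "norm (a j) * exp (\<sigma>\<^sub>0 * lam j) = r \<sigma>\<^sub>0 (lam j)" if "j \<in> I" for j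
    using a[OF that] by (simp add: r_def mult.commute)
  have rest: "(\<Sum>\<^sub>\<infinity>i\<in>I - {j}. norm (a i) * exp (\<sigma>\<^sub>0 * lam i)) = W \<sigma>\<^sub>0 - r \<sigma>\<^sub>0 (lam j)" if j: "j \<in> I" for j
  proof -
    have bij': "bij_betw lam (I - {j}) (\<Lambda> - {lam j})" using bij_betw_DiffI[OF bij, of "{j}" "{lam j}"] j bij_betwE[OF bij] by simp
    have "(\<Sum>\<^sub>\<infinity>i\<in>I - {j}. norm (a i) * exp (\<sigma>\<^sub>0 * lam i)) = (\<Sum>\<^sub>\<infinity>i\<in>I - {j}. r \<sigma>\<^sub>0 (lam i))"
      by (intro infsum_cong tm) auto
    also have "\<dots> = infsum (r \<sigma>\<^sub>0) (\<Lambda> - {lam j})" by (rule infsum_reindex_bij_betw[OF bij'])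
    also have "\<dots> = W \<sigma>\<^sub>0 - r \<sigma>\<^sub>0 (lam j)" using bij j by (intro infsum_r_Diff[OF ins]) (auto simp: bij_betw_def)
    finally show ?thesis .
  qed
  have main: "\<And>\<mu>. \<mu> \<in> \<Lambda> \<Longrightarrow> 2 * r \<sigma>\<^sub>0 \<mu> \<le> W \<sigma>\<^sub>0" "\<exists>!\<mu>. \<mu> \<in> \<Lambda> \<and> 2 * r \<sigma>\<^sub>0 \<mu> = W \<sigma>\<^sub>0"
    using boundary_equality[OF ins assms(8,5)] by blast+
  have mem: "lam j \<in> \<Lambda>" if "j \<in> I" for j using bij that by (auto simp: bij_betw_def)
  have "\<forall>j\<in>I. norm (a j) * exp (\<sigma>\<^sub>0 * lam j) \<le> (\<Sum>\<^sub>\<infinity>i\<in>I - {j}. norm (a i) * exp (\<sigma>\<^sub>0 * lam i))"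
  proof
    fix j assume "j \<in> I"
    then show "norm (a j) * exp (\<sigma>\<^sub>0 * lam j) \<le> (\<Sum>\<^sub>\<infinity>i\<in>I - {j}. norm (a i) * exp (\<sigma>\<^sub>0 * lam i))"
      using main(1)[OF mem] by (simp only: tm rest) simp
  qed
  moreover have eq: "norm (a j) * exp (\<sigma>\<^sub>0 * lam j) = (\<Sum>\<^sub>\<infinity>i\<in>I - {j}. norm (a i) * exp (\<sigma>\<^sub>0 * lam i))
      \<longleftrightarrow> 2 * r \<sigma>\<^sub>0 (lam j) = W \<sigma>\<^sub>0" if "j \<in> I" for j
    unfolding tm[OF that] rest[OF that] by linarith
  have "\<exists>!j. j \<in> I \<and> norm (a j) * exp (\<sigma>\<^sub>0 * lam j) = (\<Sum>\<^sub>\<infinity>i\<in>I - {j}. norm (a i) * exp (\<sigma>\<^sub>0 * lam i))"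
  proof -
    obtain \<mu> where \<mu>: "\<mu> \<in> \<Lambda>" "2 * r \<sigma>\<^sub>0 \<mu> = W \<sigma>\<^sub>0" using main(2) by blast
    have "\<mu> \<in> lam ` I" using \<mu>(1) by (simp only: bij_betw_imp_surj_on[OF bij])
    then obtain j where j: "j \<in> I" "lam j = \<mu>" by blast
    show ?thesis
    proof (rule ex1I[of _ j])
      show "j \<in> I \<and> norm (a j) * exp (\<sigma>\<^sub>0 * lam j) = (\<Sum>\<^sub>\<infinity>i\<in>I - {j}. norm (a i) * exp (\<sigma>\<^sub>0 * lam i))"
        using j \<mu>(2) eq by blast
      fix i assume "i \<in> I \<and> norm (a i) * exp (\<sigma>\<^sub>0 * lam i) = (\<Sum>\<^sub>\<infinity>l\<in>I - {i}. norm (a l) * exp (\<sigma>\<^sub>0 * lam l))"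
      then have i: "i \<in> I" "2 * r \<sigma>\<^sub>0 (lam i) = W \<sigma>\<^sub>0" using eq by blast+
      then have "lam i = \<mu>" using main(2) \<mu> mem by blast
      then show "i = j" using inj_onD[OF bij_betw_imp_inj_on[OF bij] _ i(1) j(1)] j(2) by simp
    qed
  qed
  ultimately show ?thesis by blast
qed

end
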